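(* Let $\mathcal U,\mathcal X,\mathcal Y$ be Hilbert spaces, let $A:\mathcal X\to\mathcal X$, $B:\mathcal U\to\mathcal X$, $C:\mathcal X\to\mathcal Y$, $D:\mathcal U\to\mathcal Y$ be bounded linear operators, let $\Sigma$ be the associated discrete-time linear system, and let $F_\Sigma(\lambda)=D+\lambda C(I-\lambda A)^{-1}B$ be its transfer function, defined near $0$. (1) Suppose that $\Sigma$ is minimal, i.e., $(A,B)$ is controllable and $(C,A)$ is observable. Then $F_\Sigma$ has an analytic continuation to a function in the Schur class $\mathcal S(\mathcal U,\mathcal Y)$ if and only if there exists a positive-definite solution $H$ of the generalized KYP-inequality: $H$ is a closed, possibly unbounded, densely defined, positive-definite (and hence injective) operator on $\mathcal X$ such that $A\,\mathcal D(H^{1/2})\subset\mathcal D(H^{1/2})$, $B\,\mathcal U\subset\mathcal D(H^{1/2})$, and $$\|H^{1/2}x\|^2+\|u\|^2-\|H^{1/2}(Ax+Bu)\|^2-\|Cx+Du\|^2\ge 0\quad\text{for all }x\in\mathcal D(H^{1/2}),\ u\in\mathcal U.$$ (2) Suppose that $\Sigma$ is exactly minimal. Then $F_\Sigma$ has an analytic continuation to a function in the Schur class $\mathcal S(\mathcal U,\mathcal Y)$ if and only if there exists a bounded, strictly positive-definite solution $H$ of the KYP-inequality $$\begin{bmatrix}A&B\\C&D\end{bmatrix}^*\begin{bmatrix}H&0\\0&I_{\mathcal Y}\end{bmatrix}\begin{bmatrix}A&B\\C&D\end{bmatrix}\preceq\begin{bmatrix}H&0\\0&I_{\mathcal U}\end{bmatrix}.$$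 In this case $A$ has spectral radius at most one, and hence $F_\Sigma$ is in fact analytic on $\mathbb D$. (3) Statement (2) continues to hold if the hypothesis that $\Sigma$ be exactly minimal is replaced by the hypothesis that $\Sigma$ be $\ell^2$-exactly minimal.
   Context: System: $\Sigma$ is $\mathbf x(n+1)=A\mathbf x(n)+B\mathbf u(n)$, $\mathbf y(n)=C\mathbf x(n)+D\mathbf u(n)$. The Schur class $\mathcal S(\mathcal U,\mathcal Y)$ is the set of holomorphic functions $F:\mathbb D\to\mathcal L(\mathcal U,\mathcal Y)$ on the open unit disk with $\|F(\lambda)\|\le1$ for all $\lambda\in\mathbb D$. Positivity: a (possibly unbounded) selfadjoint operator $H$ on $\mathcal X$ with dense domain $\mathcal D(H)$ is positive-definite if $\langle Hx,x\rangle>0$ for all nonzero $x\in\mathcal D(H)$, positive-semidefinite ($H\succeq0$) if $\langle Hx,x\rangle\ge0$ for all $x\in\mathcal D(H)$, and strictly positive-definite ($H\succ0$) if there is $\delta>0$ with $\langle Hx,x\rangle\ge\delta\|x\|^2$ for all $x\in\mathcal D(H)$. $H^{1/2}$ is the positive-semidefinite square root of a positive-semidefinite $H$. For bounded selfadjoint operators $X\preceq Y$ means $Y-X\succeq0$. Controllability/observability: $\mathrm{Rea}(A|B)$ is the (algebraic) linear span of the subspaces $\mathrm{Im}\,A^kB$, $k=0,1,2,\dots$, and $\mathrm{Obs}(C|A)$ is the linear span of $\mathrm{Im}\,A^{*k}C^*$, $k=0,1,2,\dots$. $(A,B)$ is controllable if $\mathrm{Rea}(A|B)$ is dense in $\mathcal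 X$, and exactly controllable if $\mathrm{Rea}(A|B)=\mathcal X$. $(C,A)$ is observable if $\mathrm{Obs}(C|A)$ is dense in $\mathcal X$, and exactly observable if $\mathrm{Obs}(C|A)=\mathcal X$. $\Sigma$ is minimal if $(A,B)$ is controllable and $(C,A)$ is observable; exactly minimal if $(A,B)$ is exactly controllable and $(C,A)$ is exactly observable. $\ell^2$-notions: $\mathbb Z_+=\{0,1,2,\dots\}$, $\mathbb Z_-=\{-1,-2,\dots\}$. The observability operator $\mathbf W_o$ has domain $\mathcal D(\mathbf W_o)=\{x\in\mathcal X:\{CA^nx\}_{n\ge0}\in\ell^2_{\mathcal Y}(\mathbb Z_+)\}$ and action $\mathbf W_ox=\{CA^nx\}_{n\ge0}$. The adjoint controllability operator $\mathbf W_c^*$ has domain $\mathcal D(\mathbf W_c^* )=\{x\in\mathcal X:\{B^*A^{*(-n-1)}x\}_{n\le-1}\in\ell^2_{\mathcal U}(\mathbb Z_-)\}$ and action $\mathbf W_c^*x=\{B^*A^{*(-n-1)}x\}_{n\le-1}$. Both are closed. When $\mathcal D(\mathbf W_c^* )$ is dense, the controllability operator is the adjoint $\mathbf W_c=(\mathbf W_c^* )^*$; when $\mathcal D(\mathbf W_o)$ is dense, $\mathbf W_o^*$ is the adjoint of $\mathbf W_o$. $\Sigma$ (or $(A,B)$) is $\ell^2$-exactly controllable if $\mathcal D(\mathbf W_c^* )$ is dense in $\mathcal X$ and $\mathbf W_c\,\mathcal D(\mathbf W_c)=\mathcal X$; $\Sigma$ (or $(C,A)$) is $\ell^2$-exactly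 observable if $\mathcal D(\mathbf W_o)$ is dense in $\mathcal X$ and $\mathbf W_o^*\,\mathcal D(\mathbf W_o^* )=\mathcal X$; $\Sigma$ is $\ell^2$-exactly minimal if both hold. *)

theory Defs
  imports "HOL-Analysis.Analysis"
begin

section \<open>Complex Hilbert spaces\<close>

text \<open>The inner product \<open>cinner\<close> is linear in its first argument. Topology and norm are those of
  the underlying real inner product space, whose inner product is \<open>Re (cinner x y)\<close>.\<close>

class complex_inner = real_inner +
  fixes scaleC :: "complex \<Rightarrow> 'a \<Rightarrow> 'a" (infixr \<open>*\<^sub>C\<close> 75)
    and cinner :: "'a \<Rightarrow> 'a \<Rightarrow> complex"
  assumes scaleC_add_right: "c *\<^sub>C (x + y) = c *\<^sub>C x + c *\<^sub>C y"
    and scaleC_add_left: "(c + d) *\<^sub>C x = c *\<^sub>C x + d *\<^sub>C x"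
    and scaleC_scaleC: "c *\<^sub>C d *\<^sub>C x = (c * d) *\<^sub>C x"
    and scaleC_one: "1 *\<^sub>C x = x"
    and scaleR_scaleC: "scaleR r x = complex_of_real r *\<^sub>C x"
    and cinner_commute: "cinner x y = cnj (cinner y x)"
    and cinner_add_left: "cinner (x + y) z = cinner x z + cinner y z"
    and cinner_scaleC_left: "cinner (c *\<^sub>C x) y = c * cinner x y"
    and inner_eq_Re_cinner: "inner x y = Re (cinner x y)"

class chilbert_space = complex_inner + complete_space

instance chilbert_space \<subseteq> banach ..

interpretation complex_vector: vector_space "scaleC :: complex \<Rightarrow> 'a::complex_inner \<Rightarrow> 'a"
  by unfold_locales
    (simp_all add: scaleC_add_right scaleC_add_left scaleC_scaleC scaleC_one)

abbreviation cspan :: "'a::complex_inner set \<Rightarrow> 'a set"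
  where "cspan \<equiv> module.span scaleC"

lemma cinner_self: "cinner x x = complex_of_real ((norm x)\<^sup>2)"
proof (rule complex_eqI)
  show "Re (cinner x x) = Re (complex_of_real ((norm x)\<^sup>2))"
    by (simp add: inner_eq_Re_cinner[symmetric] power2_norm_eq_inner)
  have "Im (cinner x x) = Im (cnj (cinner x x))"
    by (metis cinner_commute)
  then show "Im (cinner x x) = Im (complex_of_real ((norm x)\<^sup>2))"
    by simp
qed

lemma cinner_scaleC_right: "cinner x (c *\<^sub>C y) = cnj c * cinner x y"
  by (metis cinner_commute cinner_scaleC_left complex_cnj_mult)

lemma norm_scaleC: "norm (c *\<^sub>C x) = cmod c * norm x"
proof -
  have "complex_of_real ((norm (c *\<^sub>C x))\<^sup>2) = c * cnj c * complex_of_real ((norm x)\<^sup>2)"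
    by (metis cinner_self cinner_scaleC_left cinner_scaleC_right mult.assoc mult.commute)
  also have "\<dots> = complex_of_real ((cmod c * norm x)\<^sup>2)"
    by (simp only: power_mult_distrib of_real_mult complex_norm_square[of c])
  finally have "(norm (c *\<^sub>C x))\<^sup>2 = (cmod c * norm x)\<^sup>2"
    using of_real_eq_iff by blast
  then show ?thesis
    by simp
qed

lemma Im_cinner: "Im (cinner x y) = inner ((- \<i>) *\<^sub>C x) y"
  by (simp only: inner_eq_Re_cinner cinner_scaleC_left) simp

instantiation complex :: complex_inner
begin

definition scaleC_complex_def: "c *\<^sub>C (x::complex) = c * x"

definition cinner_complex_def: "cinner (x::complex) y = x * cnj y"

instance
  by standard
    (auto simp: scaleC_complex_def cinner_complex_def algebra_simps inner_complex_def
      scaleR_conv_of_real)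

end

instance complex :: chilbert_space ..

instantiation prod :: (complex_inner, complex_inner) complex_inner
begin

definition scaleC_prod_def: "c *\<^sub>C z = (c *\<^sub>C fst z, c *\<^sub>C snd z)"

definition cinner_prod_def: "cinner z w = cinner (fst z) (fst w) + cinner (snd z) (snd w)"

instance
proof
  fix z w :: "'a \<times> 'b"
  show "cinner z w = cnj (cinner w z)"
    unfolding cinner_prod_def complex_cnj_add by (metis cinner_commute)
qed (auto simp: scaleC_prod_def cinner_prod_def scaleC_add_right scaleC_add_left scaleC_scaleC
    scaleC_one scaleR_scaleC scaleR_prod_def cinner_add_left cinner_scaleC_left inner_prod_def
    inner_eq_Re_cinner algebra_simps)

end

instance prod :: (chilbert_space, chilbert_space) chilbert_space ..

section \<open>Square summable sequences\<close>

typedef (overloaded) 'a ell2 = "{f :: nat \<Rightarrow> 'a::real_inner. summable (\<lambda>n. (norm (f n))\<^sup>2)}"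
  morphisms ell2_nth Abs_ell2
  by (rule exI[of _ "\<lambda>_. 0"]) simp

setup_lifting type_definition_ell2

lemma ell2_summable: "summable (\<lambda>n. (norm (ell2_nth f n))\<^sup>2)"
  using ell2_nth by auto

lemma square_summable_add:
  fixes f g :: "nat \<Rightarrow> 'a::real_inner"
  assumes "summable (\<lambda>n. (norm (f n))\<^sup>2)" "summable (\<lambda>n. (norm (g n))\<^sup>2)"
  shows "summable (\<lambda>n. (norm (f n + g n))\<^sup>2)"
proof (rule summable_comparison_test')
  show "summable (\<lambda>n. 2 * (norm (f n))\<^sup>2 + 2 * (norm (g n))\<^sup>2)"
    using assms by (intro summable_add summable_mult)
  fix n
  have "(norm (f n + g n))\<^sup>2 \<le> (norm (f n) + norm (g n))\<^sup>2"
    by (simp add: norm_triangle_ineq power_mono)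
  also have "\<dots> \<le> 2 * (norm (f n))\<^sup>2 + 2 * (norm (g n))\<^sup>2"
    using zero_le_power2[of "norm (f n) - norm (g n)"] by (simp add: power2_eq_square algebra_simps)
  finally show "norm ((norm (f n + g n))\<^sup>2) \<le> 2 * (norm (f n))\<^sup>2 + 2 * (norm (g n))\<^sup>2"
    by simp
qed

lemma square_summable_mult:
  fixes f g :: "nat \<Rightarrow> 'a::real_inner"
  assumes "summable (\<lambda>n. (norm (f n))\<^sup>2)" "summable (\<lambda>n. (norm (g n))\<^sup>2)"
  shows "summable (\<lambda>n. norm (f n) * norm (g n))"
proof (rule summable_comparison_test')
  show "summable (\<lambda>n. (norm (f n))\<^sup>2 + (norm (g n))\<^sup>2)"
    using assms by (rule summable_add)
  fix n
  have "0 \<le> norm (f n) * norm (g n)"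
    by simp
  then show "norm (norm (f n) * norm (g n)) \<le> (norm (f n))\<^sup>2 + (norm (g n))\<^sup>2"
    using zero_le_power2[of "norm (f n) - norm (g n)"]
    by (simp only: real_norm_def abs_of_nonneg power2_diff)
qed

lemma square_summable_inner:
  fixes f g :: "nat \<Rightarrow> 'a::real_inner"
  assumes "summable (\<lambda>n. (norm (f n))\<^sup>2)" "summable (\<lambda>n. (norm (g n))\<^sup>2)"
  shows "summable (\<lambda>n. inner (f n) (g n))"
  using summable_comparison_test'[OF square_summable_mult[OF assms], of 0 "\<lambda>n. inner (f n) (g n)"]
    Cauchy_Schwarz_ineq2 by auto

instantiation ell2 :: (real_inner) real_vector
begin

lift_definition zero_ell2 :: "'a ell2" is "\<lambda>_. 0"
  by simp

lift_definition plus_ell2 :: "'a ell2 \<Rightarrow> 'a ell2 \<Rightarrow> 'a ell2" is "\<lambda>f g n. f n + g n"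
  by (rule square_summable_add)

lift_definition uminus_ell2 :: "'a ell2 \<Rightarrow> 'a ell2" is "\<lambda>f n. - f n"
  by simp

lift_definition minus_ell2 :: "'a ell2 \<Rightarrow> 'a ell2 \<Rightarrow> 'a ell2" is "\<lambda>f g n. f n - g n"
proof -
  fix f g :: "nat \<Rightarrow> 'a"
  assume "summable (\<lambda>n. (norm (f n))\<^sup>2)" "summable (\<lambda>n. (norm (g n))\<^sup>2)"
  then show "summable (\<lambda>n. (norm (f n - g n))\<^sup>2)"
    using square_summable_add[of f "\<lambda>n. - g n"] by simp
qed

lift_definition scaleR_ell2 :: "real \<Rightarrow> 'a ell2 \<Rightarrow> 'a ell2" is "\<lambda>r f n. r *\<^sub>R f n"
  by (simp add: power_mult_distrib)

instance
  by (standard; transfer; simp add: algebra_simps)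

end

instantiation ell2 :: (real_inner) real_inner
begin

definition inner_ell2 :: "'a ell2 \<Rightarrow> 'a ell2 \<Rightarrow> real"
  where "inner_ell2 f g = (\<Sum>n. inner (ell2_nth f n) (ell2_nth g n))"

definition norm_ell2 :: "'a ell2 \<Rightarrow> real"
  where "norm_ell2 f = sqrt (\<Sum>n. (norm (ell2_nth f n))\<^sup>2)"

definition sgn_ell2 :: "'a ell2 \<Rightarrow> 'a ell2"
  where "sgn_ell2 f = f /\<^sub>R norm f"

definition dist_ell2 :: "'a ell2 \<Rightarrow> 'a ell2 \<Rightarrow> real"
  where "dist_ell2 f g = norm (f - g)"

definition uniformity_ell2 :: "('a ell2 \<times> 'a ell2) filter"
  where "uniformity_ell2 = (INF e\<in>{0 <..}. principal {(x, y). dist x y < e})"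

definition open_ell2 :: "'a ell2 set \<Rightarrow> bool"
  where "open_ell2 U = (\<forall>x\<in>U. \<forall>\<^sub>F (x', y) in uniformity. x' = x \<longrightarrow> y \<in> U)"

instance
proof
  fix f g h :: "'a ell2" and r :: real
  show "sgn f = f /\<^sub>R norm f"
    by (rule sgn_ell2_def)
  show "dist f g = norm (f - g)"
    by (rule dist_ell2_def)
  show "uniformity = (INF e\<in>{0 <..}. principal {(x, y :: 'a ell2). dist x y < e})"
    by (rule uniformity_ell2_def)
  show "open U = (\<forall>x\<in>U. \<forall>\<^sub>F (x', y) in uniformity. x' = x \<longrightarrow> y \<in> U)" for U :: "'a ell2 set"
    by (rule open_ell2_def)
  have sm: "summable (\<lambda>n. inner (ell2_nth f n) (ell2_nth g n))" for f g :: "'a ell2"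
    by (intro square_summable_inner ell2_summable)
  show "inner f g = inner g f"
    by (simp add: inner_ell2_def inner_commute)
  show "inner (f + g) h = inner f h + inner g h"
    by (simp add: inner_ell2_def plus_ell2.rep_eq inner_add_left suminf_add sm)
  show "inner (r *\<^sub>R f) g = r * inner f g"
    by (simp add: inner_ell2_def scaleR_ell2.rep_eq suminf_mult sm)
  show "0 \<le> inner f f"
    unfolding inner_ell2_def by (rule suminf_nonneg[OF sm]) simp
  show "inner f f = 0 \<longleftrightarrow> f = 0"
    unfolding inner_ell2_def by (subst suminf_eq_zero_iff[OF sm])
      (auto simp: zero_ell2.rep_eq ell2_nth_inject[symmetric])
  show "norm f = sqrt (inner f f)"
    by (simp add: inner_ell2_def norm_ell2_def power2_norm_eq_inner)
qed

end

lemma norm_ell2_le_iff: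
  assumes "0 \<le> e"
  shows "norm f \<le> e \<longleftrightarrow> (\<forall>m. (\<Sum>n<m. (norm (ell2_nth f n))\<^sup>2) \<le> e\<^sup>2)"
proof -
  have "norm f \<le> e \<longleftrightarrow> (\<Sum>n. (norm (ell2_nth f n))\<^sup>2) \<le> e\<^sup>2"
    unfolding norm_ell2_def
    using assms real_sqrt_le_iff[of "\<Sum>n. (norm (ell2_nth f n))\<^sup>2" "e\<^sup>2"] by simp
  also have "\<dots> \<longleftrightarrow> (\<forall>m. (\<Sum>n<m. (norm (ell2_nth f n))\<^sup>2) \<le> e\<^sup>2)"
    (is "?s \<le> _ \<longleftrightarrow> _")
  proof
    assume *: "?s \<le> e\<^sup>2"
    have "(\<Sum>n<m. (norm (ell2_nth f n))\<^sup>2) \<le> ?s" for m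
      by (rule sum_le_suminf[OF ell2_summable]) auto
    with * show "\<forall>m. (\<Sum>n<m. (norm (ell2_nth f n))\<^sup>2) \<le> e\<^sup>2"
      using order_trans by blast
  qed (simp add: suminf_le_const[OF ell2_summable])
  finally show ?thesis .
qed

lemma norm_ell2_nth_le: "norm (ell2_nth f n) \<le> norm f"
proof -
  have "(norm (ell2_nth f n))\<^sup>2 \<le> (\<Sum>k<Suc n. (norm (ell2_nth f k))\<^sup>2)"
    by (simp add: sum_nonneg)
  also have "\<dots> \<le> (norm f)\<^sup>2"
    using norm_ell2_le_iff[of "norm f" f, THEN iffD1, rule_format, of "Suc n"] by simp
  finally show ?thesis
    by (simp add: power2_le_iff_abs_le)
qed

instance ell2 :: ("{real_inner, complete_space}") complete_space
proof
  fix X :: "nat \<Rightarrow> 'a ell2"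
  assume X: "Cauchy X"
  have "Cauchy (\<lambda>m. ell2_nth (X m) n)" for n
  proof (rule metric_CauchyI)
    fix e :: real
    assume "0 < e"
    then obtain M where "\<forall>m\<ge>M. \<forall>k\<ge>M. dist (X m) (X k) < e"
      using X metric_CauchyD by blast
    moreover have "dist (ell2_nth (X m) n) (ell2_nth (X k) n) \<le> dist (X m) (X k)" for m k
      using norm_ell2_nth_le[of "X m - X k" n] by (simp add: dist_norm minus_ell2.rep_eq)
    ultimately show "\<exists>M. \<forall>m\<ge>M. \<forall>k\<ge>M. dist (ell2_nth (X m) n) (ell2_nth (X k) n) < e"
      by (meson le_less_trans)
  qed
  then have "\<forall>n. \<exists>l. (\<lambda>m. ell2_nth (X m) n) \<longlonglongrightarrow> l"
    using Cauchy_convergent_iff convergent_def by blast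
  then obtain l where l: "\<And>n. (\<lambda>m. ell2_nth (X m) n) \<longlonglongrightarrow> l n"
    by metis
  have tail: "\<exists>M. \<forall>m\<ge>M. \<forall>j. (\<Sum>n<j. (norm (ell2_nth (X m) n - l n))\<^sup>2) \<le> e\<^sup>2" if "0 < e" for e
  proof -
    obtain M where M: "\<And>m k. m \<ge> M \<Longrightarrow> k \<ge> M \<Longrightarrow> dist (X m) (X k) < e"
      using X metric_CauchyD \<open>0 < e\<close> by blast
    have "(\<Sum>n<j. (norm (ell2_nth (X m) n - l n))\<^sup>2) \<le> e\<^sup>2" if "m \<ge> M" for m j
    proof (rule LIMSEQ_le_const2)
      show "(\<lambda>k. \<Sum>n<j. (norm (ell2_nth (X m) n - ell2_nth (X k) n))\<^sup>2)
        \<longlonglongrightarrow> (\<Sum>n<j. (norm (ell2_nth (X m) n - l n))\<^sup>2)"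
        by (intro tendsto_intros l)
      have "(\<Sum>n<j. (norm (ell2_nth (X m) n - ell2_nth (X k) n))\<^sup>2) \<le> e\<^sup>2" if "k \<ge> M" for k
        using norm_ell2_le_iff[of e "X m - X k"] M[OF \<open>m \<ge> M\<close> that] \<open>0 < e\<close>
        by (simp add: dist_norm minus_ell2.rep_eq)
      then show "\<exists>N. \<forall>k\<ge>N. (\<Sum>n<j. (norm (ell2_nth (X m) n - ell2_nth (X k) n))\<^sup>2) \<le> e\<^sup>2"
        by blast
    qed
    then show ?thesis
      by blast
  qed
  obtain M where M: "\<And>j. (\<Sum>n<j. (norm (ell2_nth (X M) n - l n))\<^sup>2) \<le> 1\<^sup>2"
    using tail[of 1] by auto
  have "summable (\<lambda>n. (norm (ell2_nth (X M) n - l n))\<^sup>2)"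
    by (rule summableI_nonneg_bounded[of _ "1\<^sup>2"]) (use M in auto)
  then have "summable (\<lambda>n. (norm (ell2_nth (X M) n + - (ell2_nth (X M) n - l n)))\<^sup>2)"
    by (intro square_summable_add ell2_summable) (simp only: norm_minus_cancel)
  then have "summable (\<lambda>n. (norm (l n))\<^sup>2)"
    by simp
  then have L: "ell2_nth (Abs_ell2 l) = l"
    by (simp add: Abs_ell2_inverse)
  have "X \<longlonglongrightarrow> Abs_ell2 l"
  proof (rule metric_LIMSEQ_I)
    fix e :: real
    assume e: "0 < e"
    obtain N where "\<And>m j. m \<ge> N \<Longrightarrow> (\<Sum>n<j. (norm (ell2_nth (X m) n - l n))\<^sup>2) \<le> (e / 2)\<^sup>2"
      using tail[of "e / 2"] e by auto
    then have "norm (X m - Abs_ell2 l) \<le> e / 2" if "m \<ge> N" for m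
      using that e by (subst norm_ell2_le_iff) (auto simp: minus_ell2.rep_eq L)
    then show "\<exists>N. \<forall>m\<ge>N. dist (X m) (Abs_ell2 l) < e"
      using e by (intro exI[of _ N]) (force simp: dist_norm)
  qed
  then show "convergent X"
    by (auto simp: convergent_def)
qed

instantiation ell2 :: (complex_inner) complex_inner
begin

lift_definition scaleC_ell2 :: "complex \<Rightarrow> 'a ell2 \<Rightarrow> 'a ell2" is "\<lambda>c f n. c *\<^sub>C f n"
  by (simp add: norm_scaleC power_mult_distrib)

definition cinner_ell2 :: "'a ell2 \<Rightarrow> 'a ell2 \<Rightarrow> complex"
  where "cinner_ell2 f g = (\<Sum>n. cinner (ell2_nth f n) (ell2_nth g n))"

instance
proof
  fix f g h :: "'a ell2" and r :: real and c d :: complex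
  show "c *\<^sub>C (f + g) = c *\<^sub>C f + c *\<^sub>C g" "(c + d) *\<^sub>C f = c *\<^sub>C f + d *\<^sub>C f"
    "c *\<^sub>C d *\<^sub>C f = (c * d) *\<^sub>C f" "1 *\<^sub>C f = f"
    "r *\<^sub>R f = complex_of_real r *\<^sub>C f"
    by (transfer; simp add: scaleC_add_right scaleC_add_left scaleC_scaleC scaleC_one
        scaleR_scaleC)+
  have sm: "summable (\<lambda>n. cinner (ell2_nth f n) (ell2_nth g n))" for f g :: "'a ell2"
  proof -
    have "summable (\<lambda>n. inner (ell2_nth f n) (ell2_nth g n))"
      "summable (\<lambda>n. inner (ell2_nth ((- \<i>) *\<^sub>C f) n) (ell2_nth g n))"
      by (intro square_summable_inner ell2_summable)+
    then show ?thesis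
      unfolding summable_complex_iff
      by (simp only: inner_eq_Re_cinner[symmetric] Im_cinner scaleC_ell2.rep_eq)
  qed
  have "cnj (cinner g f) = (\<Sum>n. cnj (cinner (ell2_nth g n) (ell2_nth f n)))"
    unfolding cinner_ell2_def by (intro bounded_linear.suminf[OF bounded_linear_cnj] sm)
  then show "cinner f g = cnj (cinner g f)"
    unfolding cinner_ell2_def by (simp flip: cinner_commute)
  show "cinner (f + g) h = cinner f h + cinner g h"
    by (simp add: cinner_ell2_def plus_ell2.rep_eq cinner_add_left suminf_add sm)
  show "cinner (c *\<^sub>C f) g = c * cinner f g"
    by (simp add: cinner_ell2_def scaleC_ell2.rep_eq cinner_scaleC_left suminf_mult sm)
  show "inner f g = Re (cinner f g)"
    unfolding inner_ell2_def cinner_ell2_def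
    by (subst bounded_linear.suminf[OF bounded_linear_Re sm]) (simp add: inner_eq_Re_cinner)
qed

end

instance ell2 :: (chilbert_space) chilbert_space ..

section \<open>Bounded operators\<close>

definition bounded_clinear :: "('a::complex_inner \<Rightarrow> 'b::complex_inner) \<Rightarrow> bool"
  where "bounded_clinear T \<longleftrightarrow> bounded_linear T \<and> (\<forall>c x. T (c *\<^sub>C x) = c *\<^sub>C T x)"

definition cadjoint :: "('a::complex_inner \<Rightarrow> 'b::complex_inner) \<Rightarrow> 'b \<Rightarrow> 'a"
  where "cadjoint T = (THE S. \<forall>x y. cinner (T x) y = cinner x (S y))"

definition bounded_invertible :: "('a::complex_inner \<Rightarrow> 'b::complex_inner) \<Rightarrow> bool"
  where "bounded_invertible T \<longleftrightarrow>
    bounded_clinear T \<and> (\<exists>S. bounded_clinear S \<and> S \<circ> T = id \<and> T \<circ> S = id)"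

definition spectrum :: "('a::complex_inner \<Rightarrow> 'a) \<Rightarrow> complex set"
  where "spectrum T = {z. \<not> bounded_invertible (\<lambda>x. z *\<^sub>C x - T x)}"

text \<open>In \<^typ>\<open>ennreal\<close> the supremum over the empty spectrum (the zero space) is \<open>0\<close>.\<close>

definition spectral_radius :: "('a::complex_inner \<Rightarrow> 'a) \<Rightarrow> ennreal"
  where "spectral_radius T = (SUP z\<in>spectrum T. ennreal (cmod z))"

definition block_op ::
  "('a \<Rightarrow> 'c) \<Rightarrow> ('b \<Rightarrow> 'c) \<Rightarrow> ('a \<Rightarrow> 'd) \<Rightarrow> ('b \<Rightarrow> 'd) \<Rightarrow> 'a \<times> 'b \<Rightarrow> 'c::plus \<times> 'd::plus"
  where "block_op A B C D = (\<lambda>(x, u). (A x + B u, C x + D u))"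

section \<open>Unbounded operators\<close>

text \<open>An unbounded operator is a partial map \<open>T\<close>, with domain \<^term>\<open>dom T\<close> and range \<^term>\<open>ran T\<close>.
  A bounded operator \<open>T\<close> becomes the partial map \<open>Some \<circ> T\<close>; composition (on its natural domain) is
  \<open>\<circ>\<^sub>m\<close>.\<close>

definition linear_op :: "('a::complex_inner \<rightharpoonup> 'b::complex_inner) \<Rightarrow> bool"
  where "linear_op T \<longleftrightarrow> T 0 = Some 0 \<and>
    (\<forall>x y x' y'. T x = Some x' \<longrightarrow> T y = Some y' \<longrightarrow> T (x + y) = Some (x' + y')) \<and>
    (\<forall>c x x'. T x = Some x' \<longrightarrow> T (c *\<^sub>C x) = Some (c *\<^sub>C x'))"

definition densely_defined :: "('a::complex_inner \<rightharpoonup> 'b) \<Rightarrow> bool"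
  where "densely_defined T \<longleftrightarrow> closure (dom T) = UNIV"

definition closed_op :: "('a::complex_inner \<rightharpoonup> 'b::complex_inner) \<Rightarrow> bool"
  where "closed_op T \<longleftrightarrow> closed (Map.graph T)"

text \<open>Only meaningful for densely defined \<open>T\<close>, where the vector \<open>x\<close> below is unique.\<close>

definition adjoint_op :: "('a::complex_inner \<rightharpoonup> 'b::complex_inner) \<Rightarrow> ('b \<rightharpoonup> 'a)"
  where "adjoint_op T = (\<lambda>y.
    if \<exists>x. \<forall>z\<in>dom T. cinner (the (T z)) y = cinner z x
    then Some (THE x. \<forall>z\<in>dom T. cinner (the (T z)) y = cinner z x)
    else None)"

definition selfadjoint_op :: "('a::complex_inner \<rightharpoonup> 'a) \<Rightarrow> bool"
  where "selfadjoint_op H \<longleftrightarrow> linear_op H \<and> densely_defined H \<and> adjoint_op H = H"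

text \<open>For a selfadjoint operator the quadratic form below is real, so its real part is the form
  itself.\<close>

definition pos_def :: "('a::complex_inner \<rightharpoonup> 'a) \<Rightarrow> bool"
  where "pos_def H \<longleftrightarrow>
    selfadjoint_op H \<and> (\<forall>x\<in>dom H. x \<noteq> 0 \<longrightarrow> 0 < Re (cinner (the (H x)) x))"

definition pos_semidef :: "('a::complex_inner \<rightharpoonup> 'a) \<Rightarrow> bool"
  where "pos_semidef H \<longleftrightarrow>
    selfadjoint_op H \<and> (\<forall>x\<in>dom H. 0 \<le> Re (cinner (the (H x)) x))"

definition strictly_pos_def :: "('a::complex_inner \<rightharpoonup> 'a) \<Rightarrow> bool"
  where "strictly_pos_def H \<longleftrightarrow>
    selfadjoint_op H \<and>
    (\<exists>\<delta>>0. \<forall>x\<in>dom H. \<delta> * (norm x)\<^sup>2 \<le> Re (cinner (the (H x)) x))"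

definition sqrt_op :: "('a::complex_inner \<rightharpoonup> 'a) \<Rightarrow> ('a \<rightharpoonup> 'a)"
  where "sqrt_op H = (THE K. pos_semidef K \<and> K \<circ>\<^sub>m K = H)"

definition loewner_le :: "('a::complex_inner \<Rightarrow> 'a) \<Rightarrow> ('a \<Rightarrow> 'a) \<Rightarrow> bool" (infix \<open>\<preceq>\<close> 50)
  where "S \<preceq> T \<longleftrightarrow> pos_semidef (Some \<circ> (\<lambda>x. T x - S x))"

section \<open>Transfer function and Schur class\<close>

text \<open>Holomorphy of an operator-valued function on an open set, with respect to the operator norm.\<close>

definition op_holomorphic_on ::
  "(complex \<Rightarrow> 'u::complex_inner \<Rightarrow> 'y::complex_inner) \<Rightarrow> complex set \<Rightarrow> bool"
  where "op_holomorphic_on F S \<longleftrightarrow>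
    (\<forall>z\<in>S. bounded_clinear (F z)) \<and>
    (\<forall>z\<in>S. \<exists>F'. bounded_clinear F' \<and>
      ((\<lambda>w. onorm (\<lambda>u. inverse (w - z) *\<^sub>C (F w u - F z u) - F' u)) \<longlongrightarrow> 0) (at z))"

definition schur_class :: "(complex \<Rightarrow> 'u::complex_inner \<Rightarrow> 'y::complex_inner) set"
  where "schur_class = {F. op_holomorphic_on F (ball 0 1) \<and> (\<forall>z\<in>ball 0 1. onorm (F z) \<le> 1)}"

definition transfer_domain :: "('x::complex_inner \<Rightarrow> 'x) \<Rightarrow> complex set"
  where "transfer_domain A = {z. bounded_invertible (\<lambda>x. x - z *\<^sub>C A x)}"

text \<open>Only meaningful for \<open>z\<close> in \<^term>\<open>transfer_domain A\<close>, which is a neighbourhood of \<open>0\<close>.\<close>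

definition transfer_fun ::
  "('x::complex_inner \<Rightarrow> 'x) \<Rightarrow> ('u \<Rightarrow> 'x) \<Rightarrow> ('x \<Rightarrow> 'y) \<Rightarrow> ('u \<Rightarrow> 'y)
    \<Rightarrow> complex \<Rightarrow> 'u \<Rightarrow> 'y::complex_inner"
  where "transfer_fun A B C D = (\<lambda>z u. D u + z *\<^sub>C C (inv (\<lambda>x. x - z *\<^sub>C A x) (B u)))"

definition has_schur_continuation ::
  "('x::complex_inner \<Rightarrow> 'x) \<Rightarrow> ('u::complex_inner \<Rightarrow> 'x) \<Rightarrow> ('x \<Rightarrow> 'y::complex_inner) \<Rightarrow> ('u \<Rightarrow> 'y)
    \<Rightarrow> bool"
  where "has_schur_continuation A B C D \<longleftrightarrow>
    (\<exists>F\<in>schur_class. \<forall>\<^sub>F z in nhds 0. F z = transfer_fun A B C D z)"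

section \<open>Controllability, observability, minimality\<close>

definition Rea :: "('x::complex_inner \<Rightarrow> 'x) \<Rightarrow> ('u \<Rightarrow> 'x) \<Rightarrow> 'x set"
  where "Rea A B = cspan (\<Union>k. range ((A ^^ k) \<circ> B))"

definition Obs :: "('x::complex_inner \<Rightarrow> 'y::complex_inner) \<Rightarrow> ('x \<Rightarrow> 'x) \<Rightarrow> 'x set"
  where "Obs C A = cspan (\<Union>k. range ((cadjoint A ^^ k) \<circ> cadjoint C))"

definition controllable :: "('x::complex_inner \<Rightarrow> 'x) \<Rightarrow> ('u \<Rightarrow> 'x) \<Rightarrow> bool"
  where "controllable A B \<longleftrightarrow> closure (Rea A B) = UNIV"

definition exactly_controllable :: "('x::complex_inner \<Rightarrow> 'x) \<Rightarrow> ('u \<Rightarrow> 'x) \<Rightarrow> bool"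
  where "exactly_controllable A B \<longleftrightarrow> Rea A B = UNIV"

definition observable :: "('x::complex_inner \<Rightarrow> 'y::complex_inner) \<Rightarrow> ('x \<Rightarrow> 'x) \<Rightarrow> bool"
  where "observable C A \<longleftrightarrow> closure (Obs C A) = UNIV"

definition exactly_observable :: "('x::complex_inner \<Rightarrow> 'y::complex_inner) \<Rightarrow> ('x \<Rightarrow> 'x) \<Rightarrow> bool"
  where "exactly_observable C A \<longleftrightarrow> Obs C A = UNIV"

definition minimal ::
  "('x::complex_inner \<Rightarrow> 'x) \<Rightarrow> ('u \<Rightarrow> 'x) \<Rightarrow> ('x \<Rightarrow> 'y::complex_inner) \<Rightarrow> bool"
  where "minimal A B C \<longleftrightarrow> controllable A B \<and> observable C A"

definition exactly_minimal ::
  "('x::complex_inner \<Rightarrow> 'x) \<Rightarrow> ('u \<Rightarrow> 'x) \<Rightarrow> ('x \<Rightarrow> 'y::complex_inner) \<Rightarrow> bool"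
  where "exactly_minimal A B C \<longleftrightarrow> exactly_controllable A B \<and> exactly_observable C A"

definition observability_op ::
  "('x::complex_inner \<Rightarrow> 'y::complex_inner) \<Rightarrow> ('x \<Rightarrow> 'x) \<Rightarrow> ('x \<rightharpoonup> 'y ell2)"
  where "observability_op C A = (\<lambda>x.
    if summable (\<lambda>n. (norm (C ((A ^^ n) x)))\<^sup>2) then Some (Abs_ell2 (\<lambda>n. C ((A ^^ n) x))) else None)"

text \<open>Sequences over the negative integers are reindexed by \<open>k = - n - 1\<close>, so that entry
  \<open>k \<ge> 0\<close> below is the entry at \<open>n = - k - 1\<close>.\<close>

definition adj_controllability_op ::
  "('x::complex_inner \<Rightarrow> 'x) \<Rightarrow> ('u::complex_inner \<Rightarrow> 'x) \<Rightarrow> ('x \<rightharpoonup> 'u ell2)"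
  where "adj_controllability_op A B = (\<lambda>x.
    if summable (\<lambda>k. (norm (cadjoint B ((cadjoint A ^^ k) x)))\<^sup>2)
    then Some (Abs_ell2 (\<lambda>k. cadjoint B ((cadjoint A ^^ k) x))) else None)"

definition l2_exactly_controllable ::
  "('x::complex_inner \<Rightarrow> 'x) \<Rightarrow> ('u::complex_inner \<Rightarrow> 'x) \<Rightarrow> bool"
  where "l2_exactly_controllable A B \<longleftrightarrow>
    densely_defined (adj_controllability_op A B) \<and>
    ran (adjoint_op (adj_controllability_op A B)) = UNIV"

definition l2_exactly_observable ::
  "('x::complex_inner \<Rightarrow> 'y::complex_inner) \<Rightarrow> ('x \<Rightarrow> 'x) \<Rightarrow> bool"
  where "l2_exactly_observable C A \<longleftrightarrow>
    densely_defined (observability_op C A) \<and>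
    ran (adjoint_op (observability_op C A)) = UNIV"

definition l2_exactly_minimal ::
  "('x::complex_inner \<Rightarrow> 'x) \<Rightarrow> ('u::complex_inner \<Rightarrow> 'x) \<Rightarrow> ('x \<Rightarrow> 'y::complex_inner) \<Rightarrow> bool"
  where "l2_exactly_minimal A B C \<longleftrightarrow> l2_exactly_controllable A B \<and> l2_exactly_observable C A"

section \<open>KYP inequalities\<close>

definition generalized_KYP_solution ::
  "('x::complex_inner \<Rightarrow> 'x) \<Rightarrow> ('u::complex_inner \<Rightarrow> 'x) \<Rightarrow> ('x \<Rightarrow> 'y::complex_inner) \<Rightarrow> ('u \<Rightarrow> 'y)
    \<Rightarrow> ('x \<rightharpoonup> 'x) \<Rightarrow> bool"
  where "generalized_KYP_solution A B C D H \<longleftrightarrow>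
    closed_op H \<and> densely_defined H \<and> pos_def H \<and>
    A ` dom (sqrt_op H) \<subseteq> dom (sqrt_op H) \<and> range B \<subseteq> dom (sqrt_op H) \<and>
    (\<forall>x\<in>dom (sqrt_op H). \<forall>u.
      (norm (the (sqrt_op H x)))\<^sup>2 + (norm u)\<^sup>2
        - (norm (the (sqrt_op H (A x + B u))))\<^sup>2 - (norm (C x + D u))\<^sup>2 \<ge> 0)"

definition KYP_inequality ::
  "('x::complex_inner \<Rightarrow> 'x) \<Rightarrow> ('u::complex_inner \<Rightarrow> 'x) \<Rightarrow> ('x \<Rightarrow> 'y::complex_inner) \<Rightarrow> ('u \<Rightarrow> 'y)
    \<Rightarrow> ('x \<Rightarrow> 'x) \<Rightarrow> bool"
  where "KYP_inequality A B C D H \<longleftrightarrow>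
    cadjoint (block_op A B C D) \<circ> block_op H (\<lambda>_. 0) (\<lambda>_. 0) id \<circ> block_op A B C D
      \<preceq> block_op H (\<lambda>_. 0) (\<lambda>_. 0) id"

end

theory Submission
  imports Defs "HOL-Complex_Analysis.Complex_Analysis"
begin

text \<open>The proof replaces the condition on the transfer function by one on trajectories: the
  system is \<^emph>\<open>dissipative\<close>, that is, started at rest it never puts out more energy than the input
  has supplied. In the Hardy space picture this says that multiplication by the transfer function
  is a contraction. A Schur class function satisfies it because of orthogonality on the
  circles \<open>|z| = r < 1\<close> (\<open>dissipative_if_schur\<close>); conversely the exponentially growing input
  \<open>z\<^sup>-\<^sup>n u\<close> probes the value of the transfer function at \<open>z\<close> (\<open>schur_if_dissipative\<close>).

  A solution of a KYP inequality is a storage function for the system, \<open>x \<mapsto> \<parallel>H\<^sup>1\<^sup>/\<^sup>2x\<parallel>\<^sup>2\<close>, and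
  summing the inequality along a trajectory gives dissipativity. For the converse one takes the
  \<^emph>\<open>available storage\<close>: the supremum, over all finite inputs, of the energy that can be
  extracted from the state \<open>x\<close>. It is finite at the states reachable from rest, it dominates the
  observed energy \<open>\<Sum> \<parallel>CA\<^sup>nx\<parallel>\<^sup>2\<close>, it satisfies the dissipation inequality by dynamic programming, it
  obeys the parallelogram law since it is a partial supremum of a quadratic form, and it is lower
  semicontinuous since it is a supremum of continuous functions. So controllability makes it a
  densely defined closed quadratic form and observability makes it positive.

  The remaining step is the representation of a closed form as \<open>\<parallel>Kx\<parallel>\<^sup>2\<close> with \<open>K\<close> positive and
  selfadjoint (\<open>closed_form.representation\<close>). Unbounded operators are handled through bounded ones:
  the minimizer of \<open>q(y) + \<parallel>x - y\<parallel>\<^sup>2\<close> is \<open>Rx\<close> with \<open>R = (1 + H)\<^sup>-\<^sup>1\<close>, and with \<open>P = R\<^sup>1\<^sup>/\<^sup>2\<close> and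
  \<open>Q = (1 - R)\<^sup>1\<^sup>/\<^sup>2\<close> the operators are the quotients \<open>K = QP\<^sup>-\<^sup>1\<close> and \<open>H = Q\<^sup>2P\<^sup>-\<^sup>2\<close>. The same pair
  \<open>P\<close>, \<open>Q\<close> shows that \<open>K\<close> is the only positive square root of \<open>H\<close> (\<open>bounded_transform.sqrt_op_H\<close>).

  Under exact controllability, algebraic or \<open>\<ell>\<^sup>2\<close>, the available storage is finite at every state
  and hence bounded by the Baire category theorem; under exact observability the same theorem,
  applied to the linear functionals that the observations control, makes it coercive. The
  operator \<open>H\<close> is then bounded and strictly positive, so that the powers of \<open>A\<close> are uniformly
  bounded, which yields the spectral radius and the analyticity on the disk.\<close>

section \<open>Minimization, projection and Baire category in Hilbert spaces\<close>

text \<open>The midpoint condition is uniform convexity, so a minimizing sequence is Cauchy. The condition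
  \<open>lsc\<close> combines closedness of \<open>S\<close> with lower semicontinuity of \<open>\<phi>\<close>, in the form in which a
  quadratic form with a domain provides it.\<close>

lemma minimizer_exists:
  fixes \<phi> :: "'a::{real_inner,complete_space} \<Rightarrow> real"
  assumes ne: "S \<noteq> {}" and c: "c > 0" and below: "\<And>y. y \<in> S \<Longrightarrow> b \<le> \<phi> y"
    and mid: "\<And>y z. y \<in> S \<Longrightarrow> z \<in> S \<Longrightarrow> (1/2) *\<^sub>R (y + z) \<in> S \<and>
      2 * \<phi> ((1/2) *\<^sub>R (y + z)) + c * (norm (y - z))\<^sup>2 \<le> \<phi> y + \<phi> z"
    and lsc: "\<And>y l r. (\<And>n::nat. y n \<in> S) \<Longrightarrow> y \<longlonglongrightarrow> l \<Longrightarrow> (\<lambda>n. \<phi> (y n)) \<longlonglongrightarrow> r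
      \<Longrightarrow> l \<in> S \<and> \<phi> l \<le> r"
  shows "\<exists>y\<in>S. \<forall>z\<in>S. \<phi> y \<le> \<phi> z"
proof -
  define m where "m = Inf (\<phi> ` S)"
  have bdd: "bdd_below (\<phi> ` S)"
    using below by (auto simp: bdd_below_def)
  have le: "m \<le> \<phi> y" if "y \<in> S" for y
    unfolding m_def using bdd that by (intro cInf_lower) auto
  have "\<exists>y\<in>S. \<phi> y < m + 1 / Suc n" for n :: nat
    using cInf_lessD[of "\<phi> ` S" "m + 1 / Suc n"] ne by (auto simp: m_def)
  then obtain y where y: "\<And>n. y n \<in> S" "\<And>n. \<phi> (y n) < m + 1 / Suc n"
    by metis
  have dist: "c * (norm (y i - y j))\<^sup>2 \<le> 1 / Suc i + 1 / Suc j" for i j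
    using mid[OF y(1)[of i] y(1)[of j]] le[of "(1/2) *\<^sub>R (y i + y j)"] y(2)[of i] y(2)[of j]
    by linarith
  have "Cauchy y"
  proof (rule metric_CauchyI)
    fix e :: real
    assume e: "e > 0"
    obtain M where M: "1 / real (Suc M) < c * e\<^sup>2 / 2"
      using e c by (metis nat_approx_posE half_gt_zero mult_pos_pos zero_less_power)
    have "dist (y i) (y j) < e" if "i \<ge> M" "j \<ge> M" for i j
    proof -
      have "1 / real (Suc i) \<le> 1 / real (Suc M)" "1 / real (Suc j) \<le> 1 / real (Suc M)"
        using that by (auto intro!: divide_left_mono)
      then have "c * (norm (y i - y j))\<^sup>2 < c * e\<^sup>2"
        using dist[of i j] M by linarith
      then have "(norm (y i - y j))\<^sup>2 < e\<^sup>2"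
        using c by simp
      then show ?thesis
        using e by (simp add: dist_norm power_less_imp_less_base)
    qed
    then show "\<exists>M. \<forall>m\<ge>M. \<forall>n\<ge>M. dist (y m) (y n) < e"
      by blast
  qed
  then obtain l where l: "y \<longlonglongrightarrow> l"
    using Cauchy_convergent_iff convergent_def by blast
  have "(\<lambda>n. m + 1 / real (Suc n)) \<longlonglongrightarrow> m + 0"
    using LIMSEQ_inverse_real_of_nat by (intro tendsto_add tendsto_const) (simp add: inverse_eq_divide)
  then have "(\<lambda>n. m + 1 / real (Suc n)) \<longlonglongrightarrow> m"
    by simp
  then have "(\<lambda>n. \<phi> (y n)) \<longlonglongrightarrow> m"
    by (rule tendsto_sandwich[OF _ _ tendsto_const, rotated 2])
      (use le y in \<open>auto intro!: always_eventually less_imp_le\<close>)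
  then show ?thesis
    using lsc[OF y(1) l] le by force
qed

lemma parallelogram:
  fixes x y :: "'a::real_inner"
  shows "(norm (x + y))\<^sup>2 + (norm (x - y))\<^sup>2 = 2 * (norm x)\<^sup>2 + 2 * (norm y)\<^sup>2"
  by (simp add: power2_norm_eq_inner algebra_simps inner_commute)

text \<open>The first variation of a quadratic function at a minimum vanishes; this is the only form of
  differentiation that the variational arguments below need.\<close>

lemma real_eq_0_of_quadratic_bound:
  fixes b c :: real
  assumes "\<And>t. t * b \<le> t\<^sup>2 * c"
  shows "b = 0"
proof (rule ccontr)
  assume b: "b \<noteq> 0"
  define d where "d = \<bar>c\<bar> + 1"
  have d: "d > 0" "c \<le> d"
    by (auto simp: d_def)
  have "(b / (2 * d)) * b \<le> (b / (2 * d))\<^sup>2 * c"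
    using assms .
  also have "\<dots> \<le> (b / (2 * d))\<^sup>2 * d"
    using d by (intro mult_left_mono) auto
  also have "\<dots> = (b / (2 * d)) * b / 2"
    using d by (simp add: power2_eq_square)
  finally have "b * b / d \<le> 0"
    by simp
  moreover have "b * b / d > 0"
    using b d by (intro divide_pos_pos) (auto simp: zero_less_mult_iff linorder_neq_iff)
  ultimately show False
    by simp
qed

lemma projection_exists:
  fixes M :: "'a::{real_inner,complete_space} set"
  assumes M: "subspace M" "closed M"
  shows "\<exists>m\<in>M. \<forall>y\<in>M. inner (x - m) y = 0"
proof -
  have "\<exists>m\<in>M. \<forall>z\<in>M. (norm (x - m))\<^sup>2 \<le> (norm (x - z))\<^sup>2"
  proof (rule minimizer_exists[where c = "1/2" and b = 0])
    show "M \<noteq> {}"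
      using subspace_0[OF M(1)] by auto
    fix y z
    assume yz: "y \<in> M" "z \<in> M"
    have e: "x - (1/2) *\<^sub>R (y + z) = (1/2) *\<^sub>R ((x - y) + (x - z))"
    proof -
      have "(x - y) + (x - z) = (x + x) - (y + z)"
        by simp
      then show ?thesis
        by (simp only: scaleR_right_diff_distrib scaleR_half_double)
    qed
    have "2 * (norm (x - (1/2) *\<^sub>R (y + z)))\<^sup>2 = 1/2 * (norm ((x - y) + (x - z)))\<^sup>2"
      unfolding e by (simp add: power2_eq_square)
    then show "(1/2) *\<^sub>R (y + z) \<in> M \<and>
      2 * (norm (x - (1/2) *\<^sub>R (y + z)))\<^sup>2 + 1/2 * (norm (y - z))\<^sup>2
        \<le> (norm (x - y))\<^sup>2 + (norm (x - z))\<^sup>2"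
      using parallelogram[of "x - y" "x - z"] yz M(1)
      by (auto simp: norm_minus_commute intro!: subspace_scale subspace_add)
  next
    fix y l r
    assume y: "\<And>n::nat. y n \<in> M" "y \<longlonglongrightarrow> l" "(\<lambda>n. (norm (x - y n))\<^sup>2) \<longlonglongrightarrow> r"
    have "(\<lambda>n. (norm (x - y n))\<^sup>2) \<longlonglongrightarrow> (norm (x - l))\<^sup>2"
      by (intro tendsto_intros y)
    with y show "l \<in> M \<and> (norm (x - l))\<^sup>2 \<le> r"
      using closed_sequentially[OF M(2)] LIMSEQ_unique by blast
  qed auto
  then obtain m where m: "m \<in> M" "\<And>z. z \<in> M \<Longrightarrow> (norm (x - m))\<^sup>2 \<le> (norm (x - z))\<^sup>2"
    by blast
  have "inner (x - m) y = 0" if y: "y \<in> M" for y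
  proof -
    have "t * (2 * inner (x - m) y) \<le> t\<^sup>2 * (norm y)\<^sup>2" for t
    proof -
      have "(norm (x - m))\<^sup>2 \<le> (norm ((x - m) - t *\<^sub>R y))\<^sup>2"
        using m(2)[of "m + t *\<^sub>R y"] m(1) y M(1)
        by (simp add: subspace_add subspace_scale diff_diff_eq)
      also have "\<dots> = (norm (x - m))\<^sup>2 - t * (2 * inner (x - m) y) + t\<^sup>2 * (norm y)\<^sup>2"
        unfolding power2_norm_eq_inner
        by (simp add: inner_diff_left inner_diff_right inner_commute power2_eq_square algebra_simps)
      finally show ?thesis
        by simp
    qed
    then have "2 * inner (x - m) y = 0"
      by (rule real_eq_0_of_quadratic_bound)
    then show ?thesis
      by simp
  qed
  with m(1) show ?thesis
    by blast
qed

lemma inner_right_eqI: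
  fixes y z :: "'a::real_inner"
  shows "(\<And>x. inner x y = inner x z) \<Longrightarrow> y = z"
  using vector_eq_rdot[of y z] by (simp add: inner_commute)

lemma orthogonal_dense_eq_0:
  fixes x :: "'a::real_inner"
  assumes "closure M = UNIV" "\<And>y. y \<in> M \<Longrightarrow> inner x y = 0"
  shows "x = 0"
proof -
  have "closed {y. inner x y = 0}"
    by (intro closed_Collect_eq continuous_intros)
  then have "closure M \<subseteq> {y. inner x y = 0}"
    using assms(2) by (intro closure_minimal) auto
  then have "inner x x = 0"
    using assms(1) by blast
  then show ?thesis
    by simp
qed

lemma subspace_closure:
  fixes M :: "'a::real_normed_vector set"
  assumes "subspace M"
  shows "subspace (closure M)"
  unfolding subspace_def
proof (intro conjI ballI allI)
  show "0 \<in> closure M"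
    using subspace_0[OF assms] closure_subset by blast
next
  fix x y :: 'a
  assume "x \<in> closure M" "y \<in> closure M"
  then obtain f g where "\<And>n::nat. f n \<in> M" "f \<longlonglongrightarrow> x" "\<And>n::nat. g n \<in> M" "g \<longlonglongrightarrow> y"
    unfolding closure_sequential by blast
  then show "x + y \<in> closure M"
    unfolding closure_sequential
    by (intro exI[of _ "\<lambda>n. f n + g n"]) (auto intro!: tendsto_add subspace_add[OF assms])
next
  fix c :: real and x :: 'a
  assume "x \<in> closure M"
  then obtain f where "\<And>n::nat. f n \<in> M" "f \<longlonglongrightarrow> x"
    unfolding closure_sequential by blast
  then show "c *\<^sub>R x \<in> closure M"
    unfolding closure_sequential
    by (intro exI[of _ "\<lambda>n. c *\<^sub>R f n"])
      (auto intro!: tendsto_scaleR tendsto_const subspace_scale[OF assms])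
qed

lemma dense_if_no_orthogonal:
  fixes M :: "'a::{real_inner,complete_space} set"
  assumes M: "subspace M" and orth: "\<And>x. (\<And>y. y \<in> M \<Longrightarrow> inner x y = 0) \<Longrightarrow> x = 0"
  shows "closure M = UNIV"
proof -
  have "x \<in> closure M" for x
  proof -
    obtain m where m: "m \<in> closure M" "\<And>y. y \<in> closure M \<Longrightarrow> inner (x - m) y = 0"
      using projection_exists[of "closure M" x] subspace_closure[OF M] by auto
    then have "x - m = 0"
      using closure_subset by (intro orth) blast
    with m show ?thesis
      by simp
  qed
  then show ?thesis
    by auto
qed

lemma riesz_representation:
  fixes f :: "'a::{real_inner,complete_space} \<Rightarrow> real"
  assumes "bounded_linear f"
  shows "\<exists>z. \<forall>x. f x = inner x z"
proof (cases "\<forall>x. f x = 0")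
  case False
  interpret f: bounded_linear f
    by fact
  from False obtain x where x: "f x \<noteq> 0"
    by blast
  have "subspace {y. f y = 0}"
    by (auto simp: subspace_def f.add f.zero f.scale)
  moreover have "closed {y. f y = 0}"
    by (intro closed_Collect_eq continuous_intros f.continuous_on)
  ultimately obtain m where m: "f m = 0" "\<And>y. f y = 0 \<Longrightarrow> inner (x - m) y = 0"
    using projection_exists[of "{y. f y = 0}" x] by auto
  define n where "n = x - m"
  have fn: "f n = f x"
    using m by (simp add: n_def f.diff)
  have "f y = inner y ((f x / inner n n) *\<^sub>R n)" for y
  proof -
    have "inner n (y - (f y / f x) *\<^sub>R n) = 0"
      unfolding n_def[symmetric] using x fn by (intro m(2)[folded n_def]) (simp add: f.diff f.scale)
    then have "inner n y = (f y / f x) * inner n n"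
      by (simp add: inner_diff_right)
    moreover have "inner n n \<noteq> 0"
      using x fn f.zero by auto
    ultimately show ?thesis
      using x by (simp add: inner_commute field_simps)
  qed
  then show ?thesis
    by blast
qed (auto intro: exI[of _ 0])

text \<open>The uniform boundedness principle for symmetric convex sets: some \<open>S m\<close> has an interior point
  \<open>x\<close>, and half the difference of \<open>x + y\<close> and \<open>x - y\<close> is \<open>y\<close>, so \<open>S m\<close> also contains a
  neighbourhood of \<open>0\<close>.\<close>

lemma uniform_boundedness:
  fixes S :: "nat \<Rightarrow> 'a::{real_normed_vector,complete_space} set"
  assumes closed: "\<And>m. closed (S m)" and cover: "(\<Union>m. S m) = UNIV"
    and mid: "\<And>m x y. x \<in> S m \<Longrightarrow> y \<in> S m \<Longrightarrow> (1/2) *\<^sub>R (x - y) \<in> S m"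
  shows "\<exists>m. \<exists>r>0. cball 0 r \<subseteq> S m"
proof -
  have "\<exists>m. interior (S m) \<noteq> {}"
  proof (rule ccontr)
    assume "\<nexists>m. interior (S m) \<noteq> {}"
    then have "euclidean interior_of (\<Union>(range S)) = {}"
      using completely_metrizable_space_euclidean closed
      by (intro Baire_category_alt) auto
    then show False
      using cover by simp
  qed
  then obtain m x where "x \<in> interior (S m)"
    by blast
  then obtain e where e: "e > 0" "cball x e \<subseteq> S m"
    using mem_interior_cball by blast
  have "cball 0 (e/2) \<subseteq> S m"
  proof
    fix y :: 'a
    assume "y \<in> cball 0 (e/2)"
    then have "norm y \<le> e / 2"
      by simp
    then have "x + y \<in> S m" "x - y \<in> S m"
      using e by (auto intro!: subsetD[OF e(2)] simp: dist_norm)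
    then have "(1/2) *\<^sub>R ((x + y) - (x - y)) \<in> S m"
      by (rule mid)
    moreover have "(1/2) *\<^sub>R ((x + y) - (x - y)) = y"
      by (simp flip: scaleR_2)
    ultimately show "y \<in> S m"
      by simp
  qed
  then show ?thesis
    using e(1) by (intro exI[of _ m] exI[of _ "e/2"]) auto
qed

section \<open>Square roots of bounded positive operators\<close>

definition positive_op :: "('a::real_inner \<Rightarrow> 'a) \<Rightarrow> bool" where
  "positive_op P \<longleftrightarrow> bounded_linear P \<and> (\<forall>x y. inner (P x) y = inner x (P y)) \<and>
    (\<forall>x. 0 \<le> inner (P x) x)"

lemma positive_opD:
  assumes "positive_op P"
  shows "bounded_linear P" "inner (P x) y = inner x (P y)" "0 \<le> inner (P x) x"
  using assms by (auto simp: positive_op_def)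

text \<open>A degenerate case of the Cauchy-Schwarz inequality for the form \<open>\<langle>Px, y\<rangle>\<close>.\<close>

lemma positive_op_eq_0:
  assumes P: "positive_op P" and "inner (P x) x = 0"
  shows "P x = 0"
proof -
  interpret P: bounded_linear P
    using P by (rule positive_opD)
  have "t * (- 2 * inner (P x) (P x)) \<le> t\<^sup>2 * inner (P (P x)) (P x)" for t
  proof -
    have "0 \<le> inner (P (x + t *\<^sub>R P x)) (x + t *\<^sub>R P x)"
      by (rule positive_opD[OF P])
    also have "\<dots> = t * (2 * inner (P x) (P x)) + t\<^sup>2 * inner (P (P x)) (P x)"
      using assms(2) positive_opD(2)[OF P, of "P x" x]
      by (simp add: P.add P.scaleR inner_add_left inner_add_right power2_eq_square algebra_simps)
    finally show ?thesis
      by simp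
  qed
  then have "- 2 * inner (P x) (P x) = 0"
    by (rule real_eq_0_of_quadratic_bound)
  then show ?thesis
    by simp
qed

text \<open>If \<open>P\<^sup>2 = 1 - T\<close> and \<open>P = 1 - Y\<close>, then \<open>Y\<close> is a fixed point of \<open>Y \<mapsto> (T + Y\<^sup>2)/2\<close>. Starting
  from \<open>0\<close>, the iterates are polynomials in \<open>T\<close> with nonnegative coefficients, so for a contraction
  \<open>T\<close> they are dominated by the same iteration for the number \<open>1\<close> in place of \<open>T\<close>. This gives
  convergence in norm even if the spectrum of \<open>1 - T\<close> reaches \<open>0\<close>.\<close>

fun sqrt_iter :: "('a::real_vector \<Rightarrow> 'a) \<Rightarrow> nat \<Rightarrow> 'a \<Rightarrow> 'a" where
  "sqrt_iter T 0 x = 0"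
| "sqrt_iter T (Suc n) x = (1/2) *\<^sub>R (T x + sqrt_iter T n (sqrt_iter T n x))"

fun sqrt_iter_bound :: "nat \<Rightarrow> real" where
  "sqrt_iter_bound 0 = 0"
| "sqrt_iter_bound (Suc n) = (1 + (sqrt_iter_bound n)\<^sup>2) / 2"

lemma sqrt_iter_bound: "0 \<le> sqrt_iter_bound n" "sqrt_iter_bound n \<le> 1"
  "sqrt_iter_bound n \<le> sqrt_iter_bound (Suc n)"
proof -
  have "0 \<le> sqrt_iter_bound n \<and> sqrt_iter_bound n \<le> 1"
  proof (induction n)
    case (Suc n)
    then have "(sqrt_iter_bound n)\<^sup>2 \<le> 1"
      by (intro power_le_one) auto
    then show ?case
      by simp
  qed simp
  then show "0 \<le> sqrt_iter_bound n" "sqrt_iter_bound n \<le> 1"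
    by auto
  have "0 \<le> (1 - sqrt_iter_bound n)\<^sup>2"
    by simp
  then show "sqrt_iter_bound n \<le> sqrt_iter_bound (Suc n)"
    by (simp add: power2_diff)
qed

lemma summable_sqrt_iter_bound_diff:
  "summable (\<lambda>n. sqrt_iter_bound (Suc n) - sqrt_iter_bound n)"
proof (rule summableI_nonneg_bounded[where x = 1])
  show "0 \<le> sqrt_iter_bound (Suc n) - sqrt_iter_bound n" for n
    using sqrt_iter_bound(3)[of n] by (simp del: sqrt_iter_bound.simps)
  show "(\<Sum>k<n. sqrt_iter_bound (Suc k) - sqrt_iter_bound k) \<le> 1" for n
    unfolding sum_lessThan_telescope using sqrt_iter_bound(2)[of n] by simp
qed

lemma sqrt_iter_commute:
  assumes "linear V" "\<And>x. V (T x) = T (V x)"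
  shows "V (sqrt_iter T n x) = sqrt_iter T n (V x)"
proof (induction n arbitrary: x)
  case (Suc n)
  then show ?case
    by (simp add: linear_cmul[OF assms(1)] linear_add[OF assms(1)] assms(2))
qed (simp add: linear_0[OF assms(1)])

lemma sqrt_iter_linear:
  assumes "linear T"
  shows "linear (sqrt_iter T n)"
proof (induction n)
  case 0
  then show ?case
    by (auto intro!: linearI)
next
  case (Suc n)
  then show ?case
    using assms by (auto intro!: linearI simp: linear_add linear_cmul algebra_simps)
qed

lemma sqrt_iter_sym:
  assumes "\<And>x y. inner (T x) y = inner x (T y)"
  shows "inner (sqrt_iter T n x) y = inner x (sqrt_iter T n y)"
  by (induction n arbitrary: x y) (auto simp: inner_add_left inner_add_right assms)

lemma sqrt_iter_norm:
  assumes "\<And>x. norm (T x) \<le> norm x"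
  shows "norm (sqrt_iter T n x) \<le> sqrt_iter_bound n * norm x"
proof (induction n arbitrary: x)
  case (Suc n)
  have "norm (sqrt_iter T n (sqrt_iter T n x)) \<le> sqrt_iter_bound n * norm (sqrt_iter T n x)"
    by (rule Suc)
  also have "\<dots> \<le> sqrt_iter_bound n * (sqrt_iter_bound n * norm x)"
    by (intro mult_left_mono Suc sqrt_iter_bound)
  finally have "norm (T x + sqrt_iter T n (sqrt_iter T n x)) \<le>
      norm x + (sqrt_iter_bound n)\<^sup>2 * norm x"
    using assms[of x] by (intro norm_triangle_le) (simp add: power2_eq_square)
  moreover have "norm (sqrt_iter T (Suc n) x) = norm (T x + sqrt_iter T n (sqrt_iter T n x)) / 2"
    unfolding sqrt_iter.simps norm_scaleR by simp
  ultimately show ?case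
    by (simp add: algebra_simps del: sqrt_iter.simps)
qed simp

text \<open>With \<open>Y\<close> and \<open>Z\<close> consecutive iterates, \<open>Z\<^sup>2 - Y\<^sup>2 = Z(Z - Y) + (Z - Y)Y\<close> in any order of
  multiplication, and the scalar iteration satisfies the same identity.\<close>

lemma sqrt_iter_diff_norm:
  assumes T: "linear T" "\<And>x. norm (T x) \<le> norm x"
  shows "norm (sqrt_iter T (Suc n) x - sqrt_iter T n x)
    \<le> (sqrt_iter_bound (Suc n) - sqrt_iter_bound n) * norm x"
proof (induction n arbitrary: x)
  case 0
  then show ?case
    using T(2)[of x] by simp
next
  case (Suc n)
  define Y where "Y = sqrt_iter T n"
  define Z where "Z = sqrt_iter T (Suc n)"
  define a where "a = sqrt_iter_bound n"
  define b where "b = sqrt_iter_bound (Suc n)"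
  have ab: "0 \<le> a" "0 \<le> b" "a \<le> b"
    unfolding a_def b_def by (intro sqrt_iter_bound)+
  have IH: "norm (Z x - Y x) \<le> (b - a) * norm x" for x
    using Suc unfolding Y_def Z_def a_def b_def .
  have lin: "linear Z"
    unfolding Z_def by (rule sqrt_iter_linear[OF T(1)])
  have "norm (Z (Z x - Y x)) \<le> b * ((b - a) * norm x)"
    using sqrt_iter_norm[of T "Suc n", OF T(2)] IH[of x] ab
    unfolding Z_def[symmetric] b_def[symmetric] by (meson mult_left_mono order_trans)
  moreover have "norm (Z (Y x) - Y (Y x)) \<le> (b - a) * (a * norm x)"
    using sqrt_iter_norm[of T n, OF T(2)] IH[of "Y x"] ab
    unfolding Y_def[symmetric] a_def[symmetric]
    by (meson mult_left_mono order_trans diff_ge_0_iff_ge)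
  ultimately have "norm (Z (Z x - Y x) + (Z (Y x) - Y (Y x))) \<le> (b\<^sup>2 - a\<^sup>2) * norm x"
    by (intro norm_triangle_le) (simp add: power2_eq_square algebra_simps)
  moreover have "Z (Z x - Y x) + (Z (Y x) - Y (Y x)) = Z (Z x) - Y (Y x)"
    by (simp add: linear_diff[OF lin])
  moreover have "sqrt_iter T (Suc (Suc n)) x - sqrt_iter T (Suc n) x
      = (1/2) *\<^sub>R (Z (Z x) - Y (Y x))"
    unfolding sqrt_iter.simps(2)[of T "Suc n" x] Z_def[symmetric]
    unfolding Z_def sqrt_iter.simps(2)[of T n x] Y_def
    by (simp only: algebra_simps)
  moreover have "sqrt_iter_bound (Suc (Suc n)) - sqrt_iter_bound (Suc n) = (b\<^sup>2 - a\<^sup>2) / 2"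
    unfolding sqrt_iter_bound.simps(2)[of "Suc n"] b_def[symmetric]
    by (simp add: a_def b_def field_simps)
  ultimately show ?case
    by (simp only: norm_scaleR)
qed

text \<open>The commutation property passes from the iterates to the limit. It is needed for the uniqueness
  of the root and for products of roots; with scalar multiplications as \<open>V\<close> it also makes the
  root of a complex linear operator complex linear.\<close>

lemma positive_sqrt_exists:
  fixes S :: "'a::{real_inner,banach} \<Rightarrow> 'a"
  assumes S: "positive_op S" and contr: "\<And>x. norm (x - S x) \<le> norm x"
  shows "\<exists>P. positive_op P \<and> (\<forall>x. P (P x) = S x) \<and> (\<forall>x. norm (x - P x) \<le> norm x) \<and>
    (\<forall>V. bounded_linear V \<longrightarrow> (\<forall>x. V (S x) = S (V x)) \<longrightarrow> (\<forall>x. V (P x) = P (V x)))"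
proof -
  interpret S: bounded_linear S
    using S by (rule positive_opD)
  define T where "T x = x - S x" for x
  define Y where "Y = sqrt_iter T"
  have lin: "linear T"
    by (auto intro!: linearI simp: T_def S.add S.scaleR algebra_simps)
  have T: "norm (T x) \<le> norm x" "inner (T x) y = inner x (T y)" for x y
    using contr[of x] positive_opD(2)[OF S] by (auto simp: T_def inner_diff_left inner_diff_right)
  have Yn: "norm (Y n x) \<le> norm x" for n x
  proof -
    have "norm (Y n x) \<le> sqrt_iter_bound n * norm x"
      unfolding Y_def by (rule sqrt_iter_norm[OF T(1)])
    also have "\<dots> \<le> 1 * norm x"
      by (intro mult_right_mono sqrt_iter_bound) simp
    finally show ?thesis
      by simp
  qed
  have "convergent (\<lambda>n. Y n x)" for x
  proof -
    have "summable (\<lambda>n. Y (Suc n) x - Y n x)"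
    proof (rule summable_comparison_test')
      show "summable (\<lambda>n. (sqrt_iter_bound (Suc n) - sqrt_iter_bound n) * norm x)"
        by (intro summable_mult2 summable_sqrt_iter_bound_diff)
      show "norm (Y (Suc n) x - Y n x) \<le> (sqrt_iter_bound (Suc n) - sqrt_iter_bound n) * norm x" for n
        unfolding Y_def by (rule sqrt_iter_diff_norm[OF lin T(1)])
    qed
    then have "(\<lambda>n. \<Sum>k<n. Y (Suc k) x - Y k x) \<longlonglongrightarrow> (\<Sum>n. Y (Suc n) x - Y n x)"
      by (rule summable_LIMSEQ)
    then show ?thesis
      unfolding sum_lessThan_telescope[of "\<lambda>k. Y k x"] convergent_def by (auto simp: Y_def)
  qed
  then obtain L where L: "\<And>x. (\<lambda>n. Y n x) \<longlonglongrightarrow> L x"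
    unfolding convergent_def by metis
  have Ylin: "linear (Y n)" for n
    unfolding Y_def by (rule sqrt_iter_linear[OF lin])
  have Ladd: "L (x + y) = L x + L y" for x y
  proof (rule LIMSEQ_unique[OF L])
    show "(\<lambda>n. Y n (x + y)) \<longlonglongrightarrow> L x + L y"
      unfolding linear_add[OF Ylin] by (intro tendsto_add L)
  qed
  have Lscale: "L (c *\<^sub>R x) = c *\<^sub>R L x" for c x
  proof (rule LIMSEQ_unique[OF L])
    show "(\<lambda>n. Y n (c *\<^sub>R x)) \<longlonglongrightarrow> c *\<^sub>R L x"
      unfolding linear_cmul[OF Ylin] by (intro tendsto_scaleR tendsto_const L)
  qed
  have Lnorm: "norm (L x) \<le> norm x" for x
    by (rule LIMSEQ_le_const2[OF tendsto_norm[OF L]]) (use Yn in auto)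
  have Llin: "bounded_linear L"
    by (rule bounded_linear_intro[where K = 1]) (auto simp: Ladd Lscale Lnorm)
  have Lsym: "inner (L x) y = inner x (L y)" for x y
  proof (rule LIMSEQ_unique)
    show "(\<lambda>n. inner (Y n x) y) \<longlonglongrightarrow> inner (L x) y"
      by (intro tendsto_intros L)
    show "(\<lambda>n. inner (Y n x) y) \<longlonglongrightarrow> inner x (L y)"
      unfolding Y_def sqrt_iter_sym[of T, OF T(2)] by (intro tendsto_intros L[unfolded Y_def])
  qed
  have LL: "L x = (1/2) *\<^sub>R (T x + L (L x))" for x
  proof (rule LIMSEQ_unique[OF LIMSEQ_Suc[OF L]])
    have "(\<lambda>n. norm (Y n x - L x) + norm (Y n (L x) - L (L x))) \<longlonglongrightarrow> 0 + 0"
      by (intro tendsto_add tendsto_norm_zero LIM_zero L)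
    moreover have "norm (Y n (Y n x) - L (L x)) \<le>
        norm (Y n x - L x) + norm (Y n (L x) - L (L x))" for n
    proof -
      have "Y n (Y n x) - L (L x) = Y n (Y n x - L x) + (Y n (L x) - L (L x))"
        by (simp add: linear_diff[OF Ylin])
      then show ?thesis
        using Yn[of n "Y n x - L x"] by (metis norm_triangle_le add_right_mono)
    qed
    ultimately have "(\<lambda>n. Y n (Y n x) - L (L x)) \<longlonglongrightarrow> 0"
      by (intro Lim_null_comparison[of "\<lambda>n. Y n (Y n x) - L (L x)"]) (auto intro!: always_eventually)
    then show "(\<lambda>n. Y (Suc n) x) \<longlonglongrightarrow> (1/2) *\<^sub>R (T x + L (L x))"
      unfolding Y_def sqrt_iter.simps by (intro tendsto_intros) (rule LIM_zero_cancel)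
  qed
  define P where "P x = x - L x" for x
  have "bounded_linear P"
    unfolding P_def by (intro bounded_linear_sub bounded_linear_ident Llin)
  moreover have "inner (P x) y = inner x (P y)" for x y
    by (simp add: P_def inner_diff_left inner_diff_right Lsym)
  moreover have "0 \<le> inner (P x) x" for x
  proof -
    have "inner (L x) x \<le> norm (L x) * norm x"
      by (rule norm_cauchy_schwarz)
    also have "\<dots> \<le> norm x * norm x"
      by (intro mult_right_mono Lnorm) auto
    finally show ?thesis
      by (simp add: P_def inner_diff_left dot_square_norm power2_eq_square)
  qed
  moreover have "P (P x) = S x" for x
  proof -
    interpret L: bounded_linear L by (rule Llin)
    have "2 *\<^sub>R L x = T x + L (L x)"
      by (subst LL) simp
    then show ?thesis
      by (simp add: P_def L.diff T_def algebra_simps scaleR_2)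
  qed
  moreover have "V (P x) = P (V x)"
    if V: "bounded_linear V" "\<And>x. V (S x) = S (V x)" for V x
  proof -
    interpret V: bounded_linear V by (rule V)
    have "V (L x) = L (V x)"
    proof (rule LIMSEQ_unique)
      show "(\<lambda>n. V (Y n x)) \<longlonglongrightarrow> V (L x)"
        by (intro V.tendsto L)
      have "V (Y n x) = Y n (V x)" for n
        unfolding Y_def by (rule sqrt_iter_commute) (auto simp: V.linear_axioms T_def V.diff V)
      then show "(\<lambda>n. V (Y n x)) \<longlonglongrightarrow> L (V x)"
        using L by simp
    qed
    then show ?thesis
      by (simp add: P_def V.diff)
  qed
  ultimately show ?thesis
    using Lnorm by (intro exI[of _ P]) (auto simp: positive_op_def P_def)
qed

text \<open>Any root \<open>V\<close> commutes with \<open>S = V\<^sup>2\<close>, hence with the root \<open>Q\<close> constructed above, so that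
  \<open>(V + Q)(V - Q) = 0\<close>. On the range of \<open>V - Q\<close> both positive operators vanish.\<close>

lemma positive_sqrt_unique:
  fixes S :: "'a::{real_inner,banach} \<Rightarrow> 'a"
  assumes contr: "\<And>x. norm (x - S x) \<le> norm x"
    and P: "positive_op P" "\<And>x. P (P x) = S x" and P': "positive_op P'" "\<And>x. P' (P' x) = S x"
  shows "P = P'"
proof -
  interpret P: bounded_linear P
    using P by (intro positive_opD)
  have eq: "S = (\<lambda>x. P (P x))"
    using P(2) by auto
  have "inner (P (P x)) x = inner (P x) (P x)" for x
    by (rule positive_opD[OF P(1)])
  then have S: "positive_op S"
    unfolding positive_op_def eq
    using positive_opD(1)[OF P(1)]
    by (auto simp: positive_opD(2)[OF P(1)] intro!: bounded_linear_compose[of P])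
      (metis inner_ge_zero positive_opD(2)[OF P(1)])
  obtain Q where Q: "positive_op Q" "\<And>x. Q (Q x) = S x"
    and comm: "\<And>V x. bounded_linear V \<Longrightarrow> (\<And>x. V (S x) = S (V x)) \<Longrightarrow> V (Q x) = Q (V x)"
    using positive_sqrt_exists[OF S contr] by blast
  have "V = Q" if V: "positive_op V" "\<And>x. V (V x) = S x" for V
  proof
    fix x
    interpret V: bounded_linear V
      using V by (intro positive_opD)
    interpret Q: bounded_linear Q
      using Q by (intro positive_opD)
    have VQ: "V (Q x) = Q (V x)" for x
      by (rule comm) (auto simp: V.bounded_linear_axioms simp flip: V(2))
    define y where "y = V x - Q x"
    have "V y + Q y = 0"
      unfolding y_def by (simp add: V.diff Q.diff V(2) Q(2) VQ)
    then have "inner (V y) y + inner (Q y) y = 0"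
      by (simp flip: inner_add_left)
    then have "inner (V y) y = 0" "inner (Q y) y = 0"
      using positive_opD(3)[OF V(1), of y] positive_opD(3)[OF Q(1), of y] by auto
    then have "V y = 0" "Q y = 0"
      using positive_op_eq_0 V(1) Q(1) by blast+
    then have "inner (V x - Q x) y = 0"
      by (simp add: inner_diff_left positive_opD(2)[OF V(1)] positive_opD(2)[OF Q(1)])
    then show "V x = Q x"
      by (simp add: y_def)
  qed
  then show ?thesis
    using P P' by blast
qed

section \<open>Unbounded selfadjoint operators\<close>

lemma bounded_clinearD:
  assumes "bounded_clinear T"
  shows "bounded_linear T" "T (c *\<^sub>C x) = c *\<^sub>C T x"
  using assms by (auto simp: bounded_clinear_def)

lemma bounded_linear_scaleC: "bounded_linear (\<lambda>x::'a::complex_inner. c *\<^sub>C x)"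
proof (rule bounded_linear_intro[where K = "cmod c"])
  show "c *\<^sub>C r *\<^sub>R x = r *\<^sub>R c *\<^sub>C x" for r and x :: 'a
    by (simp add: scaleR_scaleC scaleC_scaleC mult.commute)
qed (simp_all add: scaleC_add_right norm_scaleC)

lemma scaleC_minus1 [simp]: "(- 1) *\<^sub>C x = - (x::'a::complex_inner)"
  using scaleR_scaleC[of "-1" x] by simp

lemma double_scaleC:
  "(x + y) + (x - y) = 2 *\<^sub>C x" "(x + y) - (x - y) = 2 *\<^sub>C (y::'a::complex_inner)"
  using scaleR_scaleC[of 2 x] scaleR_scaleC[of 2 y] by (simp_all add: scaleR_2)

text \<open>Complex inner products agree as soon as the real ones do, also after multiplying the first
  argument by \<open>- \<i>\<close>. Most arguments below therefore use the real inner product only.\<close>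

lemma cinner_eqI:
  assumes "inner x y = inner x' y'" "inner ((- \<i>) *\<^sub>C x) y = inner ((- \<i>) *\<^sub>C x') y'"
  shows "cinner x y = cinner x' y'"
  using assms by (intro complex_eqI) (simp_all only: inner_eq_Re_cinner[symmetric] Im_cinner)

lemma linear_opD:
  assumes "linear_op T"
  shows "T 0 = Some 0"
    "T x = Some x' \<Longrightarrow> T y = Some y' \<Longrightarrow> T (x + y) = Some (x' + y')"
    "T x = Some x' \<Longrightarrow> T (c *\<^sub>C x) = Some (c *\<^sub>C x')"
    "T x = Some x' \<Longrightarrow> T (r *\<^sub>R x) = Some (r *\<^sub>R x')"
    "T x = Some x' \<Longrightarrow> T (- x) = Some (- x')"
    "T x = Some x' \<Longrightarrow> T y = Some y' \<Longrightarrow> T (x - y) = Some (x' - y')"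
proof -
  show a: "T 0 = Some 0" "T x = Some x' \<Longrightarrow> T y = Some y' \<Longrightarrow> T (x + y) = Some (x' + y')"
    and b: "T x = Some x' \<Longrightarrow> T (c *\<^sub>C x) = Some (c *\<^sub>C x')" for x y x' y' c
    using assms by (auto simp: linear_op_def)
  show "T x = Some x' \<Longrightarrow> T (r *\<^sub>R x) = Some (r *\<^sub>R x')"
    unfolding scaleR_scaleC by (rule b)
  show c: "T x = Some x' \<Longrightarrow> T (- x) = Some (- x')" for x x'
    using b[of x x' "-1"] by simp
  show "T x = Some x' \<Longrightarrow> T y = Some y' \<Longrightarrow> T (x - y) = Some (x' - y')"
    using a(2)[of x x' "-y" "-y'"] c[of y y'] by simp
qed

lemma adjoint_op_eq_Some_iff:
  fixes T :: "'a::complex_inner \<rightharpoonup> 'b::complex_inner"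
  assumes T: "linear_op T" "densely_defined T"
  shows "adjoint_op T y = Some x \<longleftrightarrow> (\<forall>z z'. T z = Some z' \<longrightarrow> inner z' y = inner z x)"
proof -
  define C where "C x \<longleftrightarrow> (\<forall>z\<in>dom T. cinner (the (T z)) y = cinner z x)" for x
  have C_iff: "C x \<longleftrightarrow> (\<forall>z z'. T z = Some z' \<longrightarrow> inner z' y = inner z x)" for x
  proof
    assume "C x"
    then show "\<forall>z z'. T z = Some z' \<longrightarrow> inner z' y = inner z x"
      unfolding C_def inner_eq_Re_cinner by (metis domI option.sel)
  next
    assume r: "\<forall>z z'. T z = Some z' \<longrightarrow> inner z' y = inner z x"
    show "C x"
      unfolding C_def
    proof
      fix z
      assume "z \<in> dom T"
      then obtain z' where z': "T z = Some z'"
        by blast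
      have "cinner z' y = cinner z x"
        using r z' linear_opD(3)[OF T(1) z', of "- \<i>"] by (intro cinner_eqI) blast+
      then show "cinner (the (T z)) y = cinner z x"
        using z' by simp
    qed
  qed
  have unique: "x = x'" if "C x" "C x'" for x x'
  proof -
    have "x - x' = 0"
    proof (rule orthogonal_dense_eq_0)
      show "closure (dom T) = UNIV"
        using T(2) by (simp add: densely_defined_def)
      show "inner (x - x') z = 0" if "z \<in> dom T" for z
        using \<open>C x\<close> \<open>C x'\<close> that unfolding C_iff
        by (auto simp: inner_diff_left inner_commute[of x] inner_commute[of x'])
    qed
    then show ?thesis
      by simp
  qed
  have "adjoint_op T y = (if \<exists>x. C x then Some (THE x. C x) else None)"
    by (simp add: adjoint_op_def C_def)
  moreover have "(THE x. C x) = x" if "C x" for x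
    using that unique by (intro the_equality) auto
  ultimately show ?thesis
    unfolding C_iff[symmetric] by auto
qed

lemma selfadjoint_opI:
  assumes "linear_op H" "densely_defined H"
    and sym: "\<And>x x' y y'. H x = Some x' \<Longrightarrow> H y = Some y' \<Longrightarrow> inner x' y = inner x y'"
    and maximal: "\<And>y z. (\<And>x x'. H x = Some x' \<Longrightarrow> inner x' y = inner x z) \<Longrightarrow> H y = Some z"
  shows "selfadjoint_op H"
proof -
  have "adjoint_op H y = Some z \<longleftrightarrow> H y = Some z" for y z
    unfolding adjoint_op_eq_Some_iff[OF assms(1,2)] using sym maximal by blast
  then have "adjoint_op H y = H y" for y
    by (metis not_Some_eq)
  then show ?thesis
    using assms(1,2) by (auto simp: selfadjoint_op_def)
qed

lemma selfadjoint_opD: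
  assumes "selfadjoint_op H"
  shows "linear_op H" "densely_defined H"
    "H x = Some x' \<Longrightarrow> H y = Some y' \<Longrightarrow> inner x' y = inner x y'"
    "(\<And>x x'. H x = Some x' \<Longrightarrow> inner x' y = inner x z) \<Longrightarrow> H y = Some z"
proof -
  show 1: "linear_op H" "densely_defined H"
    using assms by (auto simp: selfadjoint_op_def)
  have "H y = Some z \<longleftrightarrow> (\<forall>x x'. H x = Some x' \<longrightarrow> inner x' y = inner x z)" for y z
    using adjoint_op_eq_Some_iff[OF 1, of y z] assms by (simp add: selfadjoint_op_def)
  then show "H x = Some x' \<Longrightarrow> H y = Some y' \<Longrightarrow> inner x' y = inner x y'"
    "(\<And>x x'. H x = Some x' \<Longrightarrow> inner x' y = inner x z) \<Longrightarrow> H y = Some z"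
    by blast+
qed

lemma pos_semidef_nonneg:
  assumes "pos_semidef H" "H x = Some y"
  shows "0 \<le> inner y x"
proof -
  have "x \<in> dom H"
    using assms(2) by blast
  then have "0 \<le> Re (cinner (the (H x)) x)"
    using assms(1) by (simp add: pos_semidef_def)
  then show ?thesis
    using assms(2) by (simp add: inner_eq_Re_cinner)
qed

lemma selfadjoint_closed:
  fixes H :: "'a::complex_inner \<rightharpoonup> 'a"
  assumes "selfadjoint_op H"
  shows "closed_op H"
proof -
  have "Map.graph H = (\<Inter>(x, x')\<in>Map.graph H. {p. inner x' (fst p) = inner x (snd p)})"
  proof (intro set_eqI iffI)
    fix p
    assume "p \<in> Map.graph H"
    then show "p \<in> (\<Inter>(x, x')\<in>Map.graph H. {p. inner x' (fst p) = inner x (snd p)})"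
      using selfadjoint_opD(3)[OF assms] by (auto simp: Map.graph_def)
  next
    fix p
    assume p: "p \<in> (\<Inter>(x, x')\<in>Map.graph H. {p. inner x' (fst p) = inner x (snd p)})"
    have "H (fst p) = Some (snd p)"
      by (rule selfadjoint_opD(4)[OF assms]) (use p in \<open>auto simp: Map.graph_def\<close>)
    then show "p \<in> Map.graph H"
      by (auto simp: Map.graph_def)
  qed
  also have "closed \<dots>"
    by (intro closed_INT ballI) (auto intro!: closed_Collect_eq continuous_intros)
  finally show ?thesis
    by (simp add: closed_op_def)
qed

lemma closed_opD:
  assumes "closed_op T" "x \<longlonglongrightarrow> l" "y \<longlonglongrightarrow> m" "\<And>n::nat. T (x n) = Some (y n)"
  shows "T l = Some m"
proof -
  have "closed (Map.graph T)"
    using assms(1) by (simp add: closed_op_def)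
  moreover have "(x n, y n) \<in> Map.graph T" for n
    using assms(4) by (simp add: Map.graph_def)
  moreover have "(\<lambda>n. (x n, y n)) \<longlonglongrightarrow> (l, m)"
    using assms(2,3) by (rule tendsto_Pair)
  ultimately have "(l, m) \<in> Map.graph T"
    by (rule closed_sequentially)
  then show ?thesis
    by (simp add: Map.graph_def)
qed

text \<open>Selfadjoint operators are maximal among symmetric ones.\<close>

lemma selfadjoint_inclusion_eq:
  assumes "selfadjoint_op K" "selfadjoint_op L" and le: "\<And>x y. K x = Some y \<Longrightarrow> L x = Some y"
  shows "K = L"
proof
  fix y
  have "K y = Some z" if "L y = Some z" for z
    using selfadjoint_opD(4)[OF assms(1)] selfadjoint_opD(3)[OF assms(2) le that] by blast
  then show "K y = L y"
    using le by (metis not_Some_eq)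
qed

text \<open>The operator \<open>QP\<^sup>-\<^sup>1\<close> for injective \<open>P\<close>, that is \<open>Pw \<mapsto> Qw\<close>.\<close>

definition quotient_op :: "('a \<Rightarrow> 'b) \<Rightarrow> ('a \<Rightarrow> 'c) \<Rightarrow> 'b \<rightharpoonup> 'c" where
  "quotient_op P Q = (\<lambda>y. if y \<in> range P then Some (Q (inv P y)) else None)"

lemma quotient_op_eq_Some_iff:
  assumes "inj P"
  shows "quotient_op P Q y = Some z \<longleftrightarrow> (\<exists>w. y = P w \<and> z = Q w)"
  using assms by (auto simp: quotient_op_def)

lemma dom_quotient_op: "dom (quotient_op P Q) = range P"
  by (auto simp: quotient_op_def dom_def)

lemma range_dense:
  fixes P :: "'a::{real_inner,complete_space} \<Rightarrow> 'a"
  assumes "bounded_linear P" "inj P" "\<And>x y. inner (P x) y = inner x (P y)"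
  shows "closure (range P) = UNIV"
proof (rule dense_if_no_orthogonal)
  interpret bounded_linear P by fact
  show "subspace (range P)"
    by (intro linear_subspace_image linear_axioms subspace_UNIV)
  fix x
  assume "\<And>y. y \<in> range P \<Longrightarrow> inner x y = 0"
  then have "inner (P x) (P x) = 0"
    using assms(3) by auto
  then have "P x = P 0"
    by (simp add: zero)
  then show "x = 0"
    by (rule injD[OF assms(2)])
qed

text \<open>A vector \<open>y\<close> lies in the domain of the adjoint, with value \<open>z\<close>, exactly if \<open>Qy = Pz\<close>. The
  Bezout identity \<open>PU + QV = 1\<close> then produces the vector \<open>w = Uy + Vz\<close> with \<open>Pw = y\<close> and \<open>Qw = z\<close>.\<close>

lemma quotient_op_selfadjoint:
  fixes P Q U V :: "'a::chilbert_space \<Rightarrow> 'a"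
  assumes P: "bounded_clinear P" "inj P" "\<And>x y. inner (P x) y = inner x (P y)"
    and Q: "bounded_clinear Q" "\<And>x y. inner (Q x) y = inner x (Q y)"
    and comm: "\<And>x. P (Q x) = Q (P x)" "\<And>x. U (P x) = P (U x)" "\<And>x. U (Q x) = Q (U x)"
      "\<And>x. V (P x) = P (V x)" "\<And>x. V (Q x) = Q (V x)"
    and bezout: "\<And>x. P (U x) + Q (V x) = x"
  shows "selfadjoint_op (quotient_op P Q)"
proof (rule selfadjoint_opI)
  interpret P: bounded_linear P
    by (rule bounded_clinearD[OF P(1)])
  interpret Q: bounded_linear Q
    by (rule bounded_clinearD[OF Q(1)])
  note iff = quotient_op_eq_Some_iff[OF P(2), of Q]
  show "linear_op (quotient_op P Q)"
    unfolding linear_op_def iff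
  proof (intro conjI allI impI; (elim exE conjE)?)
    show "\<exists>w. 0 = P w \<and> 0 = Q w"
      by (intro exI[of _ 0]) (simp add: P.zero Q.zero)
    show "\<exists>u. x + y = P u \<and> x' + y' = Q u"
      if "x = P w" "x' = Q w" "y = P v" "y' = Q v" for x y x' y' w v
      using that by (intro exI[of _ "w + v"]) (simp add: P.add Q.add)
    show "\<exists>u. c *\<^sub>C x = P u \<and> c *\<^sub>C x' = Q u" if "x = P w" "x' = Q w" for c x x' w
      using that by (intro exI[of _ "c *\<^sub>C w"])
        (simp add: bounded_clinearD(2)[OF P(1)] bounded_clinearD(2)[OF Q(1)])
  qed
  show "densely_defined (quotient_op P Q)"
    unfolding densely_defined_def dom_quotient_op using P P.bounded_linear_axioms
    by (intro range_dense)
  show "inner x' y = inner x y'"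
    if "quotient_op P Q x = Some x'" "quotient_op P Q y = Some y'" for x x' y y'
    using that unfolding iff by (auto simp: Q(2) P(3) comm)
  show "quotient_op P Q y = Some z"
    if *: "\<And>x x'. quotient_op P Q x = Some x' \<Longrightarrow> inner x' y = inner x z" for y z
  proof -
    have "inner w (Q y) = inner w (P z)" for w
      using *[of "P w" "Q w"] unfolding iff by (auto simp: Q(2) P(3))
    then have QP: "Q y = P z"
      by (rule inner_right_eqI)
    define w where "w = U y + V z"
    have "P w = y"
      unfolding w_def using bezout[of y] by (simp add: P.add QP flip: comm)
    moreover have "Q w = z"
      unfolding w_def using bezout[of z] by (simp add: Q.add QP flip: comm)
    ultimately show ?thesis
      unfolding iff by blast
  qed
qed

text \<open>The pair \<open>P = (1 + H)\<^sup>-\<^sup>1\<^sup>/\<^sup>2\<close>, \<open>Q = (1 - P\<^sup>2)\<^sup>1\<^sup>/\<^sup>2\<close> encodes a positive selfadjoint operator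
  \<open>H = Q\<^sup>2P\<^sup>-\<^sup>2\<close> together with its root \<open>K = QP\<^sup>-\<^sup>1\<close>. The bound on \<open>1 - Q\<close> lets the bounded root
  construction be applied to \<open>Q\<close> itself.\<close>

locale bounded_transform =
  fixes P Q :: "'a::chilbert_space \<Rightarrow> 'a"
  assumes P: "positive_op P" "bounded_clinear P" "inj P"
    and Q: "positive_op Q" "bounded_clinear Q" "\<And>x. norm (x - Q x) \<le> norm x"
    and PQ: "\<And>x. P (Q x) = Q (P x)" and sq: "\<And>x. P (P x) + Q (Q x) = x"
begin

abbreviation "K \<equiv> quotient_op P Q"
abbreviation "H \<equiv> quotient_op (\<lambda>x. P (P x)) (\<lambda>x. Q (Q x))"

sublocale P: bounded_linear P
  using P by (intro positive_opD)

sublocale Q: bounded_linear Q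
  using Q by (intro positive_opD)

lemmas symP = positive_opD(2)[OF P(1)]
lemmas symQ = positive_opD(2)[OF Q(1)]

lemma PP_clinear: "bounded_clinear (\<lambda>x. P (P x))"
  using bounded_linear_compose[OF P.bounded_linear_axioms P.bounded_linear_axioms]
  by (simp add: bounded_clinear_def bounded_clinearD(2)[OF P(2)])

lemma QQ_clinear: "bounded_clinear (\<lambda>x. Q (Q x))"
  using bounded_linear_compose[OF Q.bounded_linear_axioms Q.bounded_linear_axioms]
  by (simp add: bounded_clinear_def bounded_clinearD(2)[OF Q(2)])

lemma inj_PP: "inj (\<lambda>x. P (P x))"
  using P(3) by (simp add: inj_def)

lemma K_iff: "K y = Some z \<longleftrightarrow> (\<exists>w. y = P w \<and> z = Q w)"
  by (rule quotient_op_eq_Some_iff[OF P(3)])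

lemma H_iff: "H y = Some z \<longleftrightarrow> (\<exists>w. y = P (P w) \<and> z = Q (Q w))"
  by (rule quotient_op_eq_Some_iff[OF inj_PP])

lemma norm_sq: "(norm (P x))\<^sup>2 + (norm (Q x))\<^sup>2 = (norm x)\<^sup>2"
proof -
  have "(norm x)\<^sup>2 = inner (P (P x) + Q (Q x)) x"
    by (simp add: sq power2_norm_eq_inner)
  also have "\<dots> = inner (P x) (P x) + inner (Q x) (Q x)"
    by (simp only: inner_add_left symP[of "P x"] symQ[of "Q x"])
  finally show ?thesis
    by (simp add: power2_norm_eq_inner)
qed

lemma norm_P_le: "norm (P x) \<le> norm x" and norm_Q_le: "norm (Q x) \<le> norm x"
proof -
  have "(norm (P x))\<^sup>2 \<le> (norm x)\<^sup>2" "(norm (Q x))\<^sup>2 \<le> (norm x)\<^sup>2"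
    using norm_sq[of x] zero_le_power2[of "norm (P x)"] zero_le_power2[of "norm (Q x)"]
    by linarith+
  then show "norm (P x) \<le> norm x" "norm (Q x) \<le> norm x"
    by (simp_all add: power2_le_iff_abs_le)
qed

text \<open>With \<open>T\<^sup>2 = Q\<close> and \<open>T\<close> commuting with \<open>P\<close>, the form is \<open>\<langle>P Tx, Tx\<rangle>\<close>.\<close>

lemma PQ_nonneg: "0 \<le> inner (P (Q x)) x"
proof -
  obtain T where T: "positive_op T" "\<And>x. T (T x) = Q x"
    and "\<And>V x. bounded_linear V \<Longrightarrow> (\<And>x. V (Q x) = Q (V x)) \<Longrightarrow> V (T x) = T (V x)"
    using positive_sqrt_exists[OF Q(1) Q(3)] by blast
  then have PT: "P (T x) = T (P x)" for x
    using PQ P.bounded_linear_axioms by blast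
  have "inner (P (Q x)) x = inner (T (P (T x))) x"
    by (simp only: T(2) flip: PT)
  also have "\<dots> = inner (P (T x)) (T x)"
    by (rule positive_opD(2)[OF T(1)])
  finally show ?thesis
    using positive_opD(3)[OF P(1)] by simp
qed

lemma K_selfadjoint: "selfadjoint_op K"
  by (rule quotient_op_selfadjoint[where U = P and V = Q];
      (rule P Q PQ PQ[symmetric] sq symP symQ refl))

lemma H_selfadjoint: "selfadjoint_op H"
  by (rule quotient_op_selfadjoint[where U = id and V = id])
    (simp_all add: PP_clinear QQ_clinear inj_PP PQ sq symP symQ)

lemma K_pos_semidef: "pos_semidef K"
  unfolding pos_semidef_def
proof (intro conjI K_selfadjoint ballI)
  fix x
  assume "x \<in> dom K"
  then obtain w where "x = P w" "K x = Some (Q w)"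
    using K_iff by blast
  moreover have "inner (Q w) (P w) = inner (P (Q w)) w"
    by (simp add: symP)
  ultimately show "0 \<le> Re (cinner (the (K x)) x)"
    using PQ_nonneg[of w] by (simp flip: inner_eq_Re_cinner)
qed

lemma K_K_eq_H: "K \<circ>\<^sub>m K = H"
proof
  fix y
  have "(K \<circ>\<^sub>m K) y = Some z \<longleftrightarrow> H y = Some z" for z
  proof -
    have "(K \<circ>\<^sub>m K) y = Some z \<longleftrightarrow> (\<exists>w v. y = P w \<and> Q w = P v \<and> z = Q v)"
      unfolding map_comp_Some_iff K_iff by blast
    also have "\<dots> \<longleftrightarrow> (\<exists>w. y = P (P w) \<and> z = Q (Q w))"
    proof safe
      fix w v
      assume wv: "Q w = P v"
      have "w = P (P w + Q v)"
        using sq[of w] by (simp add: P.add PQ wv)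
      moreover from this have "v = Q (P w + Q v)"
        using sq[of v] by (simp add: Q.add wv flip: PQ)
      ultimately show "\<exists>u. P w = P (P u) \<and> Q v = Q (Q u)"
        by (intro exI[of _ "P w + Q v"]) simp
    next
      fix w
      show "\<exists>u v. P (P w) = P u \<and> Q u = P v \<and> Q (Q w) = Q v"
        by (intro exI[of _ "P w"] exI[of _ "Q w"]) (simp add: PQ)
    qed
    finally show ?thesis
      unfolding H_iff .
  qed
  then show "(K \<circ>\<^sub>m K) y = H y"
    by (metis not_Some_eq)
qed

lemma H_inner: "H y = Some z \<Longrightarrow> K y = Some k \<Longrightarrow> inner z y = (norm k)\<^sup>2"
proof -
  assume "H y = Some z" "K y = Some k"
  then obtain w w' where w: "y = P (P w)" "z = Q (Q w)" "y = P w'" "k = Q w'"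
    unfolding H_iff K_iff by blast
  then have "w' = P w"
    using P(3) by (simp add: inj_eq)
  with w show ?thesis
    by (simp add: power2_norm_eq_inner symP symQ PQ)
qed

lemma dom_H_subset_dom_K: "dom H \<subseteq> dom K"
  by (auto simp: dom_quotient_op)

text \<open>Let \<open>L\<close> be a positive root of \<open>H\<close>. Then \<open>G = LP\<^sup>2\<close> is everywhere defined, bounded and positive,
  and its square is \<open>P\<^sup>2Q\<^sup>2\<close>; uniqueness of bounded roots gives \<open>LP\<^sup>2 = PQ = KP\<^sup>2\<close>. So \<open>L\<close> and \<open>K\<close>
  agree on the range of \<open>P\<^sup>2\<close>, which is dense enough (it is a core of \<open>K\<close>) to force \<open>K = L\<close>.\<close>

lemma sqrt_unique:
  assumes L: "pos_semidef L" "L \<circ>\<^sub>m L = H"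
  shows "L = K"
proof -
  have sa: "selfadjoint_op L"
    using L(1) by (simp add: pos_semidef_def)
  note lin = linear_opD[OF selfadjoint_opD(1)[OF sa]]
  note sym = selfadjoint_opD(3)[OF sa]
  note Lpos = pos_semidef_nonneg[OF L(1)]
  define G where "G x = the (L (P (P x)))" for x
  have G: "L (P (P x)) = Some (G x)" "L (G x) = Some (Q (Q x))" for x
  proof -
    have "(L \<circ>\<^sub>m L) (P (P x)) = Some (Q (Q x))"
      unfolding L(2) H_iff by blast
    then show "L (P (P x)) = Some (G x)" "L (G x) = Some (Q (Q x))"
      by (auto simp: map_comp_Some_iff G_def)
  qed
  have Ginner: "inner (G x) y = inner (P (P x)) (G y) + inner (Q (Q x)) (G y)" for x y
  proof -
    have "inner (G x) y = inner (G x) (P (P y)) + inner (G x) (Q (Q y))"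
      by (simp only: sq flip: inner_add_right)
    then show ?thesis
      using sym[OF G(1)[of x] G(1)[of y]] sym[OF G(2)[of x] G(2)[of y]] by simp
  qed
  have Gsym: "inner (G x) y = inner x (G y)" for x y
    unfolding Ginner by (simp add: sq flip: inner_add_left)
  have Gpos: "0 \<le> inner (G x) x" for x
    using Lpos[OF G(1)[of x]] Lpos[OF G(2)[of x]] Ginner[of x x]
      inner_commute[of "P (P x)" "G x"] by linarith
  have Gnorm: "(norm (G x))\<^sup>2 = (norm (P (Q x)))\<^sup>2" for x
    using sym[OF G(1)[of x] G(2)[of x]]
    by (simp add: power2_norm_eq_inner symP symQ PQ)
  have Enorm: "norm (P (Q x)) \<le> norm x" for x
    using norm_P_le norm_Q_le order_trans by blast
  have Gadd: "G (x + y) = G x + G y" for x y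
    using lin(2)[OF G(1)[of x] G(1)[of y]] G(1)[of "x + y"] by (simp add: P.add)
  have Gscale: "G (r *\<^sub>R x) = r *\<^sub>R G x" for r x
    using lin(4)[OF G(1)[of x], of r] G(1)[of "r *\<^sub>R x"] by (simp add: P.scaleR)
  have "bounded_linear G"
    using Gnorm Enorm by (intro bounded_linear_intro[where K = 1] Gadd Gscale)
      (simp add: power2_eq_iff_nonneg)
  then have "positive_op G"
    using Gsym Gpos by (simp add: positive_op_def)
  \<comment> \<open>The resolvent \<open>P\<^sup>2\<close> commutes with \<open>L\<close> on the domain of \<open>L\<close>.\<close>
  have GL: "G y = P (P z)" if y: "L y = Some z" for y z
  proof -
    have "y - P (P y) = Q (Q y)"
      using sq[of y] by (simp add: algebra_simps)
    then have "L (Q (Q y)) = Some (z - G y)"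
      using lin(6)[OF y G(1)[of y]] by simp
    then have "(L \<circ>\<^sub>m L) (G y) = Some (z - G y)"
      using G(2)[of y] by (simp add: map_comp_Some_iff)
    then obtain v where v: "G y = P (P v)" "z - G y = Q (Q v)"
      unfolding L(2) H_iff by blast
    then have "z = v"
      using sq[of v] by (simp add: algebra_simps)
    with v show ?thesis
      by simp
  qed
  have E: "positive_op (\<lambda>x. P (Q x))"
    unfolding positive_op_def
    using bounded_linear_compose[OF P.bounded_linear_axioms Q.bounded_linear_axioms] PQ_nonneg
    by (simp add: symP symQ PQ)
  have "G = (\<lambda>x. P (Q x))"
  proof (rule positive_sqrt_unique[OF _ \<open>positive_op G\<close> _ E])
    fix x
    define S where "S = P (Q (P (Q x)))"
    have "inner S x = (norm (P (Q x)))\<^sup>2"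
      by (simp add: S_def power2_norm_eq_inner symP symQ PQ)
    moreover have "(norm S)\<^sup>2 \<le> (norm (P (Q x)))\<^sup>2"
      unfolding S_def by (intro power_mono Enorm norm_ge_zero)
    moreover have "(norm (x - S))\<^sup>2 = (norm x)\<^sup>2 - 2 * inner S x + (norm S)\<^sup>2"
      by (simp add: power2_norm_eq_inner inner_diff_left inner_diff_right inner_commute)
    ultimately have "(norm (x - S))\<^sup>2 \<le> (norm x)\<^sup>2"
      using zero_le_power2[of "norm (P (Q x))"] by linarith
    then show "norm (x - P (Q (P (Q x)))) \<le> norm x"
      unfolding S_def by (simp add: power2_le_iff_abs_le)
    show "G (G x) = P (Q (P (Q x)))"
      using GL[OF G(2)] by (simp add: PQ)
  qed simp
  then have LR: "L (P (P x)) = Some (P (Q x))" for x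
    using G(1) by simp
  have "L (P w) = Some (Q w)" for w
  proof (rule selfadjoint_opD(4)[OF sa])
    fix x x'
    assume x: "L x = Some x'"
    have "closed {w. inner x' (P w) = inner x (Q w)}"
      by (intro closed_Collect_eq continuous_intros P.continuous_on Q.continuous_on)
    moreover have "range P \<subseteq> {w. inner x' (P w) = inner x (Q w)}"
      using sym[OF x LR] by (auto simp: PQ)
    ultimately have "closure (range P) \<subseteq> {w. inner x' (P w) = inner x (Q w)}"
      by (rule closure_minimal[rotated])
    then show "inner x' (P w) = inner x (Q w)"
      using range_dense[OF P.bounded_linear_axioms P(3) symP] by auto
  qed
  then have "L y = Some z" if "K y = Some z" for y z
    using that by (auto simp: K_iff)
  then show ?thesis
    using selfadjoint_inclusion_eq[OF K_selfadjoint sa] by simp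
qed

lemma sqrt_op_H: "sqrt_op H = K"
  unfolding sqrt_op_def
proof (rule the_equality)
  show "pos_semidef K \<and> K \<circ>\<^sub>m K = H"
    using K_pos_semidef K_K_eq_H by (rule conjI)
  show "L = K" if "pos_semidef L \<and> L \<circ>\<^sub>m L = H" for L
    using that sqrt_unique by blast
qed

end

section \<open>Representation of closed quadratic forms\<close>

text \<open>The condition on \<open>R\<close> is \<open>R\<^sup>2 \<le> R\<close>, that is \<open>0 \<le> R \<le> 1\<close>, written as a firm nonexpansiveness
  estimate because that is how a resolvent \<open>(1 + H)\<^sup>-\<^sup>1\<close> satisfies it.\<close>

lemma bounded_transform_of_resolvent:
  fixes R :: "'a::chilbert_space \<Rightarrow> 'a"
  assumes R: "bounded_clinear R" "inj R" and sym: "\<And>x y. inner (R x) y = inner x (R y)"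
    and firm: "\<And>x. (norm (R x))\<^sup>2 \<le> inner (R x) x"
  shows "\<exists>P Q. bounded_transform P Q \<and> (\<forall>x. P (P x) = R x)"
proof -
  interpret R: bounded_linear R
    by (rule bounded_clinearD[OF R(1)])
  have nonneg: "0 \<le> inner (R x) x" for x
    using firm[of x] zero_le_power2[of "norm (R x)"] by linarith
  have Rnorm: "norm (R x) \<le> norm x" for x
  proof (cases "R x = 0")
    case False
    have "norm (R x) * norm (R x) \<le> norm (R x) * norm x"
      using firm[of x] norm_cauchy_schwarz[of "R x" x] by (simp add: power2_eq_square)
    then show ?thesis
      using False by simp
  qed simp
  have Ldiff: "(norm (x - R x))\<^sup>2 = (norm x)\<^sup>2 - 2 * inner (R x) x + (norm (R x))\<^sup>2" for x
    by (simp add: power2_norm_eq_inner inner_diff_left inner_diff_right inner_commute)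
  have Lnorm: "norm (x - R x) \<le> norm x" for x
  proof (rule power2_le_imp_le)
    show "(norm (x - R x))\<^sup>2 \<le> (norm x)\<^sup>2"
      using Ldiff[of x] firm[of x] nonneg[of x] by linarith
  qed simp
  have posR: "positive_op R"
    using R.bounded_linear_axioms sym nonneg by (simp add: positive_op_def)
  have posL: "positive_op (\<lambda>x. x - R x)"
    unfolding positive_op_def
  proof (intro conjI allI)
    show "bounded_linear (\<lambda>x. x - R x)"
      by (intro bounded_linear_sub bounded_linear_ident R.bounded_linear_axioms)
    show "inner (x - R x) y = inner x (y - R y)" for x y
      by (simp add: inner_diff_left inner_diff_right sym)
    have "inner (R x) x \<le> norm x * norm x" for x
      using norm_cauchy_schwarz[of "R x" x] Rnorm[of x] mult_right_mono[of "norm (R x)" "norm x" "norm x"]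
      by simp
    then show "0 \<le> inner (x - R x) x" for x
      by (simp add: inner_diff_left dot_square_norm power2_eq_square)
  qed
  obtain P where P: "positive_op P" "\<And>x. P (P x) = R x"
    and Pc: "\<And>V x. bounded_linear V \<Longrightarrow> (\<And>x. V (R x) = R (V x)) \<Longrightarrow> V (P x) = P (V x)"
    using positive_sqrt_exists[OF posR Lnorm] by blast
  obtain Q where Q: "positive_op Q" "\<And>x. Q (Q x) = x - R x" "\<And>x. norm (x - Q x) \<le> norm x"
    and Qc: "\<And>V x. bounded_linear V \<Longrightarrow> (\<And>x. V (x - R x) = V x - R (V x)) \<Longrightarrow> V (Q x) = Q (V x)"
    using positive_sqrt_exists[OF posL] Rnorm by force
  have QR: "Q (R x) = R (Q x)" for x
    by (rule Qc[OF R.bounded_linear_axioms, symmetric]) (simp add: R.diff)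
  have "bounded_transform P Q"
  proof
    have "c *\<^sub>C P x = P (c *\<^sub>C x)" for c x
      by (rule Pc[OF bounded_linear_scaleC]) (simp add: bounded_clinearD(2)[OF R(1)])
    then show "bounded_clinear P"
      using positive_opD(1)[OF P(1)] by (simp add: bounded_clinear_def)
    have "c *\<^sub>C Q x = Q (c *\<^sub>C x)" for c x
      by (rule Qc[OF bounded_linear_scaleC])
        (simp add: bounded_clinearD(2)[OF R(1)] complex_vector.scale_right_diff_distrib)
    then show "bounded_clinear Q"
      using positive_opD(1)[OF Q(1)] by (simp add: bounded_clinear_def)
    show "inj P"
      by (rule injI) (metis P(2) R(2) injD)
    show "P (Q x) = Q (P x)" for x
      using Pc[OF positive_opD(1)[OF Q(1)] QR] by simp
    show "P (P x) + Q (Q x) = x" for x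
      by (simp add: P(2) Q(2))
  qed (use P(1) Q(1,3) in auto)
  with P(2) show ?thesis
    by blast
qed

text \<open>For a positive selfadjoint \<open>H\<close> the operator \<open>1 + H\<close> is bounded below, so its range \<open>M\<close> is closed;
  a vector orthogonal to the range would be an eigenvector of \<open>H\<close> for the eigenvalue \<open>-1\<close>. Hence
  \<open>1 + H\<close> has an everywhere defined inverse \<open>R\<close>.\<close>

lemma pos_semidef_eq_quotient_op:
  fixes H :: "'a::chilbert_space \<rightharpoonup> 'a"
  assumes H: "pos_semidef H"
  shows "\<exists>P Q. bounded_transform P Q \<and> H = quotient_op (\<lambda>x. P (P x)) (\<lambda>x. Q (Q x))"
proof -
  have sa: "selfadjoint_op H"
    using H by (simp add: pos_semidef_def)
  note lin = linear_opD[OF selfadjoint_opD(1)[OF sa]]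
  note sym = selfadjoint_opD(3)[OF sa]
  note pos = pos_semidef_nonneg[OF H]
  have norm_le: "norm x \<le> norm (x + y)" if "H x = Some y" for x y
  proof (rule power2_le_imp_le)
    have "(norm (x + y))\<^sup>2 = (norm x)\<^sup>2 + 2 * inner y x + (norm y)\<^sup>2"
      by (simp add: power2_norm_eq_inner inner_add_left inner_add_right inner_commute)
    then show "(norm x)\<^sup>2 \<le> (norm (x + y))\<^sup>2"
      using pos[OF that] by simp
  qed simp
  define M where "M = {x + y |x y. H x = Some y}"
  have "subspace M"
    unfolding subspace_def M_def
  proof (safe, goal_cases)
    case 1
    then show ?case
      using lin(1) by force
  next
    case (2 _ _ x y x' y')
    then show ?case
      by (intro exI[of _ "x + y"] exI[of _ "x' + y'"]) (simp add: lin(2))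
  next
    case (3 c _ x y)
    then show ?case
      by (intro exI[of _ "c *\<^sub>R x"] exI[of _ "c *\<^sub>R y"]) (simp add: lin(4) scaleR_right_distrib)
  qed
  have "closed M"
    unfolding closed_sequential_limits
  proof (intro allI impI, elim conjE)
    fix s l
    assume s: "\<forall>n. s n \<in> M" "s \<longlonglongrightarrow> l"
    then obtain x y where xy: "\<And>n. s n = x n + y n" "\<And>n. H (x n) = Some (y n)"
      unfolding M_def by simp metis
    have "norm (x m - x n) \<le> norm (s m - s n)" for m n
      using norm_le[OF lin(6)[OF xy(2)[of m] xy(2)[of n]]] by (simp add: xy(1) algebra_simps)
    then have "Cauchy x"
      using LIMSEQ_imp_Cauchy[OF s(2)] unfolding Cauchy_def dist_norm
      by (meson le_less_trans)
    then obtain a where a: "x \<longlonglongrightarrow> a"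
      using Cauchy_convergent_iff convergent_def by blast
    have "(\<lambda>n. s n - x n) \<longlonglongrightarrow> l - a"
      by (intro tendsto_diff s a)
    then have "y \<longlonglongrightarrow> l - a"
      by (simp add: xy(1))
    then have "H a = Some (l - a)"
      by (rule closed_opD[OF selfadjoint_closed[OF sa] a _ xy(2)])
    then show "l \<in> M"
      unfolding M_def by (intro CollectI exI[of _ a] exI[of _ "l - a"]) simp
  qed
  have "closure M = UNIV"
  proof (rule dense_if_no_orthogonal[OF \<open>subspace M\<close>])
    fix z
    assume z: "\<And>m. m \<in> M \<Longrightarrow> inner z m = 0"
    have "H z = Some (- z)"
    proof (rule selfadjoint_opD(4)[OF sa])
      fix x x'
      assume "H x = Some x'"
      then have "inner z (x + x') = 0"
        by (intro z) (auto simp: M_def)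
      then show "inner x' z = inner x (- z)"
        by (simp add: inner_add_right inner_commute)
    qed
    from pos[OF this] have "inner z z \<le> 0"
      by simp
    then show "z = 0"
      using antisym[OF _ inner_ge_zero[of z]] by simp
  qed
  then have "M = UNIV"
    using closure_closed[OF \<open>closed M\<close>] by simp
  then have "\<exists>x y. w = x + y \<and> H x = Some y" for w
    unfolding M_def by blast
  then have "\<exists>x. H x = Some (w - x)" for w
    by (metis add_diff_cancel_left')
  then obtain R where R: "\<And>w. H (R w) = Some (w - R w)"
    by metis
  have unique: "x = R (x + y)" if "H x = Some y" for x y
  proof -
    have "norm (x - R (x + y)) \<le> 0"
      using norm_le[OF lin(6)[OF that R[of "x + y"]]] by simp
    then show ?thesis
      by simp
  qed
  have Radd: "R (x + y) = R x + R y" for x y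
    using unique[OF lin(2)[OF R[of x] R[of y]]] by simp
  have RscaleC: "R (c *\<^sub>C x) = c *\<^sub>C R x" for c x
  proof -
    have "c *\<^sub>C R x + c *\<^sub>C (x - R x) = c *\<^sub>C x"
      unfolding scaleC_add_right[symmetric] by simp
    then show ?thesis
      using unique[OF lin(3)[OF R[of x], of c]] by simp
  qed
  have Rscale: "R (c *\<^sub>R x) = c *\<^sub>R R x" for c x
    by (simp add: scaleR_scaleC RscaleC)
  have Rnorm: "norm (R x) \<le> norm x" for x
    using norm_le[OF R[of x]] by simp
  have "bounded_linear R"
    by (rule bounded_linear_intro[where K = 1]) (simp_all add: Radd Rscale Rnorm)
  then have 1: "bounded_clinear R"
    by (simp add: bounded_clinear_def RscaleC)
  have 2: "inj R"
  proof (rule injI)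
    fix x y
    assume "R x = R y"
    then have "H (R x) = Some (y - R x)"
      using R[of y] by simp
    then show "x = y"
      unfolding R[of x] by simp
  qed
  have 3: "inner (R x) y = inner x (R y)" for x y
    using sym[OF R[of x] R[of y]] by (simp add: inner_diff_left inner_diff_right)
  have 4: "(norm (R x))\<^sup>2 \<le> inner (R x) x" for x
    using pos[OF R[of x]] by (simp add: inner_diff_left power2_norm_eq_inner inner_commute[of x])
  obtain P Q where bt: "bounded_transform P Q" and PP: "\<And>x. P (P x) = R x"
    using bounded_transform_of_resolvent[OF 1 2 3 4] by blast
  interpret bounded_transform P Q by fact
  have QQ: "Q (Q x) = x - R x" for x
    using sq[of x] by (simp add: PP algebra_simps)
  have "H y = Some z \<longleftrightarrow> quotient_op (\<lambda>x. P (P x)) (\<lambda>x. Q (Q x)) y = Some z" for y z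
    unfolding H_iff unfolding PP QQ
  proof
    assume y: "H y = Some z"
    then have "y = R (y + z)"
      by (rule unique)
    then show "\<exists>w. y = R w \<and> z = w - R w"
      by (intro exI[of _ "y + z"]) simp
  qed (use R in fastforce)
  then have "H y = quotient_op (\<lambda>x. P (P x)) (\<lambda>x. Q (Q x)) y" for y
    by (metis not_Some_eq)
  then have "H = quotient_op (\<lambda>x. P (P x)) (\<lambda>x. Q (Q x))"
    by (rule ext)
  with bt show ?thesis
    by blast
qed

text \<open>The hypothesis bounds the functional \<open>Px \<mapsto> \<langle>x, y\<rangle>\<close>, so Riesz representation should give \<open>w\<close>
  with \<open>\<langle>x, y\<rangle> = \<langle>Px, w\<rangle> = \<langle>x, Pw\<rangle>\<close>. To avoid extending the functional from the range of \<open>P\<close>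
  to its closure, \<open>w\<close> is read off from the orthogonal projection of \<open>(0, 1)\<close> onto the closure of the
  graph of the functional; boundedness says that \<open>(0, 1)\<close> is not in this closure.\<close>

lemma in_range_if_bounded:
  fixes P :: "'a::{real_inner,complete_space} \<Rightarrow> 'a"
  assumes P: "positive_op P" and y: "\<And>x. 2 * inner x y \<le> C + (norm (P x))\<^sup>2"
  shows "\<exists>w. y = P w"
proof -
  interpret P: bounded_linear P
    using P by (rule positive_opD)
  define N where "N = range (\<lambda>x. (P x, inner x y))"
  have "linear (\<lambda>x. (P x, inner x y))"
    by (auto intro!: linearI simp: P.add P.scaleR inner_add_left)
  then have "subspace N"
    unfolding N_def by (intro linear_subspace_image subspace_UNIV)
  have "closed (closure N)" "subspace (closure N)"
    using subspace_closure[OF \<open>subspace N\<close>] by auto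
  then obtain p where p: "p \<in> closure N" "\<And>n. n \<in> closure N \<Longrightarrow> inner ((0, 1) - p) n = 0"
    using projection_exists[of "closure N" "(0, 1)"] by blast
  \<comment> \<open>By homogeneity in \<open>x\<close>, the hypothesis holds with any factor \<open>t\<close>; this one
    separates \<open>(0, 1)\<close> from the graph, as \<open>2t > C\<close>.\<close>
  define t where "t = \<bar>C\<bar> + 1"
  have "closed {p :: 'a \<times> real. 2 * t * snd p \<le> C + t\<^sup>2 * (norm (fst p))\<^sup>2}"
    by (intro closed_Collect_le continuous_intros)
  moreover have "N \<subseteq> {p. 2 * t * snd p \<le> C + t\<^sup>2 * (norm (fst p))\<^sup>2}"
  proof -
    have "2 * t * inner x y \<le> C + t\<^sup>2 * (norm (P x))\<^sup>2" for x
      using y[of "t *\<^sub>R x"] by (simp add: P.scaleR power_mult_distrib)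
    then show ?thesis
      by (auto simp: N_def)
  qed
  ultimately have "closure N \<subseteq> {p. 2 * t * snd p \<le> C + t\<^sup>2 * (norm (fst p))\<^sup>2}"
    by (rule closure_minimal[rotated])
  then have "(0, 1) \<notin> closure N"
    by (auto simp: t_def)
  obtain a b where ab: "(0, 1) - p = (a, b)"
    by fastforce
  have "inner (a, b) (a, b) = inner ((0, 1) - p) (0, 1) - inner ((0, 1) - p) p"
    unfolding ab[symmetric] by (simp only: inner_diff_right)
  also have "\<dots> = b"
    using p(2)[OF p(1)] by (simp add: ab)
  finally have b: "inner (a, b) (a, b) = b" .
  have "b \<noteq> 0"
  proof
    assume "b = 0"
    then have "(0, 1) - p = 0"
      using b ab by (metis inner_eq_zero_iff)
    then show False
      using p(1) \<open>(0, 1) \<notin> closure N\<close> by simp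
  qed
  have orth: "inner a (P x) + b * inner x y = 0" for x
    using p(2)[of "(P x, inner x y)"] closure_subset[of N] unfolding ab N_def by auto
  have "inner x y = inner x (P ((- 1 / b) *\<^sub>R a))" for x
  proof -
    have "b * inner x y = - inner x (P a)"
      using orth[of x] positive_opD(2)[OF P, of x a] by (simp add: inner_commute)
    then show ?thesis
      using \<open>b \<noteq> 0\<close> by (simp add: P.scaleR P.neg field_simps)
  qed
  then have "y = P ((- 1 / b) *\<^sub>R a)"
    by (rule inner_right_eqI)
  then show ?thesis
    by blast
qed

text \<open>A closed quadratic form with domain \<open>D\<close>. The sesquilinear form behind \<open>q\<close> is never formed: the
  parallelogram law is exactly what the available storage provides, and it suffices.\<close>

locale closed_form =
  fixes D :: "'a::chilbert_space set" and q :: "'a \<Rightarrow> real"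
  assumes dense: "closure D = UNIV"
    and zero: "0 \<in> D"
    and add: "x \<in> D \<Longrightarrow> y \<in> D \<Longrightarrow> x + y \<in> D"
    and scale: "x \<in> D \<Longrightarrow> c *\<^sub>C x \<in> D"
    and q_scale: "x \<in> D \<Longrightarrow> q (c *\<^sub>C x) = (cmod c)\<^sup>2 * q x"
    and q_nonneg: "x \<in> D \<Longrightarrow> 0 \<le> q x"
    and q_parallelogram: "x \<in> D \<Longrightarrow> y \<in> D \<Longrightarrow> q (x + y) + q (x - y) = 2 * q x + 2 * q y"
    and q_lsc: "(\<And>n::nat. s n \<in> D) \<Longrightarrow> s \<longlonglongrightarrow> l \<Longrightarrow> (\<lambda>n. q (s n)) \<longlonglongrightarrow> r \<Longrightarrow> l \<in> D \<and> q l \<le> r"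
begin

lemma minus: "x \<in> D \<Longrightarrow> - x \<in> D"
  using scale[of x "-1"] by simp

lemma diff: "x \<in> D \<Longrightarrow> y \<in> D \<Longrightarrow> x - y \<in> D"
  using add[of x "- y"] minus[of y] by simp

lemma scale_real: "x \<in> D \<Longrightarrow> c *\<^sub>R x \<in> D"
  by (simp add: scaleR_scaleC scale)

lemma q_scale_real: "x \<in> D \<Longrightarrow> q (c *\<^sub>R x) = c\<^sup>2 * q x"
  by (simp add: scaleR_scaleC q_scale)

lemma q_zero: "q 0 = 0"
  using q_scale_real[OF zero, of 0] by simp

text \<open>The objective of the Moreau-Yosida regularization. Its minimizer in \<open>y\<close> is the resolvent
  \<open>(1 + H)\<^sup>-\<^sup>1x\<close>, and its minimum is \<open>\<langle>(1 - (1 + H)\<^sup>-\<^sup>1)x, x\<rangle>\<close>.\<close>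

definition E :: "'a \<Rightarrow> 'a \<Rightarrow> real" where
  "E x y = q y + (norm (x - y))\<^sup>2"

lemma E_parallelogram:
  assumes "y \<in> D" "y' \<in> D"
  shows "E (x + x') (y + y') + E (x - x') (y - y') = 2 * E x y + 2 * E x' y'"
proof -
  have e: "x + x' - (y + y') = (x - y) + (x' - y')" "x - x' - (y - y') = (x - y) - (x' - y')"
    by simp_all
  show ?thesis
    unfolding E_def e
    using arg_cong2[OF q_parallelogram[OF assms] parallelogram[of "x - y" "x' - y'"], of "(+)"]
    by (simp only: distrib_left ac_simps)
qed

lemma E_scale: "y \<in> D \<Longrightarrow> E (c *\<^sub>C x) (c *\<^sub>C y) = (cmod c)\<^sup>2 * E x y"
proof -
  have e: "c *\<^sub>C x - c *\<^sub>C y = c *\<^sub>C (x - y)"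
    by (simp add: complex_vector.scale_right_diff_distrib)
  show "?thesis" if "y \<in> D"
    unfolding E_def e norm_scaleC q_scale[OF that] by (simp add: power_mult_distrib algebra_simps)
qed

lemma E_midpoint:
  assumes "y \<in> D" "z \<in> D"
  shows "2 * E x ((1/2) *\<^sub>R (y + z)) + 1/2 * (norm (y - z))\<^sup>2 \<le> E x y + E x z"
proof -
  have "E (x + x) (y + z) + E (x - x) (y - z) = 2 * E x y + 2 * E x z"
    by (rule E_parallelogram[OF assms])
  moreover have "E (x + x) (y + z) = 4 * E x ((1/2) *\<^sub>R (y + z))"
  proof -
    have "E (2 *\<^sub>C x) (2 *\<^sub>C (1/2) *\<^sub>R (y + z)) = 4 * E x ((1/2) *\<^sub>R (y + z))"
      by (subst E_scale) (auto intro!: scale_real add assms)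
    moreover have "2 *\<^sub>C x = x + x" "2 *\<^sub>C (1/2) *\<^sub>R (y + z) = y + z"
      using scaleR_scaleC[of 2 x] scaleR_scaleC[of 2 "(1/2) *\<^sub>R (y + z)"] by (simp_all add: scaleR_2)
    ultimately show ?thesis
      by simp
  qed
  moreover have "(norm (y - z))\<^sup>2 \<le> E (x - x) (y - z)"
    using q_nonneg[OF diff[OF assms]] by (simp add: E_def norm_minus_commute)
  ultimately show ?thesis
    by simp
qed

lemma E_minimizer_exists: "\<exists>y\<in>D. \<forall>z\<in>D. E x y \<le> E x z"
proof (rule minimizer_exists[where c = "1/2" and b = 0])
  show "D \<noteq> {}"
    using zero by blast
  show "0 \<le> E x y" if "y \<in> D" for y
    using q_nonneg[OF that] by (simp add: E_def)
  show "(1/2) *\<^sub>R (y + z) \<in> D \<and>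
      2 * E x ((1/2) *\<^sub>R (y + z)) + 1/2 * (norm (y - z))\<^sup>2 \<le> E x y + E x z"
    if "y \<in> D" "z \<in> D" for y z
    using E_midpoint[OF that] add[OF that] scale_real by blast
next
  fix s l r
  assume s: "\<And>n::nat. s n \<in> D" "s \<longlonglongrightarrow> l" "(\<lambda>n. E x (s n)) \<longlonglongrightarrow> r"
  have "(\<lambda>n. E x (s n) - (norm (x - s n))\<^sup>2) \<longlonglongrightarrow> r - (norm (x - l))\<^sup>2"
    by (intro tendsto_intros s)
  then have "(\<lambda>n. q (s n)) \<longlonglongrightarrow> r - (norm (x - l))\<^sup>2"
    by (simp add: E_def)
  from q_lsc[OF s(1,2) this] show "l \<in> D \<and> E x l \<le> r"
    by (simp add: E_def)
qed simp

definition R :: "'a \<Rightarrow> 'a" where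
  "R x = (SOME y. y \<in> D \<and> (\<forall>z\<in>D. E x y \<le> E x z))"

lemma R_in_D: "R x \<in> D" and R_min: "z \<in> D \<Longrightarrow> E x (R x) \<le> E x z"
  using someI_ex[of "\<lambda>y. y \<in> D \<and> (\<forall>z\<in>D. E x y \<le> E x z)"] E_minimizer_exists[of x]
  unfolding R_def by blast+

lemma R_unique:
  assumes y: "y \<in> D" "\<And>z. z \<in> D \<Longrightarrow> E x y \<le> E x z"
  shows "R x = y"
proof -
  have "E x y \<le> E x ((1/2) *\<^sub>R (R x + y))" "E x y \<le> E x (R x)" "E x (R x) \<le> E x y"
    using y R_in_D R_min by (auto intro!: y scale_real add)
  then have "(norm (R x - y))\<^sup>2 \<le> 0"
    using E_midpoint[OF R_in_D y(1), of x x] by linarith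
  then show ?thesis
    by simp
qed

lemma R_zero: "R 0 = 0"
proof (rule R_unique[OF zero])
  show "E 0 0 \<le> E 0 z" if "z \<in> D" for z
    using q_nonneg[OF that] by (simp add: E_def q_zero)
qed

lemma R_scale: "R (c *\<^sub>C x) = c *\<^sub>C R x"
proof (cases "c = 0")
  case True
  then show ?thesis
    by (simp add: R_zero)
next
  case False
  show ?thesis
  proof (rule R_unique)
    fix z
    assume z: "z \<in> D"
    have "c *\<^sub>C inverse c *\<^sub>C z = z"
      using False by (simp add: scaleC_scaleC scaleC_one)
    then have "E (c *\<^sub>C x) z = (cmod c)\<^sup>2 * E x (inverse c *\<^sub>C z)"
      using E_scale[OF scale[OF z], of c x "inverse c"] by simp
    moreover have "E (c *\<^sub>C x) (c *\<^sub>C R x) = (cmod c)\<^sup>2 * E x (R x)"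
      by (rule E_scale[OF R_in_D])
    ultimately show "E (c *\<^sub>C x) (c *\<^sub>C R x) \<le> E (c *\<^sub>C x) z"
      using R_min[OF scale[OF z]] by (simp add: mult_left_mono)
  qed (intro scale R_in_D)
qed

definition m :: "'a \<Rightarrow> real" where
  "m x = E x (R x)"

lemma m_le: "y \<in> D \<Longrightarrow> m x \<le> E x y"
  unfolding m_def by (rule R_min)

lemma m_scale: "m (c *\<^sub>R x) = c\<^sup>2 * m x"
  unfolding m_def scaleR_scaleC R_scale by (simp add: E_scale[OF R_in_D])

text \<open>A partial minimum of a function of two variables that obeys the parallelogram law obeys it
  again; the reverse inequality arises by inserting \<open>x + y\<close> and \<open>x - y\<close>.\<close>

lemma m_subparallelogram: "m (x + y) + m (x - y) \<le> 2 * m x + 2 * m y"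
  using m_le[OF add[OF R_in_D R_in_D], of "x + y" x y] m_le[OF diff[OF R_in_D R_in_D], of "x - y" x y]
    E_parallelogram[OF R_in_D R_in_D, of x y x y] by (simp add: m_def)

lemma m_parallelogram: "m (x + y) + m (x - y) = 2 * m x + 2 * m y"
proof -
  have "m (2 *\<^sub>R x) + m (2 *\<^sub>R y) \<le> 2 * m (x + y) + 2 * m (x - y)"
    using m_subparallelogram[of "x + y" "x - y"] by (simp add: scaleR_2 algebra_simps)
  then show ?thesis
    using m_subparallelogram[of x y] by (simp add: m_scale)
qed

text \<open>Both \<open>E\<close> at the sums and \<open>m\<close> satisfy the parallelogram law, so the sum of two minimizers cannot
  miss the minimum.\<close>

lemma R_add: "R (x + y) = R x + R y"
proof (rule R_unique)
  show "R x + R y \<in> D"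
    by (intro add R_in_D)
  have "E (x + y) (R x + R y) + E (x - y) (R x - R y) = m (x + y) + m (x - y)"
    using E_parallelogram[OF R_in_D R_in_D, of x y x y] m_parallelogram[of x y] by (simp add: m_def)
  then have "E (x + y) (R x + R y) \<le> m (x + y)"
    using m_le[OF diff[OF R_in_D R_in_D], of "x - y" x y] by simp
  then show "E (x + y) (R x + R y) \<le> E (x + y) z" if "z \<in> D" for z
    using m_le[OF that] order_trans by blast
qed

lemma R_clinear: "bounded_clinear R"
  unfolding bounded_clinear_def
proof (intro conjI allI R_scale bounded_linear_intro[where K = 2])
  show "R (x + y) = R x + R y" for x y
    by (rule R_add)
  show "R (c *\<^sub>R x) = c *\<^sub>R R x" for c x
    by (simp add: scaleR_scaleC R_scale)
  show "norm (R x) \<le> norm x * 2" for x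
  proof -
    have "q (R x) + (norm (x - R x))\<^sup>2 \<le> (norm x)\<^sup>2"
      using m_le[OF zero, of x] by (simp add: m_def E_def q_zero)
    then have "(norm (x - R x))\<^sup>2 \<le> (norm x)\<^sup>2"
      using q_nonneg[OF R_in_D, of x] by linarith
    then have "norm (x - R x) \<le> norm x"
      by (simp add: power2_le_iff_abs_le)
    then show ?thesis
      using norm_triangle_ineq4[of x "x - R x"] by simp
  qed
qed

text \<open>\<open>2(x - Rx)\<close> is the gradient of \<open>m\<close>. Combined with homogeneity of \<open>m\<close> this one-sided estimate
  determines \<open>m\<close> and forces the symmetry of \<open>R\<close>.\<close>

lemma m_upper: "m (x + h) \<le> m x + 2 * inner (x - R x) h + (norm h)\<^sup>2"
proof -
  have "E (x + h) (R x) = m x + 2 * inner (x - R x) h + (norm h)\<^sup>2"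
    unfolding E_def m_def power2_norm_eq_inner
    by (simp add: inner_add_left inner_add_right inner_diff_left inner_diff_right inner_commute)
  then show ?thesis
    using m_le[OF R_in_D, of "x + h" x] by simp
qed

lemma m_eq: "m x = inner (x - R x) x"
proof -
  have "t * (2 * (m x - inner (x - R x) x)) \<le> t\<^sup>2 * ((norm x)\<^sup>2 - m x)" for t
  proof -
    have "m ((1 + t) *\<^sub>R x) \<le> m x + 2 * inner (x - R x) (t *\<^sub>R x) + (norm (t *\<^sub>R x))\<^sup>2"
      using m_upper[of x "t *\<^sub>R x"] by (simp add: scaleR_left_distrib)
    then show ?thesis
      unfolding m_scale by (simp add: power_mult_distrib algebra_simps power2_eq_square)
  qed
  then have "2 * (m x - inner (x - R x) x) = 0"
    by (rule real_eq_0_of_quadratic_bound)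
  then show ?thesis
    by simp
qed

lemma R_sym: "inner (R x) y = inner x (R y)"
proof -
  interpret R: bounded_linear R
    by (rule bounded_clinearD[OF R_clinear])
  have "t * (inner (y - R y) x - inner (x - R x) y) \<le> t\<^sup>2 * ((norm y)\<^sup>2 - m y)" for t
  proof -
    have "m (x + t *\<^sub>R y) = m x + t * (inner (x - R x) y + inner (y - R y) x) + t\<^sup>2 * m y"
      unfolding m_eq R.add R.scaleR
      by (simp add: inner_add_left inner_add_right inner_diff_left algebra_simps power2_eq_square)
    then show ?thesis
      using m_upper[of x "t *\<^sub>R y"] by (simp add: power_mult_distrib algebra_simps)
  qed
  then have "inner (y - R y) x - inner (x - R x) y = 0"
    by (rule real_eq_0_of_quadratic_bound)
  then show ?thesis
    by (simp add: inner_diff_left inner_commute[of x])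
qed

lemma q_R: "q (R x) = inner (x - R x) (R x)"
proof -
  have "q (R x) = inner (x - R x) x - inner (x - R x) (x - R x)"
    using m_eq[of x] unfolding m_def E_def power2_norm_eq_inner by linarith
  also have "\<dots> = inner (x - R x) (x - (x - R x))"
    by (simp only: inner_diff_right)
  finally show ?thesis
    by simp
qed

lemma R_inj: "inj R"
proof (rule injI)
  fix x y
  assume "R x = R y"
  define z where "z = x - y"
  have Rz: "R z = 0"
    using \<open>R x = R y\<close> linear_diff[OF bounded_linear.linear[OF bounded_clinearD(1)[OF R_clinear]]]
    by (simp add: z_def)
  have "z = 0"
  proof (rule orthogonal_dense_eq_0[OF dense])
    fix w
    assume w: "w \<in> D"
    have "t * (2 * inner z w) \<le> t\<^sup>2 * (q w + (norm w)\<^sup>2)" for t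
    proof -
      have "(norm z)\<^sup>2 \<le> t\<^sup>2 * q w + (norm (z - t *\<^sub>R w))\<^sup>2"
        using m_le[OF scale_real[OF w], of z t] by (simp add: m_def E_def Rz q_zero q_scale_real[OF w])
      moreover have "(norm (z - t *\<^sub>R w))\<^sup>2 = (norm z)\<^sup>2 - t * (2 * inner z w) + t\<^sup>2 * (norm w)\<^sup>2"
        unfolding power2_norm_eq_inner
        by (simp add: inner_diff_left inner_diff_right inner_commute power2_eq_square algebra_simps)
      ultimately show ?thesis
        by (simp add: algebra_simps)
    qed
    then have "2 * inner z w = 0"
      by (rule real_eq_0_of_quadratic_bound)
    then show "inner z w = 0"
      by simp
  qed
  then show "x = y"
    by (simp add: z_def)
qed

text \<open>Since \<open>q(Rx) = \<langle>x - Rx, Rx\<rangle> = \<parallel>QPx\<parallel>\<^sup>2\<close>, the form agrees with \<open>\<parallel>K \<cdot>\<parallel>\<^sup>2\<close> on the range of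
  \<open>R = P\<^sup>2\<close>. Lower semicontinuity extends the estimate \<open>q \<le> \<parallel>K \<cdot>\<parallel>\<^sup>2\<close> to the domain of \<open>K\<close>. In the
  other direction, the minimum property of \<open>m\<close> bounds \<open>2\<langle>x, y\<rangle> - \<parallel>Px\<parallel>\<^sup>2\<close> by \<open>q(y) + \<parallel>y\<parallel>\<^sup>2\<close>, which puts
  \<open>y\<close> into the range of \<open>P\<close> with the right norm (a Legendre transform).\<close>

theorem representation:
  shows "\<exists>P Q. bounded_transform P Q \<and> range P = D \<and> (\<forall>w. q (P w) = (norm (Q w))\<^sup>2)"
proof -
  have firm: "(norm (R x))\<^sup>2 \<le> inner (R x) x" for x
    using q_R[of x] q_nonneg[OF R_in_D, of x]
    by (simp add: inner_diff_left power2_norm_eq_inner inner_commute[of x])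
  obtain P Q where bt: "bounded_transform P Q" and PP: "\<And>x. P (P x) = R x"
    using bounded_transform_of_resolvent[OF R_clinear R_inj R_sym firm] by blast
  interpret bounded_transform P Q by fact
  have QQ: "Q (Q x) = x - R x" for x
    using sq[of x] by (simp add: PP algebra_simps)
  have qR: "q (P (P x)) = (norm (Q (P x)))\<^sup>2" for x
    unfolding PP q_R QQ[symmetric] by (simp add: PP[symmetric] power2_norm_eq_inner symP symQ PQ)
  have upper: "P w \<in> D \<and> q (P w) \<le> (norm (Q w))\<^sup>2" for w
  proof -
    have "w \<in> closure (range P)"
      using range_dense[OF P.bounded_linear_axioms P(3) symP] by simp
    then obtain s where s: "\<And>n. s n \<in> range P" "s \<longlonglongrightarrow> w"
      unfolding closure_sequential by blast
    then have "\<forall>n. \<exists>v. s n = P v"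
      by blast
    then obtain v where v: "\<And>n. s n = P (v n)"
      by metis
    show ?thesis
    proof (rule q_lsc)
      show "P (s n) \<in> D" for n
        by (simp add: v PP R_in_D)
      show "(\<lambda>n. P (s n)) \<longlonglongrightarrow> P w"
        by (intro P.tendsto s)
      have "(\<lambda>n. (norm (Q (s n)))\<^sup>2) \<longlonglongrightarrow> (norm (Q w))\<^sup>2"
        by (intro tendsto_intros Q.tendsto s)
      then show "(\<lambda>n. q (P (s n))) \<longlonglongrightarrow> (norm (Q w))\<^sup>2"
        by (simp add: v qR)
    qed
  qed
  have lower: "\<exists>w. y = P w \<and> (norm (Q w))\<^sup>2 \<le> q y" if y: "y \<in> D" for y
  proof -
    define C where "C = q y + (norm y)\<^sup>2"
    have C: "2 * inner x y \<le> C + (norm (P x))\<^sup>2" for x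
    proof -
      have "inner (x - R x) x \<le> q y + (norm (x - y))\<^sup>2"
        using m_le[OF y, of x] by (simp add: m_eq E_def)
      moreover have "inner (R x) x = (norm (P x))\<^sup>2"
        by (simp add: power2_norm_eq_inner symP flip: PP)
      ultimately show ?thesis
        by (simp add: C_def power2_norm_eq_inner inner_diff_left inner_diff_right inner_commute)
    qed
    obtain w where w: "y = P w"
      using in_range_if_bounded[OF P(1) C] by blast
    have "closed {v. 2 * inner v w \<le> C + (norm v)\<^sup>2}"
      by (intro closed_Collect_le continuous_intros)
    moreover have "range P \<subseteq> {v. 2 * inner v w \<le> C + (norm v)\<^sup>2}"
      using C by (auto simp: w symP)
    ultimately have "closure (range P) \<subseteq> {v. 2 * inner v w \<le> C + (norm v)\<^sup>2}"
      by (rule closure_minimal[rotated])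
    then have "2 * inner w w \<le> C + (norm w)\<^sup>2"
      using range_dense[OF P.bounded_linear_axioms P(3) symP] by auto
    then have "(norm (Q w))\<^sup>2 \<le> q y"
      using norm_sq[of w] by (simp add: C_def w power2_norm_eq_inner)
    with w show ?thesis
      by blast
  qed
  have "range P = D"
    using upper lower by blast
  moreover have "q (P w) = (norm (Q w))\<^sup>2" for w
  proof -
    obtain w' where "P w = P w'" "(norm (Q w'))\<^sup>2 \<le> q (P w)"
      using lower upper by blast
    then show ?thesis
      using upper[of w] P(3) by (simp add: inj_eq)
  qed
  ultimately show ?thesis
    using bt by blast
qed

end

section \<open>Adjoints\<close>

lemma cmod_cinner_le: "cmod (cinner x y) \<le> norm x * norm y"
proof (cases "cinner x y = 0")
  case False
  define z where "z = cinner x y"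
  define w where "w = cnj z / complex_of_real (cmod z)"
  have z: "cmod z \<noteq> 0"
    using False by (simp add: z_def)
  have w: "cmod w = 1"
    using z by (simp add: w_def norm_divide)
  have "w * z = complex_of_real (cmod z)"
    using z by (simp add: w_def field_simps complex_norm_square[symmetric] power2_eq_square)
  then have "cmod z = Re (cinner (w *\<^sub>C x) y)"
    by (simp add: cinner_scaleC_left z_def)
  also have "\<dots> \<le> norm (w *\<^sub>C x) * norm y"
    unfolding inner_eq_Re_cinner[symmetric] by (rule norm_cauchy_schwarz)
  finally show ?thesis
    by (simp add: norm_scaleC w z_def)
qed simp

lemma bounded_clinear_compose:
  assumes "bounded_clinear S" "bounded_clinear T"
  shows "bounded_clinear (\<lambda>x. S (T x))"
  using assms bounded_linear_compose[of S T] by (auto simp: bounded_clinear_def)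

lemma bounded_clinear_funpow:
  fixes T :: "'a::complex_inner \<Rightarrow> 'a"
  assumes "bounded_clinear T"
  shows "bounded_clinear (T ^^ n)"
  using assms
proof (induction n)
  case 0
  have "T ^^ 0 = (\<lambda>x. x)"
    by auto
  moreover have "bounded_clinear (\<lambda>x :: 'a. x)"
    using bounded_linear_ident by (simp add: bounded_clinear_def)
  ultimately show ?case
    by simp
next
  case (Suc n)
  then show ?case
    using bounded_clinear_compose[of T "T ^^ n"] by (simp add: comp_def)
qed

lemma cadjoint:
  fixes T :: "'a::chilbert_space \<Rightarrow> 'b::complex_inner"
  assumes T: "bounded_clinear T"
  shows "cinner (T x) y = cinner x (cadjoint T y)" and "inner (T x) y = inner x (cadjoint T y)"
    and "bounded_clinear (cadjoint T)"
proof -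
  interpret T: bounded_linear T
    by (rule bounded_clinearD[OF T])
  have "\<exists>z. \<forall>x. inner (T x) y = inner x z" for y
    by (rule riesz_representation) (rule bounded_linear_compose[OF bounded_linear_inner_left T.bounded_linear_axioms])
  then obtain S where S: "\<And>x y. inner (T x) y = inner x (S y)"
    by metis
  have SC: "cinner (T x) y = cinner x (S y)" for x y
    by (rule cinner_eqI) (simp_all only: S bounded_clinearD(2)[OF T, symmetric])
  have "cadjoint T = S"
    unfolding cadjoint_def
  proof (rule the_equality)
    show "\<forall>x y. cinner (T x) y = cinner x (S y)"
      using SC by blast
    fix S'
    assume S': "\<forall>x y. cinner (T x) y = cinner x (S' y)"
    show "S' = S"
    proof
      fix y
      show "S' y = S y"
        by (rule inner_right_eqI) (use S' SC in \<open>simp add: inner_eq_Re_cinner\<close>)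
    qed
  qed
  then show 1: "cinner (T x) y = cinner x (cadjoint T y)" "inner (T x) y = inner x (cadjoint T y)" for x y
    using S SC by auto
  have eqCI: "z = w" if "\<And>x. cinner x z = cinner x w" for z w :: 'a
    by (rule inner_right_eqI) (use that in \<open>simp add: inner_eq_Re_cinner\<close>)
  show "bounded_clinear (cadjoint T)"
    unfolding bounded_clinear_def
  proof (intro conjI allI)
    have "\<exists>K. \<forall>x. norm (T x) \<le> norm x * K"
      using T.bounded by blast
    then obtain K where K: "\<And>x. norm (T x) \<le> norm x * K"
      by blast
    show "bounded_linear (cadjoint T)"
    proof (rule bounded_linear_intro[where K = "\<bar>K\<bar>"])
      show "cadjoint T (x + y) = cadjoint T x + cadjoint T y" for x y
        by (rule inner_right_eqI) (simp add: inner_add_right flip: 1(2))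
      show "cadjoint T (r *\<^sub>R x) = r *\<^sub>R cadjoint T x" for r x
        by (rule inner_right_eqI) (simp flip: 1(2))
      show "norm (cadjoint T y) \<le> norm y * \<bar>K\<bar>" for y
      proof (cases "cadjoint T y = 0")
        case False
        have "norm (cadjoint T y) * norm (cadjoint T y) = inner (T (cadjoint T y)) y"
          by (simp add: 1(2) power2_norm_eq_inner[symmetric] power2_eq_square)
        also have "\<dots> \<le> norm (T (cadjoint T y)) * norm y"
          by (rule norm_cauchy_schwarz)
        also have "\<dots> \<le> (norm (cadjoint T y) * \<bar>K\<bar>) * norm y"
          using order_trans[OF K[of "cadjoint T y"] mult_left_mono[of K "\<bar>K\<bar>" "norm (cadjoint T y)"]]
          by (intro mult_right_mono) auto
        finally show ?thesis
          using False by (simp add: mult_ac)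
      qed simp
    qed
    show "cadjoint T (c *\<^sub>C y) = c *\<^sub>C cadjoint T y" for c y
      by (rule eqCI) (simp add: cinner_scaleC_right flip: 1(1))
  qed
qed

lemma cadjoint_funpow:
  fixes T :: "'a::chilbert_space \<Rightarrow> 'a"
  assumes "bounded_clinear T"
  shows "cinner ((T ^^ k) x) y = cinner x ((cadjoint T ^^ k) y)"
proof (induction k arbitrary: y)
  case (Suc k)
  have "cinner ((T ^^ Suc k) x) y = cinner ((T ^^ k) x) (cadjoint T y)"
    by (simp add: cadjoint(1)[OF assms])
  then show ?case
    by (simp add: Suc funpow_swap1)
qed simp

section \<open>Trajectories and extracted energy\<close>

locale linear_system =
  fixes A :: "'x::chilbert_space \<Rightarrow> 'x" and B :: "'u::chilbert_space \<Rightarrow> 'x"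
    and C :: "'x \<Rightarrow> 'y::chilbert_space" and D :: "'u \<Rightarrow> 'y"
  assumes A: "bounded_clinear A" and B: "bounded_clinear B"
    and C: "bounded_clinear C" and D: "bounded_clinear D"
begin

sublocale A: bounded_linear A by (rule bounded_clinearD[OF A])
sublocale B: bounded_linear B by (rule bounded_clinearD[OF B])
sublocale C: bounded_linear C by (rule bounded_clinearD[OF C])
sublocale D: bounded_linear D by (rule bounded_clinearD[OF D])

fun state :: "'x \<Rightarrow> (nat \<Rightarrow> 'u) \<Rightarrow> nat \<Rightarrow> 'x" where
  "state x u 0 = x"
| "state x u (Suc n) = A (state x u n) + B (u n)"

definition response :: "'x \<Rightarrow> (nat \<Rightarrow> 'u) \<Rightarrow> nat \<Rightarrow> 'y" where
  "response x u n = C (state x u n) + D (u n)"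

text \<open>The net energy extracted from the state \<open>x\<close> in \<open>N\<close> steps: what the system puts out minus what
  the input supplies.\<close>

definition gain :: "nat \<Rightarrow> 'x \<Rightarrow> (nat \<Rightarrow> 'u) \<Rightarrow> real" where
  "gain N x u = (\<Sum>n<N. (norm (response x u n))\<^sup>2 - (norm (u n))\<^sup>2)"

definition dissipative :: bool where
  "dissipative \<longleftrightarrow> (\<forall>N u. gain N 0 u \<le> 0)"

lemma state_append: "state x u (M + N) = state (state x u M) (\<lambda>n. u (M + n)) N"
  by (induction N) auto

lemma state_cong: "(\<And>k. k < n \<Longrightarrow> u k = v k) \<Longrightarrow> state x u n = state x v n"
  by (induction n) auto

lemma gain_cong: "(\<And>k. k < N \<Longrightarrow> u k = v k) \<Longrightarrow> gain N x u = gain N x v"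
  unfolding gain_def response_def by (intro sum.cong refl) (metis lessThan_iff less_trans state_cong)

lemma gain_append: "gain (M + N) x u = gain M x u + gain N (state x u M) (\<lambda>n. u (M + n))"
proof -
  have "gain (M + N) x u = gain M x u + (\<Sum>n = M..<M + N. (norm (response x u n))\<^sup>2 - (norm (u n))\<^sup>2)"
    unfolding gain_def by (simp add: lessThan_atLeast0 sum.atLeastLessThan_concat)
  also have "(\<Sum>n = M..<M + N. (norm (response x u n))\<^sup>2 - (norm (u n))\<^sup>2)
      = gain N (state x u M) (\<lambda>n. u (M + n))"
    unfolding gain_def response_def
    using sum.shift_bounds_nat_ivl[of "\<lambda>n. (norm (C (state x u n) + D (u n)))\<^sup>2 - (norm (u n))\<^sup>2" 0 M N]
    by (simp add: state_append add.commute[of _ M] lessThan_atLeast0)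
  finally show ?thesis .
qed

lemma state_add: "state (x + y) (\<lambda>n. u n + v n) n = state x u n + state y v n"
  by (induction n) (simp_all add: A.add B.add)

lemma state_diff: "state (x - y) (\<lambda>n. u n - v n) n = state x u n - state y v n"
  by (induction n) (simp_all add: A.diff B.diff)

lemma state_scaleC: "state (c *\<^sub>C x) (\<lambda>n. c *\<^sub>C u n) n = c *\<^sub>C state x u n"
  by (induction n) (simp_all add: bounded_clinearD(2)[OF A] bounded_clinearD(2)[OF B] scaleC_add_right)

lemma state_zero_input: "state x (\<lambda>_. 0) n = (A ^^ n) x"
  by (induction n) (simp_all add: B.zero)

text \<open>The gain is a quadratic form in the pair of state and input.\<close>

lemma gain_parallelogram:
  "gain N (x + y) (\<lambda>n. u n + v n) + gain N (x - y) (\<lambda>n. u n - v n) = 2 * gain N x u + 2 * gain N y v"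
proof -
  have "response (x + y) (\<lambda>n. u n + v n) n = response x u n + response y v n"
    "response (x - y) (\<lambda>n. u n - v n) n = response x u n - response y v n" for n
    by (simp_all add: response_def state_add state_diff C.add D.add C.diff D.diff)
  then have "((norm (response (x + y) (\<lambda>n. u n + v n) n))\<^sup>2 - (norm (u n + v n))\<^sup>2)
      + ((norm (response (x - y) (\<lambda>n. u n - v n) n))\<^sup>2 - (norm (u n - v n))\<^sup>2)
      = 2 * ((norm (response x u n))\<^sup>2 - (norm (u n))\<^sup>2) + 2 * ((norm (response y v n))\<^sup>2 - (norm (v n))\<^sup>2)" for n
    using parallelogram[of "response x u n" "response y v n"] parallelogram[of "u n" "v n"]
    by (simp only:) (simp add: algebra_simps)
  then show ?thesis
    unfolding gain_def by (simp only: sum_distrib_left flip: sum.distrib)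
qed

lemma gain_scaleC: "gain N (c *\<^sub>C x) (\<lambda>n. c *\<^sub>C u n) = (cmod c)\<^sup>2 * gain N x u"
proof -
  have "response (c *\<^sub>C x) (\<lambda>n. c *\<^sub>C u n) n = c *\<^sub>C response x u n" for n
    by (simp add: response_def state_scaleC bounded_clinearD(2)[OF C] bounded_clinearD(2)[OF D] scaleC_add_right)
  then show ?thesis
    by (simp add: gain_def norm_scaleC power_mult_distrib sum_distrib_left algebra_simps)
qed

lemma continuous_gain: "continuous_on UNIV (\<lambda>x. gain N x u)"
proof -
  have "continuous_on UNIV (\<lambda>x. state x u n)" for n
    by (induction n) (auto intro!: continuous_intros A.continuous_on)
  then show ?thesis
    unfolding gain_def response_def by (intro continuous_intros C.continuous_on)
qed

lemma gain_zero_input: "gain N x (\<lambda>_. 0) = (\<Sum>n<N. (norm (C ((A ^^ n) x)))\<^sup>2)"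
  by (simp add: gain_def response_def state_zero_input D.zero)

text \<open>Continuing with zero input costs nothing, so two experiments can be given the same length.\<close>

lemma gain_pad:
  assumes "N \<le> M"
  shows "\<exists>v. gain N x u \<le> gain M x v"
proof -
  define v where "v n = (if n < N then u n else 0)" for n
  have "gain N x v = gain N x u"
    by (intro gain_cong) (simp add: v_def)
  moreover have "0 \<le> gain (M - N) (state x v N) (\<lambda>n. v (N + n))"
    by (simp add: v_def gain_zero_input sum_nonneg)
  ultimately have "gain N x u \<le> gain M x v"
    using gain_append[of N "M - N" x v] assms by simp
  then show ?thesis
    by blast
qed

lemma dissipative_if_storage:
  assumes M: "0 \<in> M" "\<And>x u. x \<in> M \<Longrightarrow> A x + B u \<in> M"
    and S: "S 0 = 0" "\<And>x. x \<in> M \<Longrightarrow> 0 \<le> S x"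
      "\<And>x u. x \<in> M \<Longrightarrow> S (A x + B u) + (norm (C x + D u))\<^sup>2 \<le> S x + (norm u)\<^sup>2"
  shows dissipative
proof -
  have "state 0 u N \<in> M \<and> gain N 0 u + S (state 0 u N) \<le> 0" for N u
  proof (induction N)
    case 0
    then show ?case
      by (simp add: gain_def M S)
  next
    case (Suc N)
    then show ?case
      using S(3)[of "state 0 u N" "u N"] M(2) by (auto simp: gain_def response_def)
  qed
  then have "gain N 0 u \<le> 0" for N u
    using S(2) by (smt (verit))
  then show ?thesis
    by (simp add: dissipative_def)
qed

definition reachable :: "'x set" where
  "reachable = {state 0 u M |u M. True}"

lemma state_eq_sum: "state 0 (\<lambda>n. v (M - Suc n)) M = (\<Sum>k<M. (A ^^ k) (B (v k)))"
proof -
  have "state 0 u M = (\<Sum>k<M. (A ^^ k) (B (u (M - Suc k))))" for u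
  proof (induction M)
    case (Suc M)
    have "A ((A ^^ k) x) = (A ^^ Suc k) x" for k x
      by simp
    then have "state 0 u (Suc M) = (\<Sum>k<M. (A ^^ Suc k) (B (u (M - Suc k)))) + B (u M)"
      by (simp add: Suc A.sum)
    also have "\<dots> = (\<Sum>k<Suc M. (A ^^ k) (B (u (Suc M - Suc k))))"
      unfolding sum.lessThan_Suc_shift by (simp add: add.commute)
    finally show ?case .
  qed simp
  from this[of "\<lambda>n. v (M - Suc n)"] show ?thesis
    by (simp add: Suc_diff_Suc cong: sum.cong_simp)
qed

text \<open>Steering to \<open>A\<^sup>k B w\<close> takes one impulse followed by \<open>k\<close> steps of rest. To add a target that is
  reached later, the earlier input is delayed; starting from rest, waiting changes nothing.\<close>

lemma Rea_subset_reachable: "Rea A B \<subseteq> reachable"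
proof
  fix x
  assume "x \<in> Rea A B"
  then have "x \<in> cspan (\<Union>k. range ((A ^^ k) \<circ> B))"
    by (simp add: Rea_def)
  then show "x \<in> reachable"
  proof (induction rule: complex_vector.span_induct_alt)
    case base
    have "state 0 u 0 = 0" for u
      by simp
    then show ?case
      unfolding reachable_def by (metis (mono_tags, lifting) mem_Collect_eq)
  next
    case (step c y z)
    then obtain k w where y: "y = (A ^^ k) (B w)"
      by auto
    from step obtain u M where z: "z = state 0 u M"
      by (auto simp: reachable_def)
    \<comment> \<open>\<open>v1\<close> reaches \<open>z\<close> after a delay of \<open>k + 1\<close> steps; \<open>v2\<close> is an impulse at time \<open>M\<close>,
      so that both arrive at time \<open>M + (k + 1)\<close>.\<close>
    define v1 where "v1 n = (if n < k + 1 then 0 else u (n - (k + 1)))" for n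
    define v2 where "v2 n = (if n = M then c *\<^sub>C w else 0)" for n
    have z0: "state 0 (\<lambda>_. 0) n = 0" for n
      by (simp add: state_zero_input linear_0 bounded_linear.linear
          bounded_clinearD(1)[OF bounded_clinear_funpow[OF A]])
    have "state 0 v1 (k + 1 + M) = state (state 0 v1 (k + 1)) u M"
      unfolding state_append[of 0 v1 "k + 1" M] by (simp add: v1_def)
    also have "state 0 v1 (k + 1) = 0"
      using state_cong[of "k + 1" v1 "\<lambda>_. 0" 0] z0 by (simp add: v1_def del: state.simps)
    finally have 1: "state 0 v1 (M + (k + 1)) = z"
      by (simp add: z add.commute)
    have "state 0 v2 (M + 1) = c *\<^sub>C B w"
      using state_cong[of M v2 "\<lambda>_. 0" 0] z0[of M] bounded_clinearD(2)[OF B]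
      by (simp add: v2_def A.zero)
    then have 2: "state 0 v2 (M + (k + 1)) = c *\<^sub>C y"
      using state_append[of 0 v2 "M + 1" k] state_zero_input[of _ k]
      by (simp add: v2_def y add_ac bounded_clinearD(2)[OF bounded_clinear_funpow[OF A]] del: state.simps)
    have "state 0 (\<lambda>n. v2 n + v1 n) (M + (k + 1)) = c *\<^sub>C y + z"
      using state_add[of 0 0 v2 v1 "M + (k + 1)"] 1 2 by simp
    then show ?case
      unfolding reachable_def by (metis (mono_tags, lifting) mem_Collect_eq)
  qed
qed

end

section \<open>The available storage\<close>

context linear_system
begin

definition storage_dom :: "'x set" where
  "storage_dom = {x. \<exists>c. \<forall>N u. gain N x u \<le> c}"

definition storage :: "'x \<Rightarrow> real" where
  "storage x = (SUP (N, u). gain N x u)"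

lemma storage_upper:
  assumes "x \<in> storage_dom"
  shows "gain N x u \<le> storage x"
proof -
  have "bdd_above (range (\<lambda>(N, u). gain N x u))"
    using assms by (auto simp: storage_dom_def bdd_above_def)
  from cSUP_upper[OF _ this, of "(N, u)"] show ?thesis
    by (simp add: storage_def)
qed

lemma storage_least:
  assumes "\<And>N u. gain N x u \<le> c"
  shows "x \<in> storage_dom \<and> storage x \<le> c"
proof
  show "x \<in> storage_dom"
    using assms by (auto simp: storage_dom_def)
  show "storage x \<le> c"
    unfolding storage_def using assms by (intro cSUP_least) auto
qed

lemma storage_nonneg: "x \<in> storage_dom \<Longrightarrow> 0 \<le> storage x"
  using storage_upper[of x 0] by (simp add: gain_def)

lemma storage_observation:
  assumes "x \<in> storage_dom"
  shows "(\<Sum>n<N. (norm (C ((A ^^ n) x)))\<^sup>2) \<le> storage x"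
  using storage_upper[OF assms, of N "\<lambda>_. 0"] by (simp add: gain_zero_input)

text \<open>Dynamic programming: an input for the successor state, prefixed by \<open>u\<close>, is an input for \<open>x\<close>.\<close>

lemma storage_step:
  assumes x: "x \<in> storage_dom"
  shows "A x + B u \<in> storage_dom"
    and "storage (A x + B u) + (norm (C x + D u))\<^sup>2 \<le> storage x + (norm u)\<^sup>2"
proof -
  have "gain N (A x + B u) v \<le> storage x + (norm u)\<^sup>2 - (norm (C x + D u))\<^sup>2" for N v
  proof -
    define w where "w n = (case n of 0 \<Rightarrow> u | Suc k \<Rightarrow> v k)" for n
    have "gain (1 + N) x w = (norm (C x + D u))\<^sup>2 - (norm u)\<^sup>2 + gain N (A x + B u) v"
      unfolding gain_append by (simp add: gain_def response_def w_def)
    then show ?thesis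
      using storage_upper[OF x, of "1 + N" w] by simp
  qed
  from storage_least[OF this]
  show "A x + B u \<in> storage_dom"
    "storage (A x + B u) + (norm (C x + D u))\<^sup>2 \<le> storage x + (norm u)\<^sup>2"
    by auto
qed

end

locale dissipative_system = linear_system A B C D
  for A :: "'x::chilbert_space \<Rightarrow> 'x" and B :: "'u::chilbert_space \<Rightarrow> 'x"
    and C :: "'x \<Rightarrow> 'y::chilbert_space" and D :: "'u \<Rightarrow> 'y" +
  assumes dissip: dissipative
begin

lemma zero_in_storage_dom: "0 \<in> storage_dom" and storage_zero: "storage 0 = 0"
proof -
  have *: "0 \<in> storage_dom \<and> storage 0 \<le> 0"
    using dissip by (intro storage_least) (simp add: dissipative_def)
  then show "0 \<in> storage_dom" "storage 0 = 0"
    using storage_nonneg[of 0] by auto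
qed

lemma storage_scale_le:
  assumes x: "x \<in> storage_dom"
  shows "c *\<^sub>C x \<in> storage_dom \<and> storage (c *\<^sub>C x) \<le> (cmod c)\<^sup>2 * storage x"
proof (cases "c = 0")
  case True
  then show ?thesis
    by (simp add: zero_in_storage_dom storage_zero)
next
  case False
  show ?thesis
  proof (rule storage_least)
    fix N u
    have "gain N (c *\<^sub>C x) u = (cmod c)\<^sup>2 * gain N x (\<lambda>n. inverse c *\<^sub>C u n)"
      using False by (simp add: scaleC_scaleC scaleC_one flip: gain_scaleC)
    then show "gain N (c *\<^sub>C x) u \<le> (cmod c)\<^sup>2 * storage x"
      using storage_upper[OF x] by (simp add: mult_left_mono)
  qed
qed

lemma storage_scale:
  assumes x: "x \<in> storage_dom"
  shows "storage (c *\<^sub>C x) = (cmod c)\<^sup>2 * storage x"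
proof (cases "c = 0")
  case True
  then show ?thesis
    by (simp add: storage_zero)
next
  case False
  have "storage (inverse c *\<^sub>C c *\<^sub>C x) \<le> (cmod (inverse c))\<^sup>2 * storage (c *\<^sub>C x)"
    using storage_scale_le[OF x] storage_scale_le by blast
  then have "(cmod c)\<^sup>2 * storage x \<le> storage (c *\<^sub>C x)"
    using False by (simp add: scaleC_scaleC scaleC_one norm_divide power_divide field_simps)
  then show ?thesis
    using storage_scale_le[OF x, of c] by simp
qed

text \<open>The parallelogram law of the gain, applied at \<open>x + y\<close> and \<open>x - y\<close>. Choosing \<open>v = 0\<close>, for which
  the gain is nonnegative, shows that the domain is closed under addition.\<close>

lemma gain_add_diff_le:
  assumes "x \<in> storage_dom" "y \<in> storage_dom"
  shows "gain N (x + y) u + gain N (x - y) v \<le> 2 * storage x + 2 * storage y"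
proof -
  note e = double_scaleC[of x y]
  have "2 * gain N (x + y) u + 2 * gain N (x - y) v
      = gain N (2 *\<^sub>C x) (\<lambda>n. u n + v n) + gain N (2 *\<^sub>C y) (\<lambda>n. u n - v n)"
    unfolding gain_parallelogram[symmetric] e ..
  also have "\<dots> \<le> storage (2 *\<^sub>C x) + storage (2 *\<^sub>C y)"
    using storage_scale_le assms by (intro add_mono storage_upper) auto
  finally show ?thesis
    by (simp add: storage_scale assms)
qed

lemma storage_add_dom:
  assumes "x \<in> storage_dom" "y \<in> storage_dom"
  shows "x + y \<in> storage_dom"
proof -
  have "gain N (x + y) u \<le> 2 * storage x + 2 * storage y" for N u
    using gain_add_diff_le[OF assms, of N u "\<lambda>_. 0"]
    by (simp add: gain_zero_input) (smt (verit) sum_nonneg zero_le_power2)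
  then show ?thesis
    using storage_least by blast
qed

lemma storage_diff_dom: "x \<in> storage_dom \<Longrightarrow> y \<in> storage_dom \<Longrightarrow> x - y \<in> storage_dom"
  using storage_add_dom[of x "- y"] storage_scale_le[of y "-1"] by simp

lemma storage_subparallelogram:
  assumes "x \<in> storage_dom" "y \<in> storage_dom"
  shows "storage (x + y) + storage (x - y) \<le> 2 * storage x + 2 * storage y"
proof -
  have "gain N (x + y) u \<le> 2 * storage x + 2 * storage y - storage (x - y)" for N u
  proof -
    have "gain M (x - y) v \<le> 2 * storage x + 2 * storage y - gain N (x + y) u" for M v
    proof -
      obtain u' v' where "gain N (x + y) u \<le> gain (max N M) (x + y) u'"
        "gain M (x - y) v \<le> gain (max N M) (x - y) v'"
        using gain_pad max.cobounded1 max.cobounded2 by metis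
      then show ?thesis
        using gain_add_diff_le[OF assms, of "max N M" u' v'] by simp
    qed
    then show ?thesis
      using storage_least[of "x - y"] by force
  qed
  then show ?thesis
    using storage_least[of "x + y"] by force
qed

lemma storage_parallelogram:
  assumes "x \<in> storage_dom" "y \<in> storage_dom"
  shows "storage (x + y) + storage (x - y) = 2 * storage x + 2 * storage y"
proof -
  note e = double_scaleC[of x y]
  have "storage (2 *\<^sub>C x) + storage (2 *\<^sub>C y) \<le> 2 * storage (x + y) + 2 * storage (x - y)"
    using storage_subparallelogram[OF storage_add_dom[OF assms] storage_diff_dom[OF assms]]
    unfolding e .
  then show ?thesis
    using storage_subparallelogram[OF assms] by (simp add: storage_scale assms)
qed

lemma storage_lsc:
  assumes s: "\<And>n::nat. s n \<in> storage_dom" "s \<longlonglongrightarrow> l" and r: "(\<lambda>n. storage (s n)) \<longlonglongrightarrow> r"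
  shows "l \<in> storage_dom \<and> storage l \<le> r"
proof (rule storage_least)
  fix N u
  have "(\<lambda>n. gain N (s n) u) \<longlonglongrightarrow> gain N l u"
    using continuous_gain s(2) by (intro continuous_on_tendsto_compose[of UNIV "\<lambda>x. gain N x u"]) auto
  then show "gain N l u \<le> r"
    using r by (rule LIMSEQ_le) (use storage_upper[OF s(1)] in blast)
qed

lemma closed_form_storage:
  assumes "closure storage_dom = UNIV"
  shows "closed_form storage_dom storage"
proof
qed (use assms zero_in_storage_dom storage_add_dom storage_scale_le storage_scale storage_nonneg
    storage_parallelogram storage_lsc in blast)+

text \<open>Run the input that reaches the state and continue with \<open>v\<close>: from rest the total gain is at most
  \<open>0\<close>, so the continuation cannot extract more than was supplied before.\<close>

lemma gain_from_reachable: "gain N (state 0 u M) v \<le> (\<Sum>n<M. (norm (u n))\<^sup>2)"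
proof -
  define w where "w n = (if n < M then u n else v (n - M))" for n
  have "gain (M + N) 0 w = gain M 0 u + gain N (state 0 u M) v"
    using gain_cong[of M w u 0] state_cong[of M w u 0] by (simp add: gain_append w_def)
  then have "gain N (state 0 u M) v \<le> - gain M 0 u"
    using dissip by (simp add: dissipative_def) (smt (verit))
  also have "\<dots> \<le> (\<Sum>n<M. (norm (u n))\<^sup>2)"
    by (simp add: gain_def sum_subtractf sum_nonneg)
  finally show ?thesis .
qed

lemma Rea_subset_storage_dom: "Rea A B \<subseteq> storage_dom"
proof -
  have "reachable \<subseteq> storage_dom"
    using gain_from_reachable unfolding reachable_def storage_dom_def by blast
  then show ?thesis
    using Rea_subset_reachable by blast
qed

end

section \<open>Observability and coercivity\<close>

lemma abs_half_diff_le: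
  fixes a b m :: real
  shows "\<bar>a\<bar> \<le> m \<Longrightarrow> \<bar>b\<bar> \<le> m \<Longrightarrow> \<bar>(a - b) / 2\<bar> \<le> m"
  by (simp add: abs_le_iff)

lemma cinner_add_right: "cinner x (y + z) = cinner x y + cinner x z"
proof -
  have "cinner x (y + z) = cnj (cinner (y + z) x)"
    by (rule cinner_commute)
  also have "\<dots> = cnj (cinner y x) + cnj (cinner z x)"
    by (simp add: cinner_add_left)
  finally show ?thesis
    by (simp flip: cinner_commute)
qed

context linear_system
begin

text \<open>The unit ball of the observability operator on its domain.\<close>

definition unit_observed :: "'x \<Rightarrow> bool" where
  "unit_observed x \<longleftrightarrow> (\<forall>N. (\<Sum>n<N. (norm (C ((A ^^ n) x)))\<^sup>2) \<le> 1)"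

lemma CA_clinear: "bounded_clinear (\<lambda>x. C ((A ^^ n) x))"
  by (rule bounded_clinear_compose[OF C bounded_clinear_funpow[OF A]])

lemma CA_scaleR: "C ((A ^^ n) (r *\<^sub>R x)) = r *\<^sub>R C ((A ^^ n) x)"
  by (rule linear_cmul[OF bounded_linear.linear[OF bounded_clinearD(1)[OF CA_clinear]]])

text \<open>Every \<open>y\<close> is a bounded functional on the set of states with observed energy at most \<open>1\<close>. By
  uniform boundedness this set is bounded in norm, and homogeneity gives the estimate.\<close>

lemma coercive_if_observable_directions:
  assumes dir: "\<And>y. \<exists>c. \<forall>x. unit_observed x \<longrightarrow> \<bar>inner x y\<bar> \<le> c"
  shows "\<exists>\<delta>>0. \<forall>x e. (\<forall>N. (\<Sum>n<N. (norm (C ((A ^^ n) x)))\<^sup>2) \<le> e) \<longrightarrow> \<delta> * (norm x)\<^sup>2 \<le> e"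
proof -
  define S where "S m = {y. \<forall>x. unit_observed x \<longrightarrow> \<bar>inner x y\<bar> \<le> real m}" for m
  have "\<exists>m. \<exists>r>0. cball 0 r \<subseteq> S m"
  proof (rule uniform_boundedness)
    show "closed (S m)" for m
    proof -
      have "S m = (\<Inter>x\<in>Collect unit_observed. {y. \<bar>inner x y\<bar> \<le> real m})"
        by (auto simp: S_def)
      also have "closed \<dots>"
        by (intro closed_INT ballI closed_Collect_le continuous_intros)
      finally show ?thesis .
    qed
    show "(\<Union>m. S m) = UNIV"
    proof (rule set_eqI)
      fix y
      obtain c where c: "\<And>x. unit_observed x \<Longrightarrow> \<bar>inner x y\<bar> \<le> c"
        using dir by blast
      obtain m where "c \<le> real m"
        using real_arch_simple by blast
      then have "y \<in> S m"
        unfolding S_def using c order_trans by blast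
      then show "y \<in> (\<Union>m. S m) \<longleftrightarrow> y \<in> UNIV"
        by blast
    qed
    show "(1/2) *\<^sub>R (y - z) \<in> S m" if "y \<in> S m" "z \<in> S m" for m y z
    proof -
      have "\<bar>inner x ((1/2) *\<^sub>R (y - z))\<bar> \<le> real m" if "unit_observed x" for x
      proof -
        have "\<bar>inner x y\<bar> \<le> real m" "\<bar>inner x z\<bar> \<le> real m"
          using \<open>y \<in> S m\<close> \<open>z \<in> S m\<close> that by (auto simp: S_def)
        then have "\<bar>(inner x y - inner x z) / 2\<bar> \<le> real m"
          by (rule abs_half_diff_le)
        moreover have "inner x ((1/2) *\<^sub>R (y - z)) = (inner x y - inner x z) / 2"
          by (simp add: inner_diff_right)
        ultimately show ?thesis
          by (simp only:)
      qed
      then show ?thesis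
        by (simp add: S_def)
    qed
  qed
  then obtain m r where r: "r > 0" "cball 0 r \<subseteq> S m"
    by blast
  have bound: "r * norm x \<le> real m" if x: "unit_observed x" for x
  proof (cases "x = 0")
    case False
    have "(r / norm x) *\<^sub>R x \<in> S m"
      using r False by (intro subsetD[OF r(2)]) simp
    then have "\<bar>inner x ((r / norm x) *\<^sub>R x)\<bar> \<le> real m"
      using x unfolding S_def by blast
    moreover have "inner x ((r / norm x) *\<^sub>R x) = r * norm x"
      using False by (simp add: dot_square_norm power2_eq_square)
    ultimately show ?thesis
      by linarith
  qed simp
  define \<delta> where "\<delta> = (r / (real m + 1))\<^sup>2"
  have pos: "\<delta> * (norm x)\<^sup>2 \<le> e"
    if e: "e > 0" and x: "\<And>N. (\<Sum>n<N. (norm (C ((A ^^ n) x)))\<^sup>2) \<le> e" for x e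
  proof -
    have "unit_observed ((1 / sqrt e) *\<^sub>R x)"
      unfolding unit_observed_def
    proof
      fix N
      have "(\<Sum>n<N. (norm (C ((A ^^ n) ((1 / sqrt e) *\<^sub>R x))))\<^sup>2)
          = (\<Sum>n<N. (norm (C ((A ^^ n) x)))\<^sup>2) / e"
        using e by (simp add: CA_scaleR
            power_divide sum_divide_distrib)
      then show "(\<Sum>n<N. (norm (C ((A ^^ n) ((1 / sqrt e) *\<^sub>R x))))\<^sup>2) \<le> 1"
        using x[of N] e by simp
    qed
    from bound[OF this] have "r * norm x \<le> real m * sqrt e"
      using e by (simp add: field_simps)
    also have "\<dots> \<le> (real m + 1) * sqrt e"
      using e by simp
    finally have "r / (real m + 1) * norm x \<le> sqrt e"
      by (simp add: field_simps)
    then have "(r / (real m + 1) * norm x)\<^sup>2 \<le> (sqrt e)\<^sup>2"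
      using r by (intro power_mono) auto
    also have "(sqrt e)\<^sup>2 = e"
      using e by simp
    finally show ?thesis
      unfolding \<delta>_def power_mult_distrib .
  qed
  have "\<delta> * (norm x)\<^sup>2 \<le> e"
    if x: "\<And>N. (\<Sum>n<N. (norm (C ((A ^^ n) x)))\<^sup>2) \<le> e" for x e
  proof (rule field_le_epsilon)
    fix d :: real
    assume d: "d > 0"
    have "0 \<le> e"
      using x[of 0] by simp
    then show "\<delta> * (norm x)\<^sup>2 \<le> e + d"
      using d x by (intro pos) (auto intro: add_increasing2)
  qed
  moreover have "\<delta> > 0"
    using r by (simp add: \<delta>_def)
  ultimately show ?thesis
    by blast
qed

text \<open>The generators of \<open>Obs C A\<close> pair with \<open>x\<close> through single observations, as
  \<open>\<langle>x, A\<^sup>*\<^sup>kC\<^sup>*v\<rangle> = \<langle>CA\<^sup>kx, v\<rangle>\<close>.\<close>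

lemma Obs_bounded_direction:
  assumes "y \<in> Obs C A"
  shows "\<exists>c. \<forall>x. unit_observed x \<longrightarrow> cmod (cinner x y) \<le> c"
  using assms unfolding Obs_def
proof (induction rule: complex_vector.span_induct_alt)
  case base
  have "cinner x 0 = 0" for x :: 'x
    using cinner_scaleC_right[of x 0 0] by simp
  then show ?case
    by auto
next
  case (step a y z)
  then obtain k v where y: "y = (cadjoint A ^^ k) (cadjoint C v)"
    by auto
  obtain c where c: "\<And>x. unit_observed x \<Longrightarrow> cmod (cinner x z) \<le> c"
    using step by blast
  have "cmod (cinner x (a *\<^sub>C y + z)) \<le> cmod a * norm v + c" if x: "unit_observed x" for x
  proof -
    have "cinner x (a *\<^sub>C y + z) = cnj a * cinner x y + cinner x z"
      by (simp add: cinner_add_right cinner_scaleC_right)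
    moreover have "cinner x y = cinner (C ((A ^^ k) x)) v"
      by (simp add: y cadjoint(1)[OF C] cadjoint_funpow[OF A])
    moreover have "norm (C ((A ^^ k) x)) \<le> 1"
    proof -
      have "(norm (C ((A ^^ k) x)))\<^sup>2 \<le> (\<Sum>n<Suc k. (norm (C ((A ^^ n) x)))\<^sup>2)"
        by (simp add: sum_nonneg)
      also have "\<dots> \<le> 1\<^sup>2"
        using x by (simp add: unit_observed_def del: sum.lessThan_Suc)
      finally show ?thesis
        by (rule power2_le_imp_le) simp
    qed
    then have "cmod (cinner (C ((A ^^ k) x)) v) \<le> 1 * norm v"
      by (intro order_trans[OF cmod_cinner_le] mult_right_mono) auto
    ultimately have "cmod (cinner x (a *\<^sub>C y + z)) \<le> cmod a * norm v + cmod (cinner x z)"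
      by (simp add: norm_triangle_le norm_mult mult_left_mono)
    then show ?thesis
      using c[OF x] by simp
  qed
  then show ?case
    by blast
qed

text \<open>All multiples of \<open>x\<close> have observed energy \<open>0\<close>, so the bound on the direction \<open>y\<close> forces
  \<open>\<langle>x, y\<rangle> = 0\<close>.\<close>

lemma observable_imp_eq_0:
  assumes "observable C A" "\<And>n. C ((A ^^ n) x) = 0"
  shows "x = 0"
proof (rule orthogonal_dense_eq_0)
  show "closure (Obs C A) = UNIV"
    using assms(1) by (simp add: observable_def)
  fix y
  assume "y \<in> Obs C A"
  have obs: "unit_observed (c *\<^sub>R x)" for c
    by (simp add: unit_observed_def CA_scaleR assms(2))
  obtain c where c: "\<And>x. unit_observed x \<Longrightarrow> cmod (cinner x y) \<le> c"
    using Obs_bounded_direction[OF \<open>y \<in> Obs C A\<close>] by blast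
  have "inner (t *\<^sub>R x) y \<le> c" for t
    using c[OF obs] complex_Re_le_cmod order_trans unfolding inner_eq_Re_cinner by blast
  then have le: "t * inner x y \<le> c" for t
    by simp
  show "inner x y = 0"
  proof (rule ccontr)
    assume "inner x y \<noteq> 0"
    then show False
      using le[of "(c + 1) / inner x y"] by simp
  qed
qed

end

section \<open>Square summable sequences of observations\<close>

text \<open>The common shape of the observability and of the adjoint controllability operator.\<close>

definition sequence_op :: "(nat \<Rightarrow> 'x \<Rightarrow> 'w) \<Rightarrow> ('x::complex_inner \<rightharpoonup> 'w::complex_inner ell2)" where
  "sequence_op G = (\<lambda>x. if summable (\<lambda>n. (norm (G n x))\<^sup>2) then Some (Abs_ell2 (\<lambda>n. G n x)) else None)"

lemma sequence_op_eq_Some_iff: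
  "sequence_op G x = Some f \<longleftrightarrow> ell2_nth f = (\<lambda>n. G n x)"
proof
  assume "sequence_op G x = Some f"
  then show "ell2_nth f = (\<lambda>n. G n x)"
    by (auto simp: sequence_op_def Abs_ell2_inverse split: if_splits)
next
  assume f: "ell2_nth f = (\<lambda>n. G n x)"
  then have "summable (\<lambda>n. (norm (G n x))\<^sup>2)"
    using ell2_summable[of f] by simp
  then show "sequence_op G x = Some f"
    by (simp add: sequence_op_def ell2_nth_inverse flip: f)
qed

lemma linear_sequence_op:
  assumes "\<And>n. bounded_clinear (G n)"
  shows "linear_op (sequence_op G)"
proof -
  have "G n 0 = 0" "G n (x + y) = G n x + G n y" "G n (c *\<^sub>C x) = c *\<^sub>C G n x" for n x y c
    using assms[of n] bounded_linear.linear[of "G n"] linear_0[of "G n"] linear_add[of "G n"]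
    by (auto simp: bounded_clinear_def)
  then show ?thesis
    unfolding linear_op_def sequence_op_eq_Some_iff
    by (auto simp: zero_ell2.rep_eq plus_ell2.rep_eq scaleC_ell2.rep_eq)
qed

lemma norm_sum_le_of_ell2: "(\<Sum>k<n. (norm (ell2_nth f k))\<^sup>2) \<le> (norm f)\<^sup>2"
  using norm_ell2_le_iff[of "norm f" f] by simp

definition ell2_single :: "nat \<Rightarrow> 'a::real_inner \<Rightarrow> 'a ell2" where
  "ell2_single k u = Abs_ell2 (\<lambda>n. if n = k then u else 0)"

lemma ell2_nth_single: "ell2_nth (ell2_single k u) = (\<lambda>n. if n = k then u else 0)"
proof -
  have "summable (\<lambda>n. (norm (if n = k then u else 0))\<^sup>2)"
    by (rule summable_finite[of "{k}"]) auto
  then show ?thesis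
    by (simp add: ell2_single_def Abs_ell2_inverse)
qed

lemma inner_ell2_single: "inner a (ell2_single k u) = inner (ell2_nth a k) u"
proof -
  have "inner a (ell2_single k u) = (\<Sum>n\<in>{k}. inner (ell2_nth a n) (ell2_nth (ell2_single k u) n))"
    unfolding inner_ell2_def by (rule suminf_finite) (auto simp: ell2_nth_single)
  then show ?thesis
    by (simp add: ell2_nth_single)
qed

context linear_system
begin

text \<open>If \<open>y = W\<^sub>o\<^sup>*v\<close>, then \<open>\<langle>x, y\<rangle> = \<langle>W\<^sub>ox, v\<rangle>\<close> on the domain of the observability operator \<open>W\<^sub>o\<close>.\<close>

lemma l2_exactly_observable_direction:
  assumes "l2_exactly_observable C A"
  shows "\<exists>c. \<forall>x. unit_observed x \<longrightarrow> \<bar>inner x y\<bar> \<le> c"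
proof -
  define W where "W = sequence_op (\<lambda>n x. C ((A ^^ n) x))"
  have W: "observability_op C A = W"
    by (simp add: W_def observability_op_def sequence_op_def)
  have lin: "linear_op W"
    unfolding W_def by (intro linear_sequence_op CA_clinear)
  have "y \<in> ran (adjoint_op W)" and dense: "densely_defined W"
    using assms by (auto simp: l2_exactly_observable_def W)
  then obtain v where "adjoint_op W v = Some y"
    by (auto simp: ran_def)
  then have adj: "\<And>x f. W x = Some f \<Longrightarrow> inner f v = inner x y"
    using adjoint_op_eq_Some_iff[OF lin dense] by blast
  have "\<bar>inner x y\<bar> \<le> norm v" if x: "unit_observed x" for x
  proof -
    have "summable (\<lambda>n. (norm (C ((A ^^ n) x)))\<^sup>2)"
      using x by (intro summableI_nonneg_bounded[where x = 1]) (auto simp: unit_observed_def)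
    then obtain f where f: "W x = Some f"
      by (simp add: W_def sequence_op_def)
    then have "ell2_nth f = (\<lambda>n. C ((A ^^ n) x))"
      by (simp add: W_def sequence_op_eq_Some_iff)
    then have "norm f \<le> 1"
      using x by (simp add: norm_ell2_le_iff unit_observed_def)
    then have "norm f * norm v \<le> 1 * norm v"
      by (intro mult_right_mono) auto
    then show ?thesis
      using Cauchy_Schwarz_ineq2[of f v] adj[OF f] by simp
  qed
  then show ?thesis
    by blast
qed

end

context dissipative_system
begin

text \<open>The \<open>\<ell>\<^sup>2\<close> controllability operator is the double adjoint of the map \<open>f \<mapsto> \<Sum> A\<^sup>kB f\<^sub>k\<close> on finite
  sequences, hence its closure: every state \<open>x\<close> is, together with some \<open>v\<close> in \<open>\<ell>\<^sup>2\<close>, a limit of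
  pairs \<open>(f, \<Sum> A\<^sup>kB f\<^sub>k)\<close>. Each of these has available storage at most \<open>\<parallel>f\<parallel>\<^sup>2\<close>, and this bound
  survives the limit since gains are continuous in the state.\<close>

lemma l2_exactly_controllable_storage_dom:
  assumes "l2_exactly_controllable A B"
  shows "storage_dom = UNIV"
proof -
  define W where "W = sequence_op (\<lambda>k x. cadjoint B ((cadjoint A ^^ k) x))"
  have W: "adj_controllability_op A B = W"
    by (simp add: W_def adj_controllability_op_def sequence_op_def)
  have lin: "linear_op W"
    unfolding W_def
    by (rule linear_sequence_op,
        rule bounded_clinear_compose[OF cadjoint(3)[OF B] bounded_clinear_funpow[OF cadjoint(3)[OF A]]])
  have dense: "densely_defined W" and ran: "ran (adjoint_op W) = UNIV"
    using assms by (auto simp: l2_exactly_controllable_def W)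
  define G where "G M f = (\<Sum>k<M. (A ^^ k) (B (ell2_nth f k)))" for M :: nat and f
  define \<N> where "\<N> = {(f, G M f) |f M. \<forall>k\<ge>M. ell2_nth f k = 0}"
  have AB: "bounded_linear (\<lambda>u. (A ^^ k) (B u))" for k
    by (rule bounded_clinearD[OF bounded_clinear_compose[OF bounded_clinear_funpow[OF A] B]])
  have G_ext: "G M f = G M' f" if "\<forall>k\<ge>M. ell2_nth f k = 0" "M \<le> M'" for M M' f
    unfolding G_def
  proof (rule sum.mono_neutral_left)
    show "\<forall>i\<in>{..<M'} - {..<M}. (A ^^ i) (B (ell2_nth f i)) = 0"
      using that linear_0[OF bounded_linear.linear[OF AB]] by auto
  qed (use that in auto)
  have sub: "subspace \<N>"
    unfolding subspace_def
  proof (intro conjI ballI allI)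
    have "(0, G 0 0) \<in> \<N>"
      unfolding \<N>_def by (auto simp: zero_ell2.rep_eq)
    then show "0 \<in> \<N>"
      by (simp add: G_def zero_prod_def)
  next
    fix p p'
    assume "p \<in> \<N>" "p' \<in> \<N>"
    then obtain f M f' M' where p: "p = (f, G M f)" "\<forall>k\<ge>M. ell2_nth f k = 0"
      "p' = (f', G M' f')" "\<forall>k\<ge>M'. ell2_nth f' k = 0"
      by (auto simp: \<N>_def)
    define L where "L = max M M'"
    have "p + p' = (f + f', G L f + G L f')"
      using G_ext[of M f L] G_ext[of M' f' L] p by (simp add: L_def)
    also have "G L f + G L f' = G L (f + f')"
      unfolding G_def by (simp add: plus_ell2.rep_eq linear_add[OF bounded_linear.linear[OF AB]] sum.distrib)
    finally show "p + p' \<in> \<N>"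
      unfolding \<N>_def using p by (auto simp: plus_ell2.rep_eq L_def intro!: exI[of _ L])
  next
    fix c :: real and p
    assume "p \<in> \<N>"
    then obtain f M where p: "p = (f, G M f)" "\<forall>k\<ge>M. ell2_nth f k = 0"
      by (auto simp: \<N>_def)
    have "c *\<^sub>R G M f = G M (c *\<^sub>R f)"
      unfolding G_def by (simp add: scaleR_ell2.rep_eq linear_cmul[OF bounded_linear.linear[OF AB]] scaleR_sum_right)
    then show "c *\<^sub>R p \<in> \<N>"
      unfolding \<N>_def using p by (auto simp: scaleR_ell2.rep_eq intro!: exI[of _ M])
  qed
  have gain_N: "gain n (snd p) u \<le> (norm (fst p))\<^sup>2" if "p \<in> \<N>" for p n u
  proof -
    from that obtain f M where p: "p = (f, G M f)"
      unfolding \<N>_def by blast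
    have "gain n (snd p) u \<le> (\<Sum>k<M. (norm (ell2_nth f (M - Suc k)))\<^sup>2)"
      using gain_from_reachable[of n "\<lambda>k. ell2_nth f (M - Suc k)" M u]
      unfolding state_eq_sum by (simp add: p G_def)
    also have "\<dots> = (\<Sum>k<M. (norm (ell2_nth f k))\<^sup>2)"
      by (rule sum.nat_diff_reindex)
    also have "\<dots> \<le> (norm f)\<^sup>2"
      by (rule norm_sum_le_of_ell2)
    finally show ?thesis
      by (simp add: p)
  qed
  have gain_closure: "gain n (snd p) u \<le> (norm (fst p))\<^sup>2" if "p \<in> closure \<N>" for p n u
  proof -
    have "continuous_on UNIV (\<lambda>p :: 'u ell2 \<times> 'x. gain n (snd p) u)"
      by (rule continuous_on_compose2[OF continuous_gain]) (auto intro!: continuous_intros)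
    then have "closed {p :: 'u ell2 \<times> 'x. gain n (snd p) u \<le> (norm (fst p))\<^sup>2}"
      by (intro closed_Collect_le continuous_intros)
    then have "closure \<N> \<subseteq> {p. gain n (snd p) u \<le> (norm (fst p))\<^sup>2}"
      using gain_N by (intro closure_minimal) auto
    then show ?thesis
      using that by blast
  qed
  have "x \<in> storage_dom" for x
  proof -
    have "x \<in> ran (adjoint_op W)"
      using ran by simp
    then obtain v where "adjoint_op W v = Some x"
      by (auto simp: ran_def)
    then have adj: "\<And>z f. W z = Some f \<Longrightarrow> inner f v = inner z x"
      using adjoint_op_eq_Some_iff[OF lin dense] by blast
    obtain p where p: "p \<in> closure \<N>" "\<And>n. n \<in> closure \<N> \<Longrightarrow> inner ((v, x) - p) n = 0"
      using projection_exists[OF subspace_closure[OF sub] closed_closure, of "(v, x)"] by blast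
    obtain a b where ab: "(v, x) - p = (a, b)"
      by fastforce
    \<comment> \<open>The pair \<open>(a, b)\<close> is orthogonal to the graph on unit sequences, so \<open>b\<close> lies in the
      domain of the adjoint controllability operator, with value \<open>- a\<close>.\<close>
    have "ell2_nth (- a) k = cadjoint B ((cadjoint A ^^ k) b)" for k
    proof -
      have "inner u (ell2_nth (- a) k) = inner u (cadjoint B ((cadjoint A ^^ k) b))" for u
      proof -
        have "(\<Sum>j<Suc k. (A ^^ j) (B (if j = k then u else 0))) = (A ^^ k) (B u)"
          using linear_0[OF bounded_linear.linear[OF AB]] by simp
        then have "G (Suc k) (ell2_single k u) = (A ^^ k) (B u)"
          unfolding G_def ell2_nth_single .
        then have "(ell2_single k u, (A ^^ k) (B u)) \<in> \<N>"
          unfolding \<N>_def by (auto simp: ell2_nth_single intro!: exI[of _ "Suc k"])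
        then have "inner (a, b) (ell2_single k u, (A ^^ k) (B u)) = 0"
          unfolding ab[symmetric] by (intro p(2) subsetD[OF closure_subset])
        then have "inner (ell2_nth a k) u + inner b ((A ^^ k) (B u)) = 0"
          by (simp add: inner_ell2_single)
        moreover have "inner ((A ^^ k) (B u)) b = inner u (cadjoint B ((cadjoint A ^^ k) b))"
          by (simp add: inner_eq_Re_cinner cadjoint_funpow[OF A] cadjoint(1)[OF B])
        ultimately show ?thesis
          by (simp add: uminus_ell2.rep_eq inner_commute)
      qed
      then show ?thesis
        by (rule inner_right_eqI)
    qed
    then have "W b = Some (- a)"
      unfolding W_def sequence_op_eq_Some_iff by blast
    from adj[OF this] have "inner (v, x) (a, b) = 0"
      by (simp add: inner_commute[of v] inner_commute[of x])
    moreover have "inner p (a, b) = 0"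
      using p(2)[OF p(1)] ab by (simp add: inner_commute)
    ultimately have "inner ((v, x) - p) (a, b) = 0"
      by (simp only: inner_diff_left)
    then have "inner (a, b) (a, b) = 0"
      unfolding ab .
    then have "(v, x) - p = 0"
      unfolding ab by (rule inner_eq_zero_iff[THEN iffD1])
    then have "(v, x) \<in> closure \<N>"
      using p(1) by simp
    from gain_closure[OF this] show ?thesis
      by (auto simp: storage_dom_def)
  qed
  then show ?thesis
    by blast
qed

text \<open>The sublevel sets are closed, symmetric and convex by lower semicontinuity and the
  parallelogram law, and they cover the space.\<close>

lemma storage_bounded:
  assumes dom: "storage_dom = UNIV"
  shows "\<exists>M\<ge>0. \<forall>x. storage x \<le> M * (norm x)\<^sup>2"
proof -
  have "\<exists>m. \<exists>r>0. cball 0 r \<subseteq> {x. storage x \<le> real m}"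
  proof (rule uniform_boundedness)
    show "closed {x. storage x \<le> real m}" for m
    proof -
      have "{x. storage x \<le> real m} = (\<Inter>(N, u). {x. gain N x u \<le> real m})"
      proof (intro set_eqI iffI)
        fix x
        assume x: "x \<in> {x. storage x \<le> real m}"
        have "gain N x u \<le> real m" for N u
          by (rule order_trans[OF storage_upper]) (use x dom in auto)
        then show "x \<in> (\<Inter>(N, u). {x. gain N x u \<le> real m})"
          by auto
      next
        fix x
        assume "x \<in> (\<Inter>(N, u). {x. gain N x u \<le> real m})"
        then show "x \<in> {x. storage x \<le> real m}"
          using storage_least[of x "real m"] by auto
      qed
      also have "closed \<dots>"
        by (auto intro!: closed_INT closed_Collect_le continuous_gain continuous_intros)
      finally show ?thesis .
    qed
    show "(\<Union>m. {x. storage x \<le> real m}) = UNIV"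
      using real_arch_simple by auto
    show "(1/2) *\<^sub>R (x - y) \<in> {x. storage x \<le> real m}"
      if "x \<in> {x. storage x \<le> real m}" "y \<in> {x. storage x \<le> real m}" for m x y
    proof -
      have "storage (x - y) \<le> 2 * storage x + 2 * storage y"
        using storage_subparallelogram[of x y] storage_nonneg[of "x + y"] dom by simp
      moreover have "storage ((1/2) *\<^sub>R (x - y)) = (1/4) * storage (x - y)"
        using storage_scale[of "x - y" "1/2"] dom by (simp add: scaleR_scaleC power2_eq_square)
      ultimately show ?thesis
        using that by simp
    qed
  qed
  then obtain m r where r: "r > 0" "cball 0 r \<subseteq> {x. storage x \<le> real m}"
    by blast
  have "storage x \<le> real m / r\<^sup>2 * (norm x)\<^sup>2" for x
  proof (cases "x = 0")
    case False
    have "(r / norm x) *\<^sub>R x \<in> {x. storage x \<le> real m}"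
      using r False by (intro subsetD[OF r(2)]) simp
    then have "(r / norm x)\<^sup>2 * storage x \<le> real m"
      using storage_scale[of x "complex_of_real (r / norm x)"] dom r(1)
      by (simp add: scaleR_scaleC norm_divide)
    then show ?thesis
      using False r by (simp add: field_simps)
  qed (simp add: storage_zero)
  then show ?thesis
    by (intro exI[of _ "real m / r\<^sup>2"]) auto
qed

end

section \<open>The transfer function as a power series\<close>

text \<open>The bound \<open>M r\<^sup>n\<close> is chosen to cover both uses: \<open>M = 1\<close> and \<open>r = \<parallel>A\<parallel>\<close> near \<open>0\<close>, and \<open>r = 1\<close> on the
  whole disk for power bounded \<open>A\<close>.\<close>

lemma neumann_series:
  fixes A :: "'x::chilbert_space \<Rightarrow> 'x"
  assumes A: "bounded_clinear A" and bound: "\<And>n x. norm ((A ^^ n) x) \<le> M * r ^ n * norm x"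
    and r: "0 \<le> M" "0 \<le> r" and z: "cmod z * r < 1"
  shows "bounded_invertible (\<lambda>x. x - z *\<^sub>C A x)"
    and "(\<lambda>n. z ^ n *\<^sub>C (A ^^ n) y) sums inv (\<lambda>x. x - z *\<^sub>C A x) y"
proof -
  define \<rho> where "\<rho> = cmod z * r"
  have \<rho>: "0 \<le> \<rho>" "\<rho> < 1"
    using r z by (auto simp: \<rho>_def)
  define f where "f y n = z ^ n *\<^sub>C (A ^^ n) y" for y n
  define S where "S y = suminf (f y)" for y
  have An: "bounded_clinear (A ^^ n)" for n
    by (rule bounded_clinear_funpow[OF A])
  note lin = bounded_linear.linear[OF bounded_clinearD(1)]
  have norm_f: "norm (f y n) \<le> M * norm y * \<rho> ^ n" for y n
  proof -
    have "norm (f y n) = cmod z ^ n * norm ((A ^^ n) y)"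
      by (simp add: f_def norm_scaleC norm_power)
    also have "\<dots> \<le> cmod z ^ n * (M * r ^ n * norm y)"
      by (intro mult_left_mono bound) simp
    finally show ?thesis
      by (simp add: \<rho>_def power_mult_distrib mult_ac)
  qed
  have geo: "summable (\<lambda>n. M * norm y * \<rho> ^ n)" for y
    using \<rho> by (intro summable_mult summable_geometric) simp
  have sm: "summable (f y)" for y
    by (rule summable_comparison_test'[OF geo]) (rule norm_f)
  have f_add: "f (x + y) n = f x n + f y n" for x y n
    by (simp add: f_def linear_add[OF lin[OF An]] scaleC_add_right)
  have f_scaleC: "f (c *\<^sub>C x) n = c *\<^sub>C f x n" for c x n
    by (simp add: f_def bounded_clinearD(2)[OF An] scaleC_scaleC mult.commute)
  have S_add: "S (x + y) = S x + S y" for x y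
  proof -
    have "f (x + y) = (\<lambda>n. f x n + f y n)"
      by (rule ext) (rule f_add)
    then show ?thesis
      unfolding S_def by (simp add: suminf_add[OF sm sm])
  qed
  have S_scaleC: "S (c *\<^sub>C x) = c *\<^sub>C S x" for c x
  proof -
    have "f (c *\<^sub>C x) = (\<lambda>n. c *\<^sub>C f x n)"
      by (rule ext) (rule f_scaleC)
    then show ?thesis
      unfolding S_def using bounded_linear.suminf[OF bounded_linear_scaleC sm[of x]] by simp
  qed
  have S_norm: "norm (S y) \<le> norm y * (M * (1 / (1 - \<rho>)))" for y
  proof -
    have "norm (S y) \<le> (\<Sum>n. M * norm y * \<rho> ^ n)"
      unfolding S_def by (intro norm_suminf_le norm_f geo)
    also have "\<dots> = M * norm y * (1 / (1 - \<rho>))"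
      using \<rho> by (simp add: suminf_mult suminf_geometric)
    finally show ?thesis
      by (simp add: mult_ac)
  qed
  have S: "bounded_clinear S"
    unfolding bounded_clinear_def
    by (intro conjI allI S_scaleC bounded_linear_intro[OF S_add _ S_norm])
      (simp add: scaleR_scaleC S_scaleC)
  define T where "T x = z *\<^sub>C A x" for x
  have T: "bounded_clinear T"
    using bounded_linear_compose[OF bounded_linear_scaleC[of z] bounded_clinearD(1)[OF A]]
    by (simp add: bounded_clinear_def T_def[abs_def] bounded_clinearD(2)[OF A] scaleC_scaleC mult.commute)
  have shift: "(\<Sum>n. f y (Suc n)) = S y - y" for y
    using suminf_split_head[OF sm[of y]] by (simp add: S_def f_def scaleC_one)
  have Tf: "T (f y n) = f y (Suc n)" "f (T y) n = f y (Suc n)" for y n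
    by (simp_all add: T_def f_def bounded_clinearD(2)[OF A] bounded_clinearD(2)[OF An] scaleC_scaleC
        mult.commute funpow_swap1)
  have TS: "T (S y) = S y - y" for y
  proof -
    have "T (S y) = (\<Sum>n. f y (Suc n))"
      unfolding S_def bounded_linear.suminf[OF bounded_clinearD(1)[OF T] sm] Tf ..
    then show ?thesis
      using shift by (rule trans)
  qed
  have ST: "S (T y) = S y - y" for y
  proof -
    have "f (T y) = (\<lambda>n. f y (Suc n))"
      by (rule ext) (rule Tf)
    then have "S (T y) = (\<Sum>n. f y (Suc n))"
      by (simp only: S_def)
    then show ?thesis
      using shift by (rule trans)
  qed
  have S_diff: "S (x - y) = S x - S y" for x y
    by (rule linear_diff[OF lin[OF S]])
  have comp: "S \<circ> (\<lambda>x. x - T x) = id" "(\<lambda>x. x - T x) \<circ> S = id"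
    by (auto simp: S_diff ST TS)
  have "bounded_clinear (\<lambda>x. x - T x)"
    using bounded_linear_sub[OF bounded_linear_ident bounded_clinearD(1)[OF T]]
    by (simp add: bounded_clinear_def bounded_clinearD(2)[OF T] complex_vector.scale_right_diff_distrib)
  then show "bounded_invertible (\<lambda>x. x - z *\<^sub>C A x)"
    using S comp unfolding bounded_invertible_def T_def by blast
  have "inv (\<lambda>x. x - T x) = S"
    using comp by (intro inv_unique_comp)
  then show "(\<lambda>n. z ^ n *\<^sub>C (A ^^ n) y) sums inv (\<lambda>x. x - z *\<^sub>C A x) y"
    using summable_sums[OF sm[of y]] by (simp add: T_def f_def[abs_def] S_def)
qed

context linear_system
begin

text \<open>The Taylor coefficients of the transfer function at \<open>0\<close>, which are also the impulse response.\<close>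

definition markov :: "nat \<Rightarrow> 'u \<Rightarrow> 'y" where
  "markov n = (case n of 0 \<Rightarrow> D | Suc k \<Rightarrow> (\<lambda>u. C ((A ^^ k) (B u))))"

lemma markov_clinear: "bounded_clinear (markov n)"
proof (cases n)
  case (Suc k)
  then show ?thesis
    using bounded_clinear_compose[OF CA_clinear[of k] B] by (simp add: markov_def)
qed (simp add: markov_def D)

lemma response_eq_markov_sum: "response 0 u n = (\<Sum>k\<le>n. markov (n - k) (u k))"
proof -
  have st: "state 0 u n = (\<Sum>k<n. (A ^^ (n - Suc k)) (B (u k)))" for n
  proof (induction n)
    case (Suc n)
    have "A ((A ^^ (n - Suc k)) x) = (A ^^ (Suc n - Suc k)) x" if "k < n" for k x
      using that by (metis Suc_diff_Suc diff_Suc_Suc funpow.simps(2) comp_apply)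
    then show ?case
      by (simp add: Suc A.sum)
  qed simp
  have "C ((A ^^ (n - Suc k)) (B w)) = markov (n - k) w" if "k < n" for k w
  proof -
    have "n - k = Suc (n - Suc k)"
      using that by simp
    then show ?thesis
      by (simp add: markov_def)
  qed
  then have "response 0 u n = (\<Sum>k<n. markov (n - k) (u k)) + markov 0 (u n)"
    by (simp add: response_def st C.sum markov_def)
  then show ?thesis
    by (simp flip: lessThan_Suc_atMost)
qed

lemma transfer_fun_sums:
  assumes "\<And>n x. norm ((A ^^ n) x) \<le> M * r ^ n * norm x" "0 \<le> M" "0 \<le> r" "cmod z * r < 1"
  shows "(\<lambda>n. z ^ n *\<^sub>C markov n u) sums transfer_fun A B C D z u"
proof -
  have zC: "bounded_linear (\<lambda>x. z *\<^sub>C C x)"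
    by (rule bounded_linear_compose[OF bounded_linear_scaleC C.bounded_linear_axioms])
  have "(\<lambda>n. z *\<^sub>C C (z ^ n *\<^sub>C (A ^^ n) (B u))) sums (z *\<^sub>C C (inv (\<lambda>x. x - z *\<^sub>C A x) (B u)))"
    by (rule bounded_linear.sums[OF zC neumann_series(2)[OF A assms]])
  then have "(\<lambda>n. z ^ Suc n *\<^sub>C markov (Suc n) u) sums (z *\<^sub>C C (inv (\<lambda>x. x - z *\<^sub>C A x) (B u)))"
    by (simp add: bounded_clinearD(2)[OF C] scaleC_scaleC markov_def)
  from sums_Suc[OF this] show ?thesis
    by (simp add: transfer_fun_def markov_def scaleC_one add.commute)
qed

lemma transfer_fun_sums_near_0:
  "\<forall>\<^sub>F z in nhds 0. \<forall>u. (\<lambda>n. z ^ n *\<^sub>C markov n u) sums transfer_fun A B C D z u"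
proof -
  define K where "K = onorm A"
  have K: "0 \<le> K" "\<And>x. norm (A x) \<le> K * norm x"
    unfolding K_def using onorm_pos_le onorm A.bounded_linear_axioms by auto
  have bound: "norm ((A ^^ n) x) \<le> 1 * K ^ n * norm x" for n x
  proof (induction n)
    case (Suc n)
    have "norm ((A ^^ Suc n) x) \<le> K * norm ((A ^^ n) x)"
      using K(2) by simp
    also have "\<dots> \<le> K * (1 * K ^ n * norm x)"
      by (intro mult_left_mono Suc K)
    finally show ?case
      by (simp add: mult_ac)
  qed simp
  have "((\<lambda>z. cmod z * K) \<longlongrightarrow> cmod 0 * K) (nhds 0)"
    by (intro tendsto_intros) (rule filterlim_ident)
  then have "\<forall>\<^sub>F z in nhds 0. cmod z * K < 1"
    by (rule order_tendstoD) simp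
  then show ?thesis
    by eventually_elim (use transfer_fun_sums[OF bound] K in auto)
qed

end

text \<open>The difference quotient minus the formal derivative is again a series in the \<open>F n\<close>, with scalar
  coefficients of size \<open>n(n - 1) \<rho>\<^sup>n\<^sup>-\<^sup>2 |w - z|\<close>; so the operator norm is controlled by a numerical
  series.\<close>

lemma op_holomorphic_power_series:
  fixes F :: "nat \<Rightarrow> 'u::complex_inner \<Rightarrow> 'y::chilbert_space"
  assumes F: "\<And>n. bounded_clinear (F n)" and bound: "\<And>n u. norm (F n u) \<le> M * norm u"
    and G: "\<And>z u. z \<in> ball 0 1 \<Longrightarrow> (\<lambda>n. z ^ n *\<^sub>C F n u) sums G z u"
    and M: "0 \<le> M"
  shows "op_holomorphic_on G (ball 0 1)"
proof -
  \<comment> \<open>Applied to the powers of \<open>z\<close>, to their derivatives and to the errors of the difference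
    quotients.\<close>
  have series: "bounded_clinear (\<lambda>u. \<Sum>n. a n *\<^sub>C F n u) \<and> (\<forall>u. summable (\<lambda>n. a n *\<^sub>C F n u)) \<and>
      (\<forall>u. norm (\<Sum>n. a n *\<^sub>C F n u) \<le> (\<Sum>n. b n) * M * norm u)"
    if b: "summable b" "\<And>n. cmod (a n) \<le> b n" for a :: "nat \<Rightarrow> complex" and b :: "nat \<Rightarrow> real"
  proof -
    note lin = bounded_linear.linear[OF bounded_clinearD(1)[OF F]]
    have norm: "norm (a n *\<^sub>C F n u) \<le> b n * (M * norm u)" for n u
      unfolding norm_scaleC using b(2)[of n] order_trans[OF norm_ge_zero b(2)[of n]]
      by (intro mult_mono bound) auto
    have bs: "summable (\<lambda>n. b n * (M * norm u))" for u
      by (intro summable_mult2 b)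
    have sm: "summable (\<lambda>n. a n *\<^sub>C F n u)" for u
      by (rule summable_comparison_test'[OF bs]) (rule norm)
    have le: "norm (\<Sum>n. a n *\<^sub>C F n u) \<le> (\<Sum>n. b n) * M * norm u" for u
    proof -
      have "norm (\<Sum>n. a n *\<^sub>C F n u) \<le> (\<Sum>n. b n * (M * norm u))"
        by (intro norm_suminf_le norm bs)
      also have "\<dots> = (\<Sum>n. b n) * (M * norm u)"
        by (rule suminf_mult2[OF b(1), symmetric])
      finally show ?thesis
        by (simp add: mult_ac)
    qed
    have scaleC: "(\<Sum>n. a n *\<^sub>C F n (c *\<^sub>C u)) = c *\<^sub>C (\<Sum>n. a n *\<^sub>C F n u)" for c u
      unfolding bounded_linear.suminf[OF bounded_linear_scaleC sm]
      by (simp add: bounded_clinearD(2)[OF F] scaleC_scaleC mult.commute)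
    have "bounded_linear (\<lambda>u. \<Sum>n. a n *\<^sub>C F n u)"
    proof (rule bounded_linear_intro[where K = "(\<Sum>n. b n) * M"])
      show "(\<Sum>n. a n *\<^sub>C F n (u + v)) = (\<Sum>n. a n *\<^sub>C F n u) + (\<Sum>n. a n *\<^sub>C F n v)" for u v
        by (simp add: suminf_add[OF sm sm] linear_add[OF lin] scaleC_add_right)
      show "(\<Sum>n. a n *\<^sub>C F n (r *\<^sub>R u)) = r *\<^sub>R (\<Sum>n. a n *\<^sub>C F n u)" for r u
        unfolding scaleR_scaleC by (rule scaleC)
    qed (use le in \<open>simp add: mult_ac\<close>)
    then show ?thesis
      using scaleC sm le by (simp add: bounded_clinear_def)
  qed
  have sum1: "summable (\<lambda>n. \<rho> ^ n)" if "0 \<le> \<rho>" "\<rho> < 1" for \<rho> :: real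
    using that by (intro summable_geometric) simp
  have sum2: "summable (\<lambda>n. real n * real (n - Suc 0) * \<rho> ^ (n - 2))" if \<rho>: "0 \<le> \<rho>" "\<rho> < 1" for \<rho> :: real
  proof -
    have 1: "summable (\<lambda>n. diffs (\<lambda>_. 1) n * x ^ n)" if "norm x < 1" for x :: real
      by (rule termdiff_converges[where K = 1]) (use that in auto)
    have "summable (\<lambda>n. diffs (diffs (\<lambda>_. 1)) n * \<rho> ^ n)"
      by (rule termdiff_converges[where K = 1]) (use 1 \<rho> in auto)
    then have "summable (\<lambda>n. real (n + 2) * real (n + 2 - Suc 0) * \<rho> ^ (n + 2 - 2))"
      by (simp add: diffs_def mult_ac)
    then show ?thesis
      by (subst (asm) summable_iff_shift)
  qed
  have sum3: "summable (\<lambda>n. real n * \<rho> ^ (n - Suc 0))" if \<rho>: "0 \<le> \<rho>" "\<rho> < 1" for \<rho> :: real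
  proof -
    have "summable (\<lambda>n. diffs (\<lambda>_. 1) n * \<rho> ^ n)"
      by (rule termdiff_converges[where K = 1]) (use \<rho> in auto)
    then have "summable (\<lambda>n. real (n + 1) * \<rho> ^ (n + 1 - Suc 0))"
      by (simp add: diffs_def)
    then show ?thesis
      by (subst (asm) summable_iff_shift)
  qed
  have G_eq: "G z u = (\<Sum>n. z ^ n *\<^sub>C F n u)" if "z \<in> ball 0 1" for z u
    using G[OF that] by (rule sums_unique)
  have G_lin: "bounded_clinear (G z)" if z: "z \<in> ball 0 1" for z
    using series[OF sum1[of "cmod z"], of "\<lambda>n. z ^ n"] z G_eq[OF z, abs_def]
    by (simp add: norm_power)
  show ?thesis
    unfolding op_holomorphic_on_def
  proof (intro conjI ballI G_lin)
    fix z :: complex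
    assume z: "z \<in> ball 0 1"
    \<comment> \<open>A radius strictly between \<open>|z|\<close> and \<open>1\<close> that bounds all \<open>w\<close> near \<open>z\<close>.\<close>
    define \<rho> where "\<rho> = (1 + cmod z) / 2"
    have \<rho>: "0 \<le> \<rho>" "\<rho> < 1" "cmod z < \<rho>"
      using z by (auto simp: \<rho>_def)
    define a where "a n = of_nat n * z ^ (n - Suc 0)" for n
    define F' where "F' u = (\<Sum>n. a n *\<^sub>C F n u)" for u
    define c where "c = (\<Sum>n. real n * real (n - Suc 0) * \<rho> ^ (n - 2)) * M"
    have a_le: "cmod (a n) \<le> real n * cmod z ^ (n - Suc 0)" for n
      by (simp add: a_def norm_mult norm_power)
    have sa: "summable (\<lambda>n. real n * cmod z ^ (n - Suc 0))"
      using z by (intro sum3) auto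
    note F'_series = series[OF sa a_le]
    have F': "bounded_clinear F'"
      using F'_series unfolding F'_def[abs_def] by blast
    have near: "onorm (\<lambda>u. inverse (w - z) *\<^sub>C (G w u - G z u) - F' u) \<in> {0..c * cmod (w - z)}"
      if w: "w \<in> ball z (\<rho> - cmod z)" "w \<noteq> z" for w
    proof -
      define h where "h = w - z"
      have h: "h \<noteq> 0" "cmod (z + h) \<le> \<rho>" "z + h = w"
        using w norm_triangle_ineq[of z "w - z"] by (auto simp: h_def dist_norm norm_minus_commute)
      have w1: "w \<in> ball 0 1"
        using h \<rho> by simp
      define d where "d n = ((z + h) ^ n - z ^ n) / h - of_nat n * z ^ (n - Suc 0)" for n
      have d_le: "cmod (d n) \<le> real n * real (n - Suc 0) * \<rho> ^ (n - 2) * cmod h" for n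
        unfolding d_def using lemma_termdiff3[OF h(1) less_imp_le[OF \<rho>(3)] h(2), of n] by simp
      have sd: "summable (\<lambda>n. real n * real (n - Suc 0) * \<rho> ^ (n - 2) * cmod h)"
        by (intro summable_mult2 sum2 \<rho>)
      note d_series = series[OF sd d_le]
      have eq: "inverse (w - z) *\<^sub>C (G w u - G z u) - F' u = (\<Sum>n. d n *\<^sub>C F n u)" for u
      proof -
        have "(\<lambda>n. inverse h *\<^sub>C (w ^ n *\<^sub>C F n u - z ^ n *\<^sub>C F n u) - a n *\<^sub>C F n u)
            sums (inverse h *\<^sub>C (G w u - G z u) - F' u)"
          unfolding F'_def using F'_series
          by (intro sums_diff bounded_linear.sums[OF bounded_linear_scaleC] G w1 z summable_sums) auto
        moreover have "inverse h *\<^sub>C (w ^ n *\<^sub>C F n u - z ^ n *\<^sub>C F n u) - a n *\<^sub>C F n u = d n *\<^sub>C F n u" for n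
          by (simp add: d_def a_def h(3) scaleC_scaleC divide_inverse mult.commute
              flip: complex_vector.scale_left_diff_distrib)
        ultimately show ?thesis
          using sums_unique by (simp add: h_def) blast
      qed
      have "onorm (\<lambda>u. \<Sum>n. d n *\<^sub>C F n u) \<le> c * cmod h"
      proof (rule onorm_bound)
        have "(\<Sum>n. real n * real (n - Suc 0) * \<rho> ^ (n - 2) * cmod h) * M = c * cmod h"
          unfolding c_def suminf_mult2[OF sum2[OF \<rho>(1,2)], symmetric] by (simp only: mult_ac)
        then show "norm (\<Sum>n. d n *\<^sub>C F n u) \<le> c * cmod h * norm u" for u
          using d_series by simp
        show "0 \<le> c * cmod h"
          unfolding c_def using M \<rho> by (intro mult_nonneg_nonneg suminf_nonneg sum2) auto
      qed
      moreover have "0 \<le> onorm (\<lambda>u. \<Sum>n. d n *\<^sub>C F n u)"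
        using d_series by (intro onorm_pos_le bounded_clinearD(1)) blast
      ultimately show ?thesis
        unfolding eq by (simp add: h_def)
    qed
    have "((\<lambda>w. onorm (\<lambda>u. inverse (w - z) *\<^sub>C (G w u - G z u) - F' u)) \<longlongrightarrow> 0) (at z)"
    proof (rule tendsto_sandwich)
      have ev: "\<forall>\<^sub>F w in at z. w \<in> ball z (\<rho> - cmod z) \<and> w \<noteq> z"
        using \<rho> by (intro eventually_conj eventually_at_in_open' ) (auto simp: eventually_at_filter)
      show "\<forall>\<^sub>F w in at z. 0 \<le> onorm (\<lambda>u. inverse (w - z) *\<^sub>C (G w u - G z u) - F' u)"
        using ev by eventually_elim (use near in auto)
      show "\<forall>\<^sub>F w in at z. onorm (\<lambda>u. inverse (w - z) *\<^sub>C (G w u - G z u) - F' u) \<le> c * cmod (w - z)"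
        using ev by eventually_elim (use near in auto)
      have "((\<lambda>w. c * cmod (w - z)) \<longlongrightarrow> c * cmod (z - z)) (at z)"
        by (intro tendsto_intros)
      then show "((\<lambda>w. c * cmod (w - z)) \<longlongrightarrow> 0) (at z)"
        by simp
    qed simp
    with F' show "\<exists>F'. bounded_clinear F' \<and>
        ((\<lambda>w. onorm (\<lambda>u. inverse (w - z) *\<^sub>C (G w u - G z u) - F' u)) \<longlongrightarrow> 0) (at z)"
      by blast
  qed
qed

section \<open>Dissipative systems have a Schur class transfer function\<close>

context linear_system
begin

lemma markov_bound:
  assumes dissipative
  shows "norm (markov n u) \<le> norm u"
proof -
  define v where "v k = (if k = 0 then u else 0)" for k :: nat
  have resp: "response 0 v k = markov k u" for k
  proof -
    have "response 0 v k = (\<Sum>j\<le>k. if j = 0 then markov k u else 0)"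
      unfolding response_eq_markov_sum v_def
      by (intro sum.cong) (auto simp: linear_0 bounded_linear.linear bounded_clinearD(1)[OF markov_clinear])
    then show ?thesis
      by simp
  qed
  have "(\<Sum>k<Suc n. (norm (v k))\<^sup>2) = (norm u)\<^sup>2"
    by (simp add: v_def sum.lessThan_Suc_shift del: sum.lessThan_Suc)
  moreover have "(\<Sum>k<Suc n. (norm (markov k u))\<^sup>2) - (\<Sum>k<Suc n. (norm (v k))\<^sup>2) \<le> 0"
    using assms[unfolded dissipative_def, rule_format, of "Suc n" v]
    by (simp only: gain_def resp sum_subtractf)
  moreover have "(norm (markov n u))\<^sup>2 \<le> (\<Sum>k<Suc n. (norm (markov k u))\<^sup>2)"
    by (simp add: sum_nonneg)
  ultimately have "(norm (markov n u))\<^sup>2 \<le> (norm u)\<^sup>2"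
    by linarith
  then show ?thesis
    by (rule power2_le_imp_le) simp
qed

text \<open>Feed in \<open>u\<^sub>n = z\<^sup>-\<^sup>n u\<close>. The response is \<open>z\<^sup>-\<^sup>n S\<^sub>n\<close> with the partial sums \<open>S\<^sub>n\<close> of the series for \<open>y\<close>,
  so dissipativity bounds the sums of \<open>|z|\<^sup>-\<^sup>2\<^sup>n(\<parallel>S\<^sub>n\<parallel>\<^sup>2 - \<parallel>u\<parallel>\<^sup>2)\<close>. As the weights do not decrease, the
  limit of the second factor cannot be positive.\<close>

lemma dissipative_transfer_contractive:
  assumes diss: dissipative and z: "cmod z < 1" and y: "(\<lambda>n. z ^ n *\<^sub>C markov n u) sums y"
  shows "norm y \<le> norm u"
proof (cases "z = 0")
  case True
  have "(\<lambda>n. z ^ n *\<^sub>C markov n u) = (\<lambda>n. if n = 0 then markov 0 u else 0)"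
    by (auto simp: True scaleC_one)
  then have "y = markov 0 u"
    using y sums_single[of 0 "\<lambda>_. markov 0 u"] sums_unique2 by (metis (no_types, lifting))
  then show ?thesis
    using markov_bound[OF diss] by simp
next
  case False
  define w where "w = inverse z"
  have w: "1 \<le> cmod w"
    using z False by (simp add: w_def norm_inverse one_le_inverse)
  have wz: "w ^ k * z ^ k = 1" for k
    using False by (simp add: w_def flip: power_mult_distrib)
  define S where "S n = (\<Sum>k\<le>n. z ^ k *\<^sub>C markov k u)" for n
  have resp: "response 0 (\<lambda>n. w ^ n *\<^sub>C u) n = w ^ n *\<^sub>C S n" for n
  proof -
    have "response 0 (\<lambda>n. w ^ n *\<^sub>C u) n = (\<Sum>k\<le>n. w ^ (n - k) *\<^sub>C markov k u)"
      unfolding response_eq_markov_sum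
      by (rule sum.reindex_bij_witness[where i = "\<lambda>k. n - k" and j = "\<lambda>k. n - k"])
        (auto simp: bounded_clinearD(2)[OF markov_clinear])
    also have "\<dots> = (\<Sum>k\<le>n. w ^ n *\<^sub>C z ^ k *\<^sub>C markov k u)"
    proof (rule sum.cong[OF refl])
      fix k
      assume "k \<in> {..n}"
      then have "w ^ n * z ^ k = w ^ (n - k) * (w ^ k * z ^ k)"
        by (simp flip: power_add mult.assoc)
      then show "w ^ (n - k) *\<^sub>C markov k u = w ^ n *\<^sub>C z ^ k *\<^sub>C markov k u"
        by (simp add: scaleC_scaleC wz)
    qed
    finally show ?thesis
      by (simp add: S_def complex_vector.scale_sum_right)
  qed
  define t where "t n = (cmod w ^ n)\<^sup>2 * ((norm (S n))\<^sup>2 - (norm u)\<^sup>2)" for n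
  have le0: "(\<Sum>n<N. t n) \<le> 0" for N
    using diss[unfolded dissipative_def, rule_format, of N "\<lambda>n. w ^ n *\<^sub>C u"]
    by (simp add: gain_def resp norm_scaleC norm_power power_mult_distrib t_def algebra_simps)
  have S: "S \<longlonglongrightarrow> y"
    using y unfolding sums_def_le S_def[abs_def] .
  show ?thesis
  proof (rule ccontr)
    assume "\<not> norm y \<le> norm u"
    \<comment> \<open>The sums in \<open>le0\<close> would grow at least like \<open>e\<close> times their length.\<close>
    define e where "e = ((norm y)\<^sup>2 - (norm u)\<^sup>2) / 2"
    have "(norm u)\<^sup>2 < (norm y)\<^sup>2"
      using \<open>\<not> norm y \<le> norm u\<close> by (intro power_strict_mono) auto
    then have e: "0 < e" "e < (norm y)\<^sup>2 - (norm u)\<^sup>2"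
      by (auto simp: e_def)
    have "(\<lambda>n. (norm (S n))\<^sup>2 - (norm u)\<^sup>2) \<longlonglongrightarrow> (norm y)\<^sup>2 - (norm u)\<^sup>2"
      by (intro tendsto_intros S)
    then have "\<forall>\<^sub>F n in sequentially. e < (norm (S n))\<^sup>2 - (norm u)\<^sup>2"
      using e by (intro order_tendstoD)
    then obtain n0 where n0: "\<And>n. n \<ge> n0 \<Longrightarrow> e < (norm (S n))\<^sup>2 - (norm u)\<^sup>2"
      by (auto simp: eventually_sequentially)
    have t: "e \<le> t n" if "n \<ge> n0" for n
    proof -
      have "1 \<le> (cmod w ^ n)\<^sup>2"
        using w by (simp add: one_le_power)
      then have "1 * e \<le> t n"
        unfolding t_def using n0[OF that] e by (intro mult_mono) auto
      then show ?thesis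
        by simp
    qed
    have grow: "(\<Sum>n<n0. t n) + real m * e \<le> (\<Sum>n<n0 + m. t n)" for m
    proof (induction m)
      case (Suc m)
      then show ?case
        using t[of "n0 + m"] by (simp add: algebra_simps)
    qed simp
    obtain m where "- (\<Sum>n<n0. t n) < real m * e"
      using e(1) reals_Archimedean3 by blast
    then show False
      using grow[of m] le0[of "n0 + m"] by linarith
  qed
qed

theorem schur_if_dissipative:
  assumes diss: dissipative
  shows "has_schur_continuation A B C D"
proof -
  define G where "G z u = (\<Sum>n. z ^ n *\<^sub>C markov n u)" for z u
  have G: "(\<lambda>n. z ^ n *\<^sub>C markov n u) sums G z u" if z: "z \<in> ball 0 1" for z u
  proof -
    have "summable (\<lambda>n. z ^ n *\<^sub>C markov n u)"
    proof (rule summable_comparison_test')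
      show "summable (\<lambda>n. cmod z ^ n * norm u)"
        using z by (intro summable_mult2 summable_geometric) auto
      show "norm (z ^ n *\<^sub>C markov n u) \<le> cmod z ^ n * norm u" for n
        unfolding norm_scaleC norm_power using markov_bound[OF diss] by (intro mult_left_mono) auto
    qed
    then show ?thesis
      by (simp add: G_def summable_sums)
  qed
  have "op_holomorphic_on G (ball 0 1)"
    by (rule op_holomorphic_power_series[OF markov_clinear _ G, where M = 1])
      (simp_all add: markov_bound[OF diss])
  moreover have "onorm (G z) \<le> 1" if "z \<in> ball 0 1" for z
    using dissipative_transfer_contractive[OF diss _ G[OF that]] that by (intro onorm_bound) auto
  moreover have "\<forall>\<^sub>F z in nhds 0. G z = transfer_fun A B C D z"
  proof -
    have "\<forall>\<^sub>F z in nhds (0::complex). z \<in> ball 0 1"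
      by (intro eventually_nhds_in_open) auto
    with transfer_fun_sums_near_0 show ?thesis
    proof eventually_elim
      case (elim z)
      then show ?case
        using G sums_unique2 by blast
    qed
  qed
  ultimately show ?thesis
    unfolding has_schur_continuation_def schur_class_def by blast
qed

end

section \<open>Systems with a Schur class transfer function are dissipative\<close>

text \<open>Cauchy's integral formula for the Taylor coefficients, on the circle where
  \<open>cnj z = r\<^sup>2 / z\<close>.\<close>

lemma circle_mean:
  fixes h :: "complex \<Rightarrow> complex"
  assumes h: "h holomorphic_on ball 0 1" "h has_fps_expansion a" and r: "0 < r" "r < 1"
  shows "((\<lambda>t. h (circlepath 0 r t) * cnj (circlepath 0 r t) ^ n) has_integral
    complex_of_real (r ^ (2 * n)) * fps_nth a n) {0..1}"
proof -
  define \<gamma> where "\<gamma> = circlepath 0 r"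
  have \<gamma>: "\<gamma> t = complex_of_real r * exp (2 * complex_of_real pi * \<i> * complex_of_real t)" for t
    by (simp add: \<gamma>_def circlepath)
  have cmod: "cmod (\<gamma> t) = r" for t
    using r by (simp add: \<gamma> norm_mult)
  have ne: "\<gamma> t \<noteq> 0" for t
    using cmod[of t] r by auto
  have cnj: "cnj (\<gamma> t) = complex_of_real (r\<^sup>2) / \<gamma> t" for t
    using complex_norm_square[of "\<gamma> t"] ne[of t] by (simp add: cmod field_simps)
  have "((\<lambda>u. h u / (u - 0) ^ Suc n) has_contour_integral
      (2 * pi * \<i>) / fact n * (deriv ^^ n) h 0) (circlepath 0 r)"
  proof (rule Cauchy_has_contour_integral_higher_derivative_circlepath)
    show "continuous_on (cball 0 r) h"
      using r by (intro holomorphic_on_imp_continuous_on holomorphic_on_subset[OF h(1)]) auto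
    show "h holomorphic_on ball 0 r"
      using r by (intro holomorphic_on_subset[OF h(1)]) auto
  qed (use r in auto)
  then have "((\<lambda>t. h (\<gamma> t) / \<gamma> t ^ Suc n * vector_derivative \<gamma> (at t within {0..1})) has_integral
      (2 * pi * \<i>) * fps_nth a n) {0..1}"
    unfolding has_contour_integral_def fps_nth_fps_expansion[OF h(2)] by (simp add: \<gamma>_def)
  then have "((\<lambda>t. complex_of_real (r ^ (2 * n)) / (2 * pi * \<i>) *
      (h (\<gamma> t) / \<gamma> t ^ Suc n * vector_derivative \<gamma> (at t within {0..1}))) has_integral
      complex_of_real (r ^ (2 * n)) / (2 * pi * \<i>) * ((2 * pi * \<i>) * fps_nth a n)) {0..1}"
    by (rule has_integral_mult_right)
  moreover have "complex_of_real (r ^ (2 * n)) / (2 * pi * \<i>) *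
      (h (\<gamma> t) / \<gamma> t ^ Suc n * vector_derivative \<gamma> (at t within {0..1})) = h (\<gamma> t) * cnj (\<gamma> t) ^ n"
    if "t \<in> {0..1}" for t
  proof -
    have "vector_derivative \<gamma> (at t within {0..1}) = 2 * pi * \<i> * \<gamma> t"
      using that vector_derivative_circlepath01[of t 0 r] by (simp add: \<gamma>_def \<gamma>[unfolded \<gamma>_def])
    moreover have "complex_of_real (r ^ (2 * n)) = complex_of_real (r\<^sup>2) ^ n"
      by (simp only: power_mult of_real_power)
    ultimately show ?thesis
      using ne[of t] by (simp add: cnj power_divide field_simps del: of_real_power)
  qed
  ultimately have "((\<lambda>t. h (\<gamma> t) * cnj (\<gamma> t) ^ n) has_integral
      complex_of_real (r ^ (2 * n)) / (2 * pi * \<i>) * ((2 * pi * \<i>) * fps_nth a n)) {0..1}"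
    by (rule has_integral_eq[rotated])
  also have "complex_of_real (r ^ (2 * n)) / (2 * pi * \<i>) * ((2 * pi * \<i>) * fps_nth a n)
      = complex_of_real (r ^ (2 * n)) * fps_nth a n"
    by (simp only: times_divide_eq_left times_divide_eq_right) (simp add: field_simps)
  finally show ?thesis
    unfolding \<gamma>_def .
qed

text \<open>Orthogonality of the monomials on the circle: the mean of \<open>\<langle>T(z)U(z), V(z)\<rangle>\<close> for polynomials \<open>U\<close>
  and \<open>V\<close> pairs the coefficients of \<open>V\<close> with those of the product series \<open>T(z)U(z)\<close>.\<close>

lemma circle_mean_form:
  fixes T :: "complex \<Rightarrow> 'a::complex_inner \<Rightarrow> 'b::complex_inner" and c :: "nat \<Rightarrow> 'a \<Rightarrow> 'b"
  assumes lin: "\<And>z. z \<in> ball 0 1 \<Longrightarrow> bounded_clinear (T z)"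
    and holo: "\<And>x y. (\<lambda>z. cinner (T z x) y) holomorphic_on ball 0 1"
    and exp: "\<And>x y. (\<lambda>z. cinner (T z x) y) has_fps_expansion Abs_fps (\<lambda>n. cinner (c n x) y)"
    and r: "0 < r" "r < 1"
  defines "\<gamma> \<equiv> circlepath 0 r"
  shows "((\<lambda>t. cinner (T (\<gamma> t) (\<Sum>k<N. \<gamma> t ^ k *\<^sub>C u k)) (\<Sum>n<N. \<gamma> t ^ n *\<^sub>C v n)) has_integral
    (\<Sum>n<N. complex_of_real (r ^ (2 * n)) * cinner (\<Sum>k\<le>n. c (n - k) (u k)) (v n))) {0..1}"
proof -
  have zero: "cinner 0 y = 0" for y :: 'b
    using cinner_scaleC_left[of 0 0 y] by simp
  have zero': "cinner y 0 = 0" for y :: 'b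
    using cinner_scaleC_right[of y 0 0] by simp
  have sum_left: "cinner (\<Sum>k\<in>I. f k) y = (\<Sum>k\<in>I. cinner (f k) y)" for I :: "nat set" and f and y :: 'b
    by (induction I rule: infinite_finite_induct) (simp_all add: zero cinner_add_left)
  have sum_right: "cinner y (\<Sum>k\<in>I. f k) = (\<Sum>k\<in>I. cinner y (f k))" for I :: "nat set" and f and y :: 'b
    by (induction I rule: infinite_finite_induct) (simp_all add: zero' cinner_add_right)
  have tm: "((\<lambda>t. cinner (T (\<gamma> t) (u k)) (v n) * \<gamma> t ^ k * cnj (\<gamma> t) ^ n) has_integral
      complex_of_real (r ^ (2 * n)) * (if k \<le> n then cinner (c (n - k) (u k)) (v n) else 0)) {0..1}" for k n
  proof -
    define h where "h z = cinner (T z (u k)) (v n) * z ^ k" for z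
    have "h holomorphic_on ball 0 1"
      unfolding h_def by (intro holomorphic_intros holo)
    moreover have "h has_fps_expansion Abs_fps (\<lambda>j. cinner (c j (u k)) (v n)) * fps_X ^ k"
      unfolding h_def by (intro has_fps_expansion_mult exp has_fps_expansion_fps_X_power)
    ultimately have "((\<lambda>t. h (\<gamma> t) * cnj (\<gamma> t) ^ n) has_integral
      complex_of_real (r ^ (2 * n)) * fps_nth (Abs_fps (\<lambda>j. cinner (c j (u k)) (v n)) * fps_X ^ k) n) {0..1}"
      unfolding \<gamma>_def by (rule circle_mean[OF _ _ r])
    moreover have "fps_nth (Abs_fps (\<lambda>j. cinner (c j (u k)) (v n)) * fps_X ^ k) n
        = (if k \<le> n then cinner (c (n - k) (u k)) (v n) else 0)"
      by (simp add: fps_X_power_mult_right_nth)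
    ultimately show ?thesis
      by (simp add: h_def)
  qed
  have "((\<lambda>t. \<Sum>n<N. \<Sum>k<N. cinner (T (\<gamma> t) (u k)) (v n) * \<gamma> t ^ k * cnj (\<gamma> t) ^ n) has_integral
      (\<Sum>n<N. \<Sum>k<N. complex_of_real (r ^ (2 * n)) * (if k \<le> n then cinner (c (n - k) (u k)) (v n) else 0))) {0..1}"
    by (intro has_integral_sum tm) auto
  moreover have "(\<Sum>k<N. complex_of_real (r ^ (2 * n)) * (if k \<le> n then cinner (c (n - k) (u k)) (v n) else 0))
      = complex_of_real (r ^ (2 * n)) * cinner (\<Sum>k\<le>n. c (n - k) (u k)) (v n)" if "n < N" for n
  proof -
    have "(\<Sum>k<N. if k \<le> n then cinner (c (n - k) (u k)) (v n) else 0)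
        = (\<Sum>k\<le>n. cinner (c (n - k) (u k)) (v n))"
      using that by (intro sum.mono_neutral_cong_right) auto
    then show ?thesis
      by (simp add: sum_left flip: sum_distrib_left)
  qed
  moreover have "cinner (T (\<gamma> t) (\<Sum>k<N. \<gamma> t ^ k *\<^sub>C u k)) (\<Sum>n<N. \<gamma> t ^ n *\<^sub>C v n)
      = (\<Sum>n<N. \<Sum>k<N. cinner (T (\<gamma> t) (u k)) (v n) * \<gamma> t ^ k * cnj (\<gamma> t) ^ n)" for t
  proof -
    have "\<gamma> t \<in> ball 0 1"
      using r by (simp add: \<gamma>_def circlepath norm_mult)
    then have "bounded_clinear (T (\<gamma> t))"
      by (rule lin)
    then have "T (\<gamma> t) (\<Sum>k<N. \<gamma> t ^ k *\<^sub>C u k) = (\<Sum>k<N. \<gamma> t ^ k *\<^sub>C T (\<gamma> t) (u k))"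
      by (simp add: linear_sum[OF bounded_linear.linear[OF bounded_clinearD(1)]] bounded_clinearD(2))
    then show ?thesis
      by (simp add: sum_left sum_right cinner_scaleC_left cinner_scaleC_right sum_distrib_left mult_ac)
  qed
  ultimately show ?thesis
    by simp
qed

lemma circle_mean_norm:
  fixes u :: "nat \<Rightarrow> 'a::complex_inner"
  assumes r: "0 < r" "r < 1"
  shows "((\<lambda>t. (norm (\<Sum>k<N. circlepath 0 r t ^ k *\<^sub>C u k))\<^sup>2) has_integral
    (\<Sum>n<N. r ^ (2 * n) * (norm (u n))\<^sup>2)) {0..1}"
proof -
  have exp: "(\<lambda>z. cinner x y) has_fps_expansion Abs_fps (\<lambda>n. cinner (if n = 0 then x else 0) y)"
    for x y :: 'a
  proof -
    have "cinner 0 y = 0"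
      using cinner_scaleC_left[of 0 0 y] by simp
    then have "Abs_fps (\<lambda>n. cinner (if n = 0 then x else 0) y) = fps_const (cinner x y)"
      by (intro fps_ext) simp
    then show ?thesis
      by simp
  qed
  have lin: "bounded_clinear (\<lambda>x :: 'a. x)"
    using bounded_linear_ident by (simp add: bounded_clinear_def)
  have delta: "(\<Sum>k\<le>n. if n - k = 0 then u k else 0) = u n" for n
  proof -
    have "(\<Sum>k\<le>n. if n - k = 0 then u k else 0) = (\<Sum>k\<le>n. if k = n then u k else 0)"
      by (intro sum.cong) auto
    then show ?thesis
      by simp
  qed
  have "((\<lambda>t. cinner (\<Sum>k<N. circlepath 0 r t ^ k *\<^sub>C u k) (\<Sum>k<N. circlepath 0 r t ^ k *\<^sub>C u k)) has_integral
    (\<Sum>n<N. complex_of_real (r ^ (2 * n)) * cinner (u n) (u n))) {0..1}"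
    using circle_mean_form[OF lin _ exp r, where u = u and v = u and N = N] unfolding delta by simp
  from has_integral_linear[OF this bounded_linear_Re] show ?thesis
    by (simp add: o_def inner_eq_Re_cinner[symmetric] power2_norm_eq_inner)
qed

context linear_system
begin

text \<open>Let \<open>y\<close> be the response to \<open>u\<close>, and \<open>U\<close>, \<open>V\<close> the polynomials with coefficients \<open>u\<close>, \<open>y\<close>. On a
  circle \<open>Re \<langle>FU, V\<rangle> \<le> (\<parallel>U\<parallel>\<^sup>2 + \<parallel>V\<parallel>\<^sup>2)/2\<close>, and the mean of the left side is the weighted energy of
  \<open>y\<close>. Testing against the truncated output in this way avoids the infinite tail of \<open>FU\<close>.\<close>

theorem dissipative_if_schur:
  assumes "has_schur_continuation A B C D"
  shows dissipative
proof -
  obtain F where F: "op_holomorphic_on F (ball 0 1)" "\<And>z. z \<in> ball 0 1 \<Longrightarrow> onorm (F z) \<le> 1"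
    and eq: "\<forall>\<^sub>F z in nhds 0. F z = transfer_fun A B C D z"
    using assms by (auto simp: has_schur_continuation_def schur_class_def)
  have lin: "bounded_clinear (F z)" if "z \<in> ball 0 1" for z
    using F(1) that by (auto simp: op_holomorphic_on_def)
  have norm_F: "norm (F z x) \<le> norm x" if "z \<in> ball 0 1" for z x
    using onorm[OF bounded_clinearD(1)[OF lin[OF that]], of x] F(2)[OF that]
      mult_right_mono[of "onorm (F z)" 1 "norm x"] by simp
  have cinner_bl: "bounded_linear (\<lambda>x. cinner x y)" for y :: 'y
  proof (rule bounded_linear_intro[where K = "norm y"])
    show "cinner (c *\<^sub>R x) y = c *\<^sub>R cinner x y" for c x
      by (subst scaleR_scaleC[of c x]) (simp add: cinner_scaleC_left scaleR_conv_of_real)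
  qed (simp_all add: cinner_add_left cmod_cinner_le)
  have holo: "(\<lambda>z. cinner (F z x) y) holomorphic_on ball 0 1" for x y
    unfolding holomorphic_on_def
  proof
    fix z :: complex
    assume z: "z \<in> ball 0 1"
    obtain F' where F': "bounded_clinear F'"
      "((\<lambda>w. onorm (\<lambda>u. inverse (w - z) *\<^sub>C (F w u - F z u) - F' u)) \<longlongrightarrow> 0) (at z)"
      using F(1) z unfolding op_holomorphic_on_def by blast
    have "((\<lambda>w. inverse (w - z) *\<^sub>C (F w x - F z x) - F' x) \<longlongrightarrow> 0) (at z)"
    proof (rule Lim_null_comparison)
      have "\<forall>\<^sub>F w in at z. w \<in> ball 0 1"
        using z by (intro eventually_at_in_open') auto
      then show "\<forall>\<^sub>F w in at z. norm (inverse (w - z) *\<^sub>C (F w x - F z x) - F' x)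
          \<le> onorm (\<lambda>u. inverse (w - z) *\<^sub>C (F w u - F z u) - F' u) * norm x"
      proof eventually_elim
        case (elim w)
        have "bounded_linear (\<lambda>u. inverse (w - z) *\<^sub>C (F w u - F z u) - F' u)"
          by (intro bounded_linear_sub bounded_linear_compose[OF bounded_linear_scaleC]
              bounded_clinearD(1) lin elim z F')
        then show ?case
          by (rule onorm)
      qed
      show "((\<lambda>w. onorm (\<lambda>u. inverse (w - z) *\<^sub>C (F w u - F z u) - F' u) * norm x) \<longlongrightarrow> 0) (at z)"
        using tendsto_mult_right[OF F'(2), of "norm x"] by simp
    qed
    then have "((\<lambda>w. inverse (w - z) *\<^sub>C (F w x - F z x)) \<longlongrightarrow> F' x) (at z)"
      by (rule LIM_zero_cancel)
    then have "((\<lambda>w. cinner (inverse (w - z) *\<^sub>C (F w x - F z x)) y) \<longlongrightarrow> cinner (F' x) y) (at z)"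
      by (rule bounded_linear.tendsto[OF cinner_bl])
    then have "((\<lambda>w. (cinner (F w x) y - cinner (F z x) y) / (w - z)) \<longlongrightarrow> cinner (F' x) y) (at z)"
      by (simp add: cinner_scaleC_left linear_diff[OF bounded_linear.linear[OF cinner_bl]]
          divide_inverse mult.commute)
    then have "((\<lambda>z. cinner (F z x) y) has_field_derivative cinner (F' x) y) (at z)"
      by (simp add: has_field_derivative_iff)
    then show "(\<lambda>z. cinner (F z x) y) field_differentiable at z within ball 0 1"
      using field_differentiable_at_within field_differentiable_def by blast
  qed
  have exp: "(\<lambda>z. cinner (F z x) y) has_fps_expansion Abs_fps (\<lambda>n. cinner (markov n x) y)" for x y
  proof (rule has_fps_expansionI)
    show "\<forall>\<^sub>F z in nhds 0. (\<lambda>n. fps_nth (Abs_fps (\<lambda>n. cinner (markov n x) y)) n * z ^ n) sums cinner (F z x) y"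
      using eq transfer_fun_sums_near_0
    proof eventually_elim
      case (elim z)
      then have "(\<lambda>n. cinner (z ^ n *\<^sub>C markov n x) y) sums cinner (F z x) y"
        by (intro bounded_linear.sums[OF cinner_bl]) simp
      then show ?case
        by (simp add: cinner_scaleC_left mult.commute)
    qed
  qed
  show ?thesis
    unfolding dissipative_def
  proof (intro allI)
    fix N u
    define y where "y = response 0 u"
    have weighted: "(\<Sum>n<N. r ^ (2 * n) * ((norm (y n))\<^sup>2 - (norm (u n))\<^sup>2)) \<le> 0"
      if r: "0 < r" "r < 1" for r :: real
    proof -
      define \<gamma> where "\<gamma> = circlepath 0 r"
      define U where "U t = (\<Sum>k<N. \<gamma> t ^ k *\<^sub>C u k)" for t
      define V where "V t = (\<Sum>k<N. \<gamma> t ^ k *\<^sub>C y k)" for t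
      have "((\<lambda>t. cinner (F (\<gamma> t) (U t)) (V t)) has_integral
          (\<Sum>n<N. complex_of_real (r ^ (2 * n)) * cinner (y n) (y n))) {0..1}"
        using circle_mean_form[OF lin holo exp r, where u = u and v = y and N = N]
        unfolding U_def V_def \<gamma>_def y_def response_eq_markov_sum .
      from has_integral_linear[OF this bounded_linear_Re]
      have "((\<lambda>t. inner (F (\<gamma> t) (U t)) (V t)) has_integral (\<Sum>n<N. r ^ (2 * n) * (norm (y n))\<^sup>2)) {0..1}"
        by (simp add: o_def inner_eq_Re_cinner[symmetric] power2_norm_eq_inner)
      moreover have "((\<lambda>t. ((norm (U t))\<^sup>2 + (norm (V t))\<^sup>2) / 2) has_integral
          ((\<Sum>n<N. r ^ (2 * n) * (norm (u n))\<^sup>2) + (\<Sum>n<N. r ^ (2 * n) * (norm (y n))\<^sup>2)) / 2) {0..1}"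
        unfolding U_def V_def \<gamma>_def
        by (intro has_integral_divide has_integral_add circle_mean_norm r)
      moreover have "inner (F (\<gamma> t) (U t)) (V t) \<le> ((norm (U t))\<^sup>2 + (norm (V t))\<^sup>2) / 2" for t
      proof -
        have "\<gamma> t \<in> ball 0 1"
          using r by (simp add: \<gamma>_def circlepath norm_mult)
        then have "norm (F (\<gamma> t) (U t)) * norm (V t) \<le> norm (U t) * norm (V t)"
          by (intro mult_right_mono norm_F) auto
        moreover have "0 \<le> (norm (U t) - norm (V t))\<^sup>2"
          by simp
        ultimately show ?thesis
          using norm_cauchy_schwarz[of "F (\<gamma> t) (U t)" "V t"]
          by (simp add: power2_diff)
      qed
      ultimately have "(\<Sum>n<N. r ^ (2 * n) * (norm (y n))\<^sup>2)
          \<le> ((\<Sum>n<N. r ^ (2 * n) * (norm (u n))\<^sup>2) + (\<Sum>n<N. r ^ (2 * n) * (norm (y n))\<^sup>2)) / 2"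
        by (rule has_integral_le)
      then show ?thesis
        by (simp add: right_diff_distrib sum_subtractf)
    qed
    have "((\<lambda>r. \<Sum>n<N. r ^ (2 * n) * ((norm (y n))\<^sup>2 - (norm (u n))\<^sup>2)) \<longlongrightarrow>
        (\<Sum>n<N. 1 ^ (2 * n) * ((norm (y n))\<^sup>2 - (norm (u n))\<^sup>2))) (at_left 1)"
      by (intro tendsto_intros)
    moreover have "\<forall>\<^sub>F r in at_left 1. (\<Sum>n<N. r ^ (2 * n) * ((norm (y n))\<^sup>2 - (norm (u n))\<^sup>2)) \<le> 0"
    proof -
      have "\<forall>\<^sub>F r in at_left 1. r \<in> {0<..<1::real}"
        by (rule eventually_at_leftI[of 0]) auto
      then show ?thesis
        by eventually_elim (use weighted in auto)
    qed
    ultimately have "(\<Sum>n<N. 1 ^ (2 * n) * ((norm (y n))\<^sup>2 - (norm (u n))\<^sup>2)) \<le> 0"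
      by (rule tendsto_upperbound) simp
    then show "gain N 0 u \<le> 0"
      by (simp add: gain_def y_def)
  qed
qed

end

section \<open>Generalized KYP solutions\<close>

context linear_system
begin

text \<open>The storage function is \<open>\<parallel>H\<^sup>1\<^sup>/\<^sup>2x\<parallel>\<^sup>2\<close>. What has to be known about the root is that it exists and
  is linear.\<close>

lemma dissipative_if_generalized_KYP:
  assumes H: "generalized_KYP_solution A B C D H"
  shows dissipative
proof -
  have "pos_semidef H"
  proof -
    have pd: "pos_def H"
      using H by (simp add: generalized_KYP_solution_def)
    have "0 \<le> Re (cinner (the (H x)) x)" if "x \<in> dom H" for x
    proof (cases "x = 0")
      case True
      then show ?thesis
        using cinner_scaleC_right[of "the (H 0)" 0 0] by simp
    next
      case False
      then show ?thesis
        using pd that by (simp add: pos_def_def less_imp_le)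
    qed
    then show ?thesis
      using pd by (simp add: pos_def_def pos_semidef_def)
  qed
  then obtain P Q where bt: "bounded_transform P Q"
    and H_eq: "H = quotient_op (\<lambda>x. P (P x)) (\<lambda>x. Q (Q x))"
    using pos_semidef_eq_quotient_op by blast
  interpret bt: bounded_transform P Q by fact
  define K where "K = sqrt_op H"
  have "selfadjoint_op K"
    unfolding K_def H_eq bt.sqrt_op_H by (rule bt.K_selfadjoint)
  note lin = linear_opD[OF selfadjoint_opD(1)[OF this]]
  have AK: "A x \<in> dom K" if "x \<in> dom K" for x
    using H that unfolding generalized_KYP_solution_def K_def by blast
  have BK: "B u \<in> dom K" for u
    using H unfolding generalized_KYP_solution_def K_def by blast
  have ineq: "(norm (the (K x)))\<^sup>2 + (norm u)\<^sup>2 - (norm (the (K (A x + B u))))\<^sup>2 - (norm (C x + D u))\<^sup>2 \<ge> 0"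
    if "x \<in> dom K" for x u
    using H that by (simp add: generalized_KYP_solution_def K_def)
  show ?thesis
  proof (rule dissipative_if_storage[where M = "dom K" and S = "\<lambda>x. (norm (the (K x)))\<^sup>2"])
    show "0 \<in> dom K" "(norm (the (K 0)))\<^sup>2 = 0"
      using lin(1) by auto
    fix x u
    assume x: "x \<in> dom K"
    obtain a b where "K (A x) = Some a" "K (B u) = Some b"
      using AK[OF x] BK[of u] by blast
    from lin(2)[OF this] show "A x + B u \<in> dom K"
      by blast
    show "(norm (the (K (A x + B u))))\<^sup>2 + (norm (C x + D u))\<^sup>2 \<le> (norm (the (K x)))\<^sup>2 + (norm u)\<^sup>2"
      using ineq[OF x, of u] by simp
  qed simp
qed

end

context dissipative_system
begin

text \<open>The solution is the operator of the available storage; its root has the domain and the form of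
  the available storage, whose dissipation inequality is the KYP inequality.\<close>

lemma generalized_KYP_exists:
  assumes ctr: "controllable A B" and obs: "observable C A"
  shows "\<exists>H. generalized_KYP_solution A B C D H"
proof -
  have "closure storage_dom = UNIV"
    using ctr closure_mono[OF Rea_subset_storage_dom] by (auto simp: controllable_def)
  then interpret form: closed_form storage_dom storage
    by (rule closed_form_storage)
  obtain P Q where bt: "bounded_transform P Q" and dom: "range P = storage_dom"
    and st: "\<And>w. storage (P w) = (norm (Q w))\<^sup>2"
    using form.representation by blast
  interpret bt: bounded_transform P Q by fact
  have dom_K: "dom bt.K = storage_dom"
    by (simp add: dom_quotient_op dom)
  have norm_K: "(norm (the (bt.K x)))\<^sup>2 = storage x" if "x \<in> storage_dom" for x
  proof -
    obtain w where "x = P w"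
      using \<open>x \<in> storage_dom\<close> dom by blast
    moreover from this have "bt.K x = Some (Q w)"
      using bt.K_iff by blast
    ultimately show ?thesis
      using st by simp
  qed
  have "pos_def bt.H"
    unfolding pos_def_def
  proof (intro conjI ballI impI bt.H_selfadjoint)
    fix x
    assume x: "x \<in> dom bt.H" "x \<noteq> 0"
    then obtain z k where z: "bt.H x = Some z" "bt.K x = Some k"
      using bt.dom_H_subset_dom_K by blast
    have "x \<in> storage_dom"
      using z(2) dom_K by blast
    have "storage x \<noteq> 0"
    proof
      assume 0: "storage x = 0"
      have "C ((A ^^ n) x) = 0" for n
      proof -
        have "(norm (C ((A ^^ n) x)))\<^sup>2 \<le> (\<Sum>k<Suc n. (norm (C ((A ^^ k) x)))\<^sup>2)"
          by (simp add: sum_nonneg)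
        also have "\<dots> \<le> 0"
          using storage_observation[OF \<open>x \<in> storage_dom\<close>, of "Suc n"] 0 by simp
        finally show ?thesis
          by simp
      qed
      then show False
        using observable_imp_eq_0[OF obs] x(2) by blast
    qed
    then have "0 < storage x"
      using storage_nonneg[OF \<open>x \<in> storage_dom\<close>] by simp
    then have "0 < inner z x"
      using bt.H_inner[OF z] norm_K[OF \<open>x \<in> storage_dom\<close>] z(2) by simp
    then show "0 < Re (cinner (the (bt.H x)) x)"
      by (simp add: z(1) inner_eq_Re_cinner)
  qed
  have "generalized_KYP_solution A B C D bt.H"
    unfolding generalized_KYP_solution_def bt.sqrt_op_H dom_K
  proof (intro conjI ballI allI)
    show "closed_op bt.H" "densely_defined bt.H"
      using bt.H_selfadjoint selfadjoint_closed selfadjoint_opD(2) by blast+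
    show "pos_def bt.H"
      by fact
    show "A ` storage_dom \<subseteq> storage_dom"
      using storage_step(1)[of _ 0] by (auto simp: B.zero)
    show "range B \<subseteq> storage_dom"
      using storage_step(1)[OF zero_in_storage_dom] by (auto simp: A.zero)
    fix x u
    assume x: "x \<in> storage_dom"
    show "0 \<le> (norm (the (bt.K x)))\<^sup>2 + (norm u)\<^sup>2 - (norm (the (bt.K (A x + B u))))\<^sup>2 - (norm (C x + D u))\<^sup>2"
      using storage_step(2)[OF x, of u] by (simp add: norm_K x storage_step(1))
  qed
  then show ?thesis
    by blast
qed

end

section \<open>Bounded KYP solutions\<close>

lemma selfadjoint_bounded:
  assumes L: "bounded_clinear L" and sym: "\<And>x y. inner (L x) y = inner x (L y)"
  shows "selfadjoint_op (Some \<circ> L)"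
proof (rule selfadjoint_opI)
  interpret L: bounded_linear L
    by (rule bounded_clinearD[OF L])
  show "linear_op (Some \<circ> L)"
    by (simp add: linear_op_def L.zero L.add bounded_clinearD(2)[OF L])
  show "densely_defined (Some \<circ> L)"
    by (simp add: densely_defined_def dom_def)
  show "inner x' y = inner x y'" if "(Some \<circ> L) x = Some x'" "(Some \<circ> L) y = Some y'" for x x' y y'
    using that sym by auto
  show "(Some \<circ> L) y = Some z"
    if *: "\<And>x x'. (Some \<circ> L) x = Some x' \<Longrightarrow> inner x' y = inner x z" for y z
  proof -
    have "inner x (L y) = inner x z" for x
      using *[of x "L x"] by (simp add: sym)
    then have "L y = z"
      by (rule inner_right_eqI)
    then show ?thesis
      by simp
  qed
qed

lemma strictly_pos_defD:
  assumes "strictly_pos_def (Some \<circ> H)"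
  shows "inner (H x) y = inner x (H y)" and "\<exists>\<delta>>0. \<forall>x. \<delta> * (norm x)\<^sup>2 \<le> inner (H x) x"
  using assms selfadjoint_opD(3)[of "Some \<circ> H" x "H x" y "H y"]
  by (auto simp: strictly_pos_def_def dom_def inner_eq_Re_cinner)

lemma bounded_clinear_block_op:
  assumes "bounded_clinear A" "bounded_clinear B" "bounded_clinear C" "bounded_clinear D"
  shows "bounded_clinear (block_op A B C D)"
proof -
  have "bounded_linear (\<lambda>p. (A (fst p) + B (snd p), C (fst p) + D (snd p)))"
    by (intro bounded_linear_Pair bounded_linear_add
        bounded_linear_compose[OF bounded_clinearD(1)[OF assms(1)] bounded_linear_fst]
        bounded_linear_compose[OF bounded_clinearD(1)[OF assms(2)] bounded_linear_snd]
        bounded_linear_compose[OF bounded_clinearD(1)[OF assms(3)] bounded_linear_fst]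
        bounded_linear_compose[OF bounded_clinearD(1)[OF assms(4)] bounded_linear_snd])
  moreover have "block_op A B C D = (\<lambda>p. (A (fst p) + B (snd p), C (fst p) + D (snd p)))"
    by (auto simp: block_op_def)
  ultimately show ?thesis
    using assms[THEN bounded_clinearD(2)] by (simp add: bounded_clinear_def scaleC_prod_def scaleC_add_right)
qed

context linear_system
begin

lemma KYP_inequality_iff:
  assumes H: "bounded_clinear H" and sym: "\<And>x y. inner (H x) y = inner x (H y)"
  shows "KYP_inequality A B C D H \<longleftrightarrow>
    (\<forall>x u. inner (H (A x + B u)) (A x + B u) + (norm (C x + D u))\<^sup>2 \<le> inner (H x) x + (norm u)\<^sup>2)"
proof -
  define T where "T = block_op A B C D"
  define HX :: "'x \<times> 'u \<Rightarrow> 'x \<times> 'u" where "HX = block_op H (\<lambda>_. 0) (\<lambda>_. 0) id"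
  define HY :: "'x \<times> 'y \<Rightarrow> 'x \<times> 'y" where "HY = block_op H (\<lambda>_. 0) (\<lambda>_. 0) id"
  define L where "L p = HX p - cadjoint T (HY (T p))" for p
  have T: "bounded_clinear T"
    unfolding T_def by (intro bounded_clinear_block_op A B C D)
  have zero_clinear: "bounded_clinear (\<lambda>_::'a::complex_inner. 0 :: 'b::complex_inner)"
    by (simp add: bounded_clinear_def)
  have id_clinear: "bounded_clinear (id :: 'a::complex_inner \<Rightarrow> 'a)"
    using bounded_linear_ident by (simp add: bounded_clinear_def id_def)
  have HX: "bounded_clinear HX"
    unfolding HX_def by (intro bounded_clinear_block_op H zero_clinear id_clinear)
  have HY: "bounded_clinear HY"
    unfolding HY_def by (intro bounded_clinear_block_op H zero_clinear id_clinear)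
  have symX: "inner (HX p) q = inner p (HX q)" for p q
    by (cases p; cases q) (simp add: HX_def block_op_def sym)
  have symY: "inner (HY p) q = inner p (HY q)" for p q
    by (cases p; cases q) (simp add: HY_def block_op_def sym)
  have TT: "bounded_clinear (\<lambda>p. cadjoint T (HY (T p)))"
    by (rule bounded_clinear_compose[OF cadjoint(3)[OF T] bounded_clinear_compose[OF HY T]])
  have "bounded_linear L"
    unfolding L_def[abs_def] by (intro bounded_linear_sub bounded_clinearD(1)[OF HX] bounded_clinearD(1)[OF TT])
  then have L: "bounded_clinear L"
    by (simp add: bounded_clinear_def L_def bounded_clinearD(2)[OF HX] bounded_clinearD(2)[OF TT]
        complex_vector.scale_right_diff_distrib)
  have adj: "inner (cadjoint T p) q = inner p (T q)" for p q
    using cadjoint(2)[OF T, of q p] by (simp add: inner_commute)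
  have symL: "inner (L p) q = inner p (L q)" for p q
    by (simp add: L_def inner_diff_left inner_diff_right symX adj symY flip: cadjoint(2)[OF T])
  have "KYP_inequality A B C D H \<longleftrightarrow> pos_semidef (Some \<circ> L)"
    unfolding KYP_inequality_def loewner_le_def L_def[abs_def] T_def HX_def HY_def by (simp add: comp_def)
  also have "\<dots> \<longleftrightarrow> (\<forall>p. 0 \<le> inner (L p) p)"
    using selfadjoint_bounded[OF L symL] by (simp add: pos_semidef_def dom_def inner_eq_Re_cinner)
  also have "\<dots> \<longleftrightarrow> (\<forall>x u. 0 \<le> inner (L (x, u)) (x, u))"
    by simp
  also have "(\<lambda>x u. inner (L (x, u)) (x, u)) = (\<lambda>x u. inner (H x) x + (norm u)\<^sup>2
      - (inner (H (A x + B u)) (A x + B u) + (norm (C x + D u))\<^sup>2))"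
    by (intro ext) (simp add: L_def inner_diff_left adj, simp add: HX_def HY_def T_def block_op_def power2_norm_eq_inner)
  then have "(\<forall>x u. 0 \<le> inner (L (x, u)) (x, u)) \<longleftrightarrow> (\<forall>x u. inner (H (A x + B u)) (A x + B u) + (norm (C x + D u))\<^sup>2
      \<le> inner (H x) x + (norm u)\<^sup>2)"
    by (simp add: fun_eq_iff)
  finally show ?thesis .
qed

text \<open>The form of \<open>H\<close> is a storage function, and it is equivalent to the squared norm. It does not
  increase along the free evolution, so the powers of \<open>A\<close> are uniformly bounded.\<close>

lemma bounded_KYP_consequences:
  assumes H: "bounded_clinear H" "strictly_pos_def (Some \<circ> H)" "KYP_inequality A B C D H"
  shows dissipative and "\<exists>M\<ge>0. \<forall>n x. norm ((A ^^ n) x) \<le> M * norm x"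
proof -
  note sym = strictly_pos_defD(1)[OF H(2)]
  obtain \<delta> where \<delta>: "\<delta> > 0" "\<And>x. \<delta> * (norm x)\<^sup>2 \<le> inner (H x) x"
    using strictly_pos_defD(2)[OF H(2)] by blast
  have nonneg: "0 \<le> inner (H x) x" for x
    using \<delta>(1) by (intro order_trans[OF _ \<delta>(2)]) simp
  have ineq: "inner (H (A x + B u)) (A x + B u) + (norm (C x + D u))\<^sup>2 \<le> inner (H x) x + (norm u)\<^sup>2" for x u
    using KYP_inequality_iff[OF H(1) sym] H(3) by blast
  show dissipative
    by (rule dissipative_if_storage[where M = UNIV and S = "\<lambda>x. inner (H x) x"]) (use ineq nonneg in auto)
  have step: "inner (H (A x)) (A x) \<le> inner (H x) x" for x
  proof -
    have "inner (H (A x)) (A x) + (norm (C x))\<^sup>2 \<le> inner (H x) x"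
      using ineq[of x 0] by (simp add: B.zero D.zero)
    then show ?thesis
      using zero_le_power2[of "norm (C x)"] by linarith
  qed
  have An: "inner (H ((A ^^ n) x)) ((A ^^ n) x) \<le> inner (H x) x" for n x
  proof (induction n)
    case (Suc n)
    then show ?case
      using order_trans[OF step] by simp
  qed simp
  define M where "M = sqrt (onorm H / \<delta>)"
  have oH: "0 \<le> onorm H"
    by (rule onorm_pos_le[OF bounded_clinearD(1)[OF H(1)]])
  have "norm ((A ^^ n) x) \<le> M * norm x" for n x
  proof (rule power2_le_imp_le)
    have "\<delta> * (norm ((A ^^ n) x))\<^sup>2 \<le> inner (H x) x"
      using \<delta>(2) An order_trans by blast
    also have "\<dots> \<le> norm (H x) * norm x"
      by (rule norm_cauchy_schwarz)
    also have "\<dots> \<le> onorm H * norm x * norm x"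
      by (intro mult_right_mono onorm bounded_clinearD(1)[OF H(1)]) simp
    finally have "(norm ((A ^^ n) x))\<^sup>2 \<le> onorm H / \<delta> * (norm x)\<^sup>2"
      using \<delta>(1) by (simp add: field_simps power2_eq_square)
    then show "(norm ((A ^^ n) x))\<^sup>2 \<le> (M * norm x)\<^sup>2"
      using oH \<delta>(1) by (simp add: M_def power_mult_distrib)
    show "0 \<le> M * norm x"
      using oH \<delta>(1) by (simp add: M_def)
  qed
  moreover have "0 \<le> M"
    using oH \<delta>(1) by (simp add: M_def)
  ultimately show "\<exists>M\<ge>0. \<forall>n x. norm ((A ^^ n) x) \<le> M * norm x"
    by blast
qed

text \<open>Neumann series converge on the open disk, both for \<open>1 - zA\<close> and, outside the closed disk, for
  \<open>z - A = z(1 - z\<^sup>-\<^sup>1A)\<close>.\<close>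

lemma power_bounded_consequences:
  assumes "M \<ge> 0" and bound: "\<And>n x. norm ((A ^^ n) x) \<le> M * norm x" and diss: dissipative
  shows "spectral_radius A \<le> 1" and "ball 0 1 \<subseteq> transfer_domain A"
    and "op_holomorphic_on (transfer_fun A B C D) (ball 0 1)"
proof -
  have bound': "norm ((A ^^ n) x) \<le> M * 1 ^ n * norm x" for n x
    using bound by simp
  have inv: "bounded_invertible (\<lambda>x. x - z *\<^sub>C A x)" if "cmod z < 1" for z
    using neumann_series(1)[OF A bound' assms(1)] that by simp
  then show "ball 0 1 \<subseteq> transfer_domain A"
    by (auto simp: transfer_domain_def)
  have "cmod z \<le> 1" if z: "z \<in> spectrum A" for z
  proof (rule ccontr)
    assume "\<not> cmod z \<le> 1"
    then have z0: "z \<noteq> 0" and "cmod (inverse z) < 1"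
      by (auto simp: norm_inverse inverse_less_1_iff)
    define T where "T x = x - inverse z *\<^sub>C A x" for x
    obtain S where TS: "bounded_clinear T" "bounded_clinear S" "S \<circ> T = id" "T \<circ> S = id"
      using inv[OF \<open>cmod (inverse z) < 1\<close>] unfolding bounded_invertible_def T_def[abs_def] by blast
    have scale: "bounded_clinear (\<lambda>x::'x. c *\<^sub>C x)" for c
      by (simp add: bounded_clinear_def bounded_linear_scaleC scaleC_scaleC mult.commute)
    have eq: "z *\<^sub>C x - A x = z *\<^sub>C T x" for x
      using z0 by (simp add: T_def complex_vector.scale_right_diff_distrib scaleC_scaleC scaleC_one)
    have "bounded_invertible (\<lambda>x. z *\<^sub>C x - A x)"
      unfolding bounded_invertible_def eq
    proof (intro conjI exI[of _ "\<lambda>x. inverse z *\<^sub>C S x"])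
      show "bounded_clinear (\<lambda>x. z *\<^sub>C T x)" "bounded_clinear (\<lambda>x. inverse z *\<^sub>C S x)"
        by (rule bounded_clinear_compose[OF scale] TS)+
      show "(\<lambda>x. inverse z *\<^sub>C S x) \<circ> (\<lambda>x. z *\<^sub>C T x) = id" "(\<lambda>x. z *\<^sub>C T x) \<circ> (\<lambda>x. inverse z *\<^sub>C S x) = id"
        using TS z0 by (auto simp: fun_eq_iff bounded_clinearD(2)[OF TS(2)] bounded_clinearD(2)[OF TS(1)]
            scaleC_scaleC scaleC_one)
    qed
    then show False
      using z by (simp add: spectrum_def)
  qed
  then show "spectral_radius A \<le> 1"
    unfolding spectral_radius_def by (intro SUP_least) (simp add: ennreal_le_1)
  show "op_holomorphic_on (transfer_fun A B C D) (ball 0 1)"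
  proof (rule op_holomorphic_power_series[OF markov_clinear, where M = 1])
    show "norm (markov n u) \<le> 1 * norm u" for n u
      using markov_bound[OF diss] by simp
    show "(\<lambda>n. z ^ n *\<^sub>C markov n u) sums transfer_fun A B C D z u" if "z \<in> ball 0 1" for z u
      by (rule transfer_fun_sums[OF bound' assms(1)]) (use that in auto)
  qed simp
qed

end

context dissipative_system
begin

text \<open>A finite available storage is bounded, so its root \<open>K\<close> is a bounded operator on the whole space
  and \<open>H = K\<^sup>2\<close> represents it.\<close>

lemma bounded_KYP_exists:
  assumes dom: "storage_dom = UNIV" and \<delta>: "\<delta> > 0" "\<And>x. \<delta> * (norm x)\<^sup>2 \<le> storage x"
  shows "\<exists>H. bounded_clinear H \<and> strictly_pos_def (Some \<circ> H) \<and> KYP_inequality A B C D H"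
proof -
  interpret form: closed_form storage_dom storage
    by (rule closed_form_storage) (simp add: dom)
  obtain P Q where bt: "bounded_transform P Q" and rP: "range P = UNIV"
    and st: "\<And>w. storage (P w) = (norm (Q w))\<^sup>2"
    using form.representation unfolding dom by blast
  interpret bt: bounded_transform P Q by fact
  obtain M where M: "M \<ge> 0" "\<And>x. storage x \<le> M * (norm x)\<^sup>2"
    using storage_bounded[OF dom] by blast
  note sa = bt.K_selfadjoint
  note lin = linear_opD[OF selfadjoint_opD(1)[OF sa]]
  define K where "K x = the (bt.K x)" for x
  have K: "bt.K x = Some (K x)" and norm_K: "(norm (K x))\<^sup>2 = storage x" for x
  proof -
    obtain w where w: "x = P w"
      using rP by blast
    then have "bt.K x = Some (Q w)"
      using bt.K_iff by blast
    then show "bt.K x = Some (K x)" "(norm (K x))\<^sup>2 = storage x"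
      by (simp_all add: K_def w st)
  qed
  have K_add: "K (x + y) = K x + K y" for x y
    using lin(2)[OF K[of x] K[of y]] K[of "x + y"] by simp
  have K_scaleC: "K (c *\<^sub>C x) = c *\<^sub>C K x" for c x
    using lin(3)[OF K[of x], of c] K[of "c *\<^sub>C x"] by simp
  have K_norm: "norm (K x) \<le> norm x * sqrt M" for x
  proof (rule power2_le_imp_le)
    show "(norm (K x))\<^sup>2 \<le> (norm x * sqrt M)\<^sup>2"
      using M(2)[of x] M(1) by (simp add: norm_K power_mult_distrib mult.commute)
  qed (use M in simp)
  have Kc: "bounded_clinear K"
    unfolding bounded_clinear_def
    by (intro conjI allI K_scaleC bounded_linear_intro[OF K_add _ K_norm]) (simp add: scaleR_scaleC K_scaleC)
  have K_sym: "inner (K x) y = inner x (K y)" for x y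
    by (rule selfadjoint_opD(3)[OF sa K K])
  define H where "H x = K (K x)" for x
  have H: "bounded_clinear H"
    unfolding H_def[abs_def] by (rule bounded_clinear_compose[OF Kc Kc])
  have H_sym: "inner (H x) y = inner x (H y)" for x y
    by (simp add: H_def K_sym)
  have H_form: "inner (H x) x = storage x" for x
    by (simp add: H_def K_sym power2_norm_eq_inner flip: norm_K)
  have "strictly_pos_def (Some \<circ> H)"
    unfolding strictly_pos_def_def
    using selfadjoint_bounded[OF H H_sym] \<delta> by (auto simp: H_form simp flip: inner_eq_Re_cinner)
  moreover have "KYP_inequality A B C D H"
    unfolding KYP_inequality_iff[OF H H_sym] H_form using storage_step(2) dom by blast
  ultimately show ?thesis
    using H by blast
qed

end

context linear_system
begin

text \<open>The two hypotheses are what exact controllability and exact observability contribute, in the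
  algebraic as well as in the \<open>\<ell>\<^sup>2\<close> version.\<close>

lemma bounded_KYP_characterization:
  assumes dom: "dissipative_system A B C D \<Longrightarrow> storage_dom = UNIV"
    and dir: "\<And>y. \<exists>c. \<forall>x. unit_observed x \<longrightarrow> \<bar>inner x y\<bar> \<le> c"
  shows "(has_schur_continuation A B C D \<longleftrightarrow>
      (\<exists>H. bounded_clinear H \<and> strictly_pos_def (Some \<circ> H) \<and> KYP_inequality A B C D H))
    \<and> (has_schur_continuation A B C D \<longrightarrow> spectral_radius A \<le> 1 \<and> ball 0 1 \<subseteq> transfer_domain A \<and>
        op_holomorphic_on (transfer_fun A B C D) (ball 0 1))"
proof -
  have ex: "\<exists>H. bounded_clinear H \<and> strictly_pos_def (Some \<circ> H) \<and> KYP_inequality A B C D H"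
    if "has_schur_continuation A B C D"
  proof -
    interpret dissipative_system A B C D
      by unfold_locales (rule dissipative_if_schur[OF that])
    have "storage_dom = UNIV"
      by (rule dom) unfold_locales
    obtain \<delta> where "\<delta> > 0"
      "\<And>x e. (\<forall>N. (\<Sum>n<N. (norm (C ((A ^^ n) x)))\<^sup>2) \<le> e) \<Longrightarrow> \<delta> * (norm x)\<^sup>2 \<le> e"
      using coercive_if_observable_directions[OF dir] by blast
    then show ?thesis
      using bounded_KYP_exists \<open>storage_dom = UNIV\<close> storage_observation by blast
  qed
  moreover have "has_schur_continuation A B C D"
    if "bounded_clinear H" "strictly_pos_def (Some \<circ> H)" "KYP_inequality A B C D H" for H
    using schur_if_dissipative[OF bounded_KYP_consequences(1)[OF that]] .
  moreover have "spectral_radius A \<le> 1 \<and> ball 0 1 \<subseteq> transfer_domain A \<and>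
        op_holomorphic_on (transfer_fun A B C D) (ball 0 1)" if schur: "has_schur_continuation A B C D"
  proof -
    obtain H where H: "bounded_clinear H" "strictly_pos_def (Some \<circ> H)" "KYP_inequality A B C D H"
      using ex[OF schur] by blast
    obtain M where "M \<ge> 0" "\<And>n x. norm ((A ^^ n) x) \<le> M * norm x"
      using bounded_KYP_consequences(2)[OF H] by blast
    from power_bounded_consequences[OF this dissipative_if_schur[OF schur]] show ?thesis
      by blast
  qed
  ultimately show ?thesis
    by blast
qed

end

theorem theorem1p3:
  fixes A :: "'x::chilbert_space \<Rightarrow> 'x"
    and B :: "'u::chilbert_space \<Rightarrow> 'x"
    and C :: "'x \<Rightarrow> 'y::chilbert_space"
    and D :: "'u \<Rightarrow> 'y"
  assumes "bounded_clinear A" and "bounded_clinear B"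
    and "bounded_clinear C" and "bounded_clinear D"
  shows
    "(minimal A B C \<longrightarrow>
        (has_schur_continuation A B C D \<longleftrightarrow> (\<exists>H. generalized_KYP_solution A B C D H)))
     \<and>
     (exactly_minimal A B C \<longrightarrow>
        (has_schur_continuation A B C D \<longleftrightarrow>
          (\<exists>H. bounded_clinear H \<and> strictly_pos_def (Some \<circ> H) \<and> KYP_inequality A B C D H))
        \<and> (has_schur_continuation A B C D \<longrightarrow>
            spectral_radius A \<le> 1 \<and>
            ball 0 1 \<subseteq> transfer_domain A \<and>
            op_holomorphic_on (transfer_fun A B C D) (ball 0 1)))
     \<and>
     (l2_exactly_minimal A B C \<longrightarrow>
        (has_schur_continuation A B C D \<longleftrightarrow>
          (\<exists>H. bounded_clinear H \<and> strictly_pos_def (Some \<circ> H) \<and> KYP_inequality A B C D H))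
        \<and> (has_schur_continuation A B C D \<longrightarrow>
            spectral_radius A \<le> 1 \<and>
            ball 0 1 \<subseteq> transfer_domain A \<and>
            op_holomorphic_on (transfer_fun A B C D) (ball 0 1)))"
proof -
  interpret linear_system A B C D
    using assms by unfold_locales
  have "\<exists>H. generalized_KYP_solution A B C D H" if "minimal A B C" "has_schur_continuation A B C D"
    using dissipative_system.generalized_KYP_exists[of A B C D] dissipative_if_schur[OF that(2)] that(1)
    by (simp add: minimal_def dissipative_system_def dissipative_system_axioms_def linear_system_axioms)
  then have 1: "has_schur_continuation A B C D \<longleftrightarrow> (\<exists>H. generalized_KYP_solution A B C D H)"
    if "minimal A B C"
    using that schur_if_dissipative dissipative_if_generalized_KYP by blast
  have dom2: "storage_dom = UNIV" if "exactly_minimal A B C" "dissipative_system A B C D"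
    using dissipative_system.Rea_subset_storage_dom[OF that(2)] that(1)
    by (auto simp: exactly_minimal_def exactly_controllable_def)
  have dir2: "\<exists>c. \<forall>x. unit_observed x \<longrightarrow> \<bar>inner x y\<bar> \<le> c" if "exactly_minimal A B C" for y
  proof -
    have "y \<in> Obs C A"
      using that by (simp add: exactly_minimal_def exactly_observable_def)
    then show ?thesis
      using Obs_bounded_direction abs_Re_le_cmod order_trans unfolding inner_eq_Re_cinner by metis
  qed
  have dom3: "storage_dom = UNIV" if "l2_exactly_minimal A B C" "dissipative_system A B C D"
    using dissipative_system.l2_exactly_controllable_storage_dom[OF that(2)] that(1)
    by (simp add: l2_exactly_minimal_def)
  have dir3: "\<exists>c. \<forall>x. unit_observed x \<longrightarrow> \<bar>inner x y\<bar> \<le> c" if "l2_exactly_minimal A B C" for y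
    using l2_exactly_observable_direction that by (simp add: l2_exactly_minimal_def)
  show ?thesis
    using 1 bounded_KYP_characterization[OF dom2 dir2] bounded_KYP_characterization[OF dom3 dir3]
    by blast
qed

end
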